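(* Let $S$ be an inverse semigroup and $K$ a field. Fix a set $D\subseteq\widehat{E(S)}$ containing exactly one finite index character from each orbit of finite index characters under the spectral action of $S$ on $\widehat{E(S)}$. For a character $\varphi$, let $S_\varphi$ be the stabilizer of $\varphi$ and let $G_\varphi$ be the maximal group image of $S_\varphi$. Then there is a bijection between finite dimensional simple $KS$-modules (up to isomorphism) and pairs $(\varphi,V)$ where $\varphi\in D$ and $V$ is a finite dimensional simple $KG_\varphi$-module (considered up to isomorphism).
   Context: An inverse semigroup is a semigroup $S$ such that each $s\in S$ has a unique $s^*$ with $ss^*s=s$, $s^*ss^*=s^*$. $E(S)$ is its commutative semigroup of idempotents; $s\le t$ iff $s=et$ for some $e\in E(S)$. $KS$ is the semigroup algebra; modules $V$ over a $K$-algebra $A$ (including simple ones) are assumed non-degenerate, i.e. $AV=V$. $\widehat{E(S)}$ is the space of characters, i.e. non-zero semilattice homomorphisms $\varphi\colon E(S)\to\{0,1\}$, topologized as a subspace of $\{0,1\}^{E(S)}$; $D(e)=\{\varphi\mid\varphi(e)=1\}$. The spectral action of $S$ on $\widehat{E(S)}$ sends $s\in S$ to the partial homeomorphism $D(s^*s)\to D(ss^* )$, $\varphi\mapsto s\varphi$, $(s\varphi)(e)=\varphi(s^*es)$. The orbit of $\varphi$ is $\{s\varphi\mid s\in S,\ \varphi(s^*s)=1\}$; $\varphi$ has finite index if its orbit is finite. The stabilizer is the inverse subsemigroup $S_\varphi=\{s\in S\mid \varphi(s^*s)=1,\ s\varphi=\varphi\}$. The maximal group image of an inverse semigroup $T$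 is the group $T/{\sim}$ where $s\sim t$ iff $s$ and $t$ have a common lower bound in $T$ in the natural partial order. *)

theory Defs
  imports Complex_Main "HOL-Algebra.Group" "HOL-Library.Poly_Mapping" "HOL-Library.FuncSet"
begin

section \<open>Inverse semigroups\<close>

class inverse_semigroup = semigroup_mult +
  assumes ex1_star: "\<exists>!t. s * t * s = s \<and> t * s * t = t"

definition star :: "'s::inverse_semigroup \<Rightarrow> 's" where
  "star s = (THE t. s * t * s = s \<and> t * s * t = t)"

definition idems :: "'s::semigroup_mult set" where
  "idems = {e. e * e = e}"

text \<open>The natural partial order of a subsemigroup \<open>T\<close>; the idempotent is required to lie in \<open>T\<close>.\<close>

definition natural_le :: "'s::semigroup_mult set \<Rightarrow> 's \<Rightarrow> 's \<Rightarrow> bool" where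
  "natural_le T s t \<longleftrightarrow> (\<exists>e \<in> idems \<inter> T. s = e * t)"

definition max_group_rel :: "'s::semigroup_mult set \<Rightarrow> ('s \<times> 's) set" where
  "max_group_rel T =
     {(s, t). s \<in> T \<and> t \<in> T \<and> (\<exists>u \<in> T. natural_le T u s \<and> natural_le T u t)}"

text \<open>For an inverse subsemigroup \<open>T\<close>, the idempotents of \<open>T\<close> form one class, which is the
  identity of the quotient; see \<open>group_max_group_image\<close> below.\<close>

definition max_group_image :: "'s::semigroup_mult set \<Rightarrow> 's set monoid" where
  "max_group_image T =
     \<lparr>carrier = T // max_group_rel T,
      mult = (\<lambda>X Y. \<Union>x\<in>X. \<Union>y\<in>Y. max_group_rel T `` {x * y}),
      one = max_group_rel T `` (idems \<inter> T)\<rparr>"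


section \<open>Characters and the spectral action\<close>

text \<open>The semilattice \<open>{0,1}\<close> is \<^typ>\<open>bool\<close> with conjunction. Characters are functions on
  \<^term>\<open>idems\<close>, hence extensional, so that equality of characters is equality on idempotents.\<close>

definition characters :: "('s::inverse_semigroup \<Rightarrow> bool) set" where
  "characters = {\<phi> \<in> extensional idems.
     (\<forall>e\<in>idems. \<forall>f\<in>idems. \<phi> (e * f) \<longleftrightarrow> \<phi> e \<and> \<phi> f) \<and> (\<exists>e\<in>idems. \<phi> e)}"

text \<open>\<open>spectral_act s \<phi>\<close> is meaningful only on the domain of \<open>s\<close>, i.e. if \<open>\<phi> (star s * s)\<close>.\<close>

definition spectral_act :: "'s::inverse_semigroup \<Rightarrow> ('s \<Rightarrow> bool) \<Rightarrow> ('s \<Rightarrow> bool)" where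
  "spectral_act s \<phi> = (\<lambda>e\<in>idems. \<phi> (star s * e * s))"

definition spectral_orbit :: "('s::inverse_semigroup \<Rightarrow> bool) \<Rightarrow> ('s \<Rightarrow> bool) set" where
  "spectral_orbit \<phi> = {spectral_act s \<phi> | s. \<phi> (star s * s)}"

definition finite_index :: "('s::inverse_semigroup \<Rightarrow> bool) \<Rightarrow> bool" where
  "finite_index \<phi> \<longleftrightarrow> finite (spectral_orbit \<phi>)"

definition stabilizer :: "('s::inverse_semigroup \<Rightarrow> bool) \<Rightarrow> 's set" where
  "stabilizer \<phi> = {s. \<phi> (star s * s) \<and> spectral_act s \<phi> = \<phi>}"


section \<open>Modules over semigroup algebras\<close>

text \<open>The semigroup algebra of the semigroup with carrier \<open>M\<close> and multiplication \<open>m\<close> consists of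
  the finitely supported functions with support in \<open>M\<close>, with convolution as product. (The
  multiplication of \<^typ>\<open>'a \<Rightarrow>\<^sub>0 'b\<close> in the library needs an additive monoid structure
  on \<open>'a\<close>.)\<close>

definition pm_scale :: "'k::field \<Rightarrow> ('a \<Rightarrow>\<^sub>0 'k) \<Rightarrow> ('a \<Rightarrow>\<^sub>0 'k)" where
  "pm_scale c f = Poly_Mapping.map ((*) c) f"

definition semigroup_algebra :: "'g set \<Rightarrow> ('g \<Rightarrow>\<^sub>0 'k::field) set" where
  "semigroup_algebra M = {f. Poly_Mapping.keys f \<subseteq> M}"

definition convolution ::
    "('g \<Rightarrow> 'g \<Rightarrow> 'g) \<Rightarrow> ('g \<Rightarrow>\<^sub>0 'k::field) \<Rightarrow> ('g \<Rightarrow>\<^sub>0 'k) \<Rightarrow> ('g \<Rightarrow>\<^sub>0 'k)" where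
  "convolution m f g =
     (\<Sum>s\<in>Poly_Mapping.keys f. \<Sum>t\<in>Poly_Mapping.keys g.
        Poly_Mapping.single (m s t) (Poly_Mapping.lookup f s * Poly_Mapping.lookup g t))"

text \<open>The underlying vector space of a module is a subspace, the carrier, of an ambient vector
  space with scalar multiplication \<open>scale\<close>. The action is a total function, of which only the
  values on algebra elements and carrier elements matter.\<close>

record ('a, 'v) alg_module = "'v partial_object" +
  act :: "'a \<Rightarrow> 'v \<Rightarrow> 'v"

definition nondegenerate_module ::
    "('k::field \<Rightarrow> 'v::ab_group_add \<Rightarrow> 'v) \<Rightarrow> 'g set \<Rightarrow> ('g \<Rightarrow> 'g \<Rightarrow> 'g) \<Rightarrow>
     ('g \<Rightarrow>\<^sub>0 'k, 'v) alg_module \<Rightarrow> bool" where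
  "nondegenerate_module scale M m V \<longleftrightarrow>
     module.subspace scale (carrier V) \<and>
     (\<forall>a\<in>semigroup_algebra M. \<forall>v\<in>carrier V. act V a v \<in> carrier V) \<and>
     (\<forall>a\<in>semigroup_algebra M. \<forall>v\<in>carrier V. \<forall>w\<in>carrier V.
        act V a (v + w) = act V a v + act V a w) \<and>
     (\<forall>a\<in>semigroup_algebra M. \<forall>b\<in>semigroup_algebra M. \<forall>v\<in>carrier V.
        act V (a + b) v = act V a v + act V b v) \<and>
     (\<forall>c. \<forall>a\<in>semigroup_algebra M. \<forall>v\<in>carrier V.
        act V a (scale c v) = scale c (act V a v) \<and>
        act V (pm_scale c a) v = scale c (act V a v)) \<and>
     (\<forall>a\<in>semigroup_algebra M. \<forall>b\<in>semigroup_algebra M. \<forall>v\<in>carrier V.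
        act V (convolution m a b) v = act V a (act V b v)) \<and>
     module.span scale {act V a v | a v. a \<in> semigroup_algebra M \<and> v \<in> carrier V} = carrier V"

definition submodule_of ::
    "('k::field \<Rightarrow> 'v::ab_group_add \<Rightarrow> 'v) \<Rightarrow> 'g set \<Rightarrow> 'v set \<Rightarrow>
     ('g \<Rightarrow>\<^sub>0 'k, 'v) alg_module \<Rightarrow> bool" where
  "submodule_of scale M W V \<longleftrightarrow>
     W \<subseteq> carrier V \<and> module.subspace scale W \<and>
     (\<forall>a\<in>semigroup_algebra M. \<forall>w\<in>W. act V a w \<in> W)"

definition simple_module ::
    "('k::field \<Rightarrow> 'v::ab_group_add \<Rightarrow> 'v) \<Rightarrow> 'g set \<Rightarrow> ('g \<Rightarrow> 'g \<Rightarrow> 'g) \<Rightarrow>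
     ('g \<Rightarrow>\<^sub>0 'k, 'v) alg_module \<Rightarrow> bool" where
  "simple_module scale M m V \<longleftrightarrow>
     nondegenerate_module scale M m V \<and> carrier V \<noteq> {0} \<and>
     (\<forall>W. submodule_of scale M W V \<longrightarrow> W = {0} \<or> W = carrier V)"

definition finite_dim_module ::
    "('k::field \<Rightarrow> 'v::ab_group_add \<Rightarrow> 'v) \<Rightarrow> ('a, 'v) alg_module \<Rightarrow> bool" where
  "finite_dim_module scale V \<longleftrightarrow> (\<exists>B. finite B \<and> carrier V = module.span scale B)"

definition module_iso ::
    "('k::field \<Rightarrow> 'v::ab_group_add \<Rightarrow> 'v) \<Rightarrow> ('k \<Rightarrow> 'w::ab_group_add \<Rightarrow> 'w) \<Rightarrow> 'g set \<Rightarrow>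
     ('g \<Rightarrow>\<^sub>0 'k, 'v) alg_module \<Rightarrow> ('g \<Rightarrow>\<^sub>0 'k, 'w) alg_module \<Rightarrow> bool" where
  "module_iso scale1 scale2 M V W \<longleftrightarrow> (\<exists>h. bij_betw h (carrier V) (carrier W) \<and>
     (\<forall>v\<in>carrier V. \<forall>v'\<in>carrier V. h (v + v') = h v + h v') \<and>
     (\<forall>c. \<forall>v\<in>carrier V. h (scale1 c v) = scale2 c (h v)) \<and>
     (\<forall>a\<in>semigroup_algebra M. \<forall>v\<in>carrier V. h (act V a v) = act W a (h v)))"

text \<open>To have a set of isomorphism classes, we take the modules whose underlying vector spaces are
  subspaces of the space \<^typ>\<open>nat \<Rightarrow>\<^sub>0 'k\<close> of countable dimension. Every finite dimensional
  simple module over any ambient space is isomorphic to one of these; see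
  \<open>finite_dim_simple_module_model\<close> below.\<close>

definition fd_simple_modules ::
    "'k::field itself \<Rightarrow> 'g set \<Rightarrow> ('g \<Rightarrow> 'g \<Rightarrow> 'g) \<Rightarrow>
     ('g \<Rightarrow>\<^sub>0 'k, nat \<Rightarrow>\<^sub>0 'k) alg_module set" where
  "fd_simple_modules _ M m =
     {V. simple_module pm_scale M m V \<and> finite_dim_module pm_scale V}"

definition fd_simple_classes ::
    "'k::field itself \<Rightarrow> 'g set \<Rightarrow> ('g \<Rightarrow> 'g \<Rightarrow> 'g) \<Rightarrow>
     ('g \<Rightarrow>\<^sub>0 'k, nat \<Rightarrow>\<^sub>0 'k) alg_module set set" where
  "fd_simple_classes K M m =
     fd_simple_modules K M m //
       {(V, W). V \<in> fd_simple_modules K M m \<and> W \<in> fd_simple_modules K M m \<and>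
                module_iso pm_scale pm_scale M V W}"


section \<open>The maximal group image of a stabilizer is a group\<close>

lemma star_props: "s * star s * s = s" "star s * s * star s = star s"
  using theI'[OF ex1_star[of s]] by (auto simp: star_def)

lemma star_unique: "s * t * s = s \<Longrightarrow> t * s * t = t \<Longrightarrow> star s = t"
  using ex1_star[of s] star_props[of s] by blast

lemma star_star [simp]: "star (star s) = s"
  by (rule star_unique) (simp_all add: star_props)

lemma idems_star: "e \<in> idems \<Longrightarrow> star e = e"
  by (rule star_unique) (simp_all add: idems_def)

lemma star_mult_idem: "star s * s \<in> idems" "s * star s \<in> idems"
proof -
  have "(star s * s) * (star s * s) = (star s * s * star s) * s" by (simp add: mult.assoc)
  then show "star s * s \<in> idems" by (simp add: idems_def star_props)
  have "(s * star s) * (s * star s) = (s * star s * s) * star s" by (simp add: mult.assoc)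
  then show "s * star s \<in> idems" by (simp add: idems_def star_props)
qed

lemma idems_mult_closed:
  fixes e :: "'s::inverse_semigroup"
  assumes "e \<in> idems" "f \<in> idems"
  shows "e * f \<in> idems"
proof -
  have e: "e * e = e" and f: "f * f = f" using assms by (auto simp: idems_def)
  have e': "e * (e * y) = e * y" for y by (simp add: e flip: mult.assoc)
  have f': "f * (f * y) = f * y" for y by (simp add: f flip: mult.assoc)
  define x where "x = star (e * f)"
  have x1: "e * (f * (x * (e * f))) = e * f"
    using star_props(1)[of "e * f"] by (simp add: x_def mult.assoc)
  have x2: "x * (e * (f * x)) = x"
    using star_props(2)[of "e * f"] by (simp add: x_def mult.assoc)
  have x2': "x * (e * (f * (x * y))) = x * y" for y
    using x2 by (metis mult.assoc)
  have "x = f * x * e"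
    unfolding x_def by (rule star_unique) (simp_all add: mult.assoc e' f' x1 x2' flip: x_def)
  then have "x * x = x" by (metis mult.assoc x2')
  then have "star x = x" by (intro idems_star) (simp add: idems_def)
  then have "x = e * f" by (simp add: x_def)
  with \<open>x * x = x\<close> show ?thesis by (simp add: idems_def)
qed

lemma idems_commute:
  fixes e :: "'s::inverse_semigroup"
  assumes "e \<in> idems" "f \<in> idems"
  shows "e * f = f * e"
proof -
  have e: "e * e = e" and f: "f * f = f" using assms by (auto simp: idems_def)
  have e': "e * (e * y) = e * y" for y by (simp add: e flip: mult.assoc)
  have f': "f * (f * y) = f * y" for y by (simp add: f flip: mult.assoc)
  have ef: "e * f \<in> idems" and fe: "f * e \<in> idems"
    using assms by (auto intro: idems_mult_closed)
  have "star (e * f) = f * e"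
    by (rule star_unique) (use ef fe in \<open>simp_all add: idems_def mult.assoc e' f'\<close>)
  with idems_star[OF ef] show ?thesis by simp
qed

lemma star_mult: "star (s * t) = star t * star s"
proof (rule star_unique)
  have c: "(t * star t) * (star s * s) = (star s * s) * (t * star t)"
    by (rule idems_commute) (simp_all add: star_mult_idem)
  have "s * t * (star t * star s) * (s * t) = s * ((t * star t) * (star s * s)) * t"
    by (simp add: mult.assoc)
  also have "\<dots> = (s * star s * s) * (t * star t * t)" unfolding c by (simp add: mult.assoc)
  finally show "s * t * (star t * star s) * (s * t) = s * t" by (simp add: star_props)
  have "star t * star s * (s * t) * (star t * star s) =
      star t * ((star s * s) * (t * star t)) * star s"
    by (simp add: mult.assoc)
  also have "\<dots> = (star t * t * star t) * (star s * s * star s)"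
    unfolding c[symmetric] by (simp add: mult.assoc)
  finally show "star t * star s * (s * t) * (star t * star s) = star t * star s"
    by (simp add: star_props)
qed

lemma star_conj_idem: "e \<in> idems \<Longrightarrow> star s * e * s \<in> idems"
proof -
  assume e: "e \<in> idems"
  have "(star s * e * s) * (star s * e * s) = star s * (e * (s * star s)) * e * s"
    by (simp add: mult.assoc)
  also have "\<dots> = (star s * s * star s) * (e * e) * s"
    by (simp add: idems_commute[OF e star_mult_idem(2)] mult.assoc)
  also have "\<dots> = star s * e * s" using e by (simp add: star_props idems_def)
  finally show ?thesis by (simp add: idems_def)
qed

lemma mult_idem_swap: "e \<in> idems \<Longrightarrow> s * e = (s * e * star s) * s"
proof -
  assume e: "e \<in> idems"
  have "(s * e * star s) * s = s * (e * (star s * s))" by (simp add: mult.assoc)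
  also have "\<dots> = (s * star s * s) * e"
    by (simp add: idems_commute[OF e star_mult_idem(1)] mult.assoc)
  finally show ?thesis by (simp add: star_props)
qed

definition inverse_subsemigroup :: "'s::inverse_semigroup set \<Rightarrow> bool" where
  "inverse_subsemigroup T \<longleftrightarrow>
     T \<noteq> {} \<and> (\<forall>s\<in>T. \<forall>t\<in>T. s * t \<in> T) \<and> (\<forall>s\<in>T. star s \<in> T)"

lemma equiv_max_group_rel:
  fixes T :: "'s::inverse_semigroup set"
  assumes T: "inverse_subsemigroup T"
  shows "equiv T (max_group_rel T)"
proof (rule equivI)
  show "max_group_rel T \<subseteq> T \<times> T" by (auto simp: max_group_rel_def)
  show "refl_on T (max_group_rel T)"
  proof (rule refl_onI)
    fix s assume s: "s \<in> T"
    have "s * star s \<in> idems \<inter> T"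
      using s T by (simp add: star_mult_idem inverse_subsemigroup_def)
    then have "natural_le T s s"
      unfolding natural_le_def by (intro bexI[of _ "s * star s"]) (simp_all add: star_props)
    with s show "(s, s) \<in> max_group_rel T" by (auto simp: max_group_rel_def)
  qed
  show "sym (max_group_rel T)" by (auto simp: max_group_rel_def sym_def)
  show "trans (max_group_rel T)"
  proof (rule transI)
    fix s t r assume "(s, t) \<in> max_group_rel T" "(t, r) \<in> max_group_rel T"
    then obtain e f g h where st: "s \<in> T" "t \<in> T" "r \<in> T"
      and i: "e \<in> idems \<inter> T" "f \<in> idems \<inter> T" "g \<in> idems \<inter> T" "h \<in> idems \<inter> T"
      and eq: "e * s = f * t" "g * t = h * r"
      by (auto simp: max_group_rel_def natural_le_def)
    have "g * (e * s) = (g * f) * t" by (simp add: eq(1) mult.assoc)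
    also have "\<dots> = f * (g * t)" using i by (simp add: idems_commute[of g f] mult.assoc)
    finally have "(g * e) * s = (f * h) * r" by (simp add: eq(2) mult.assoc)
    moreover have "g * e \<in> idems \<inter> T" "f * h \<in> idems \<inter> T" "(g * e) * s \<in> T"
      using i st T by (auto simp: idems_mult_closed inverse_subsemigroup_def)
    ultimately show "(s, r) \<in> max_group_rel T"
      using st unfolding max_group_rel_def natural_le_def by blast
  qed
qed

lemma max_group_rel_mult:
  fixes T :: "'s::inverse_semigroup set"
  assumes T: "inverse_subsemigroup T"
    and "(s, s') \<in> max_group_rel T" "(t, t') \<in> max_group_rel T"
  shows "(s * t, s' * t') \<in> max_group_rel T"
proof -
  obtain e e' f f' where st: "s \<in> T" "s' \<in> T" "t \<in> T" "t' \<in> T"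
    and i: "e \<in> idems \<inter> T" "e' \<in> idems \<inter> T" "f \<in> idems \<inter> T" "f' \<in> idems \<inter> T"
    and eq: "e * s = e' * s'" "f * t = f' * t'"
    using assms(2,3) by (auto simp: max_group_rel_def natural_le_def)
  have le: "natural_le T ((e * s) * (f * t)) (s * t)"
    if "e \<in> idems \<inter> T" "f \<in> idems \<inter> T" "s \<in> T" "t \<in> T" for e f s t
  proof -
    have f: "s * f = (s * f * star s) * s" using that by (intro mult_idem_swap) simp
    have "(e * s) * (f * t) = e * (s * f) * t" by (simp add: mult.assoc)
    also have "\<dots> = e * ((s * f * star s) * s) * t" by (subst f) (rule refl)
    also have "\<dots> = (e * (s * f * star s)) * (s * t)" by (simp only: mult.assoc)
    finally have "(e * s) * (f * t) = (e * (s * f * star s)) * (s * t)" .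
    moreover have "s * f * star s \<in> idems"
      using star_conj_idem[of f "star s"] that by simp
    ultimately show ?thesis
      using that T unfolding natural_le_def inverse_subsemigroup_def
      by (intro bexI[of _ "e * (s * f * star s)"]) (auto simp: idems_mult_closed)
  qed
  have "natural_le T ((e * s) * (f * t)) (s * t)" using le i st by blast
  moreover have "natural_le T ((e * s) * (f * t)) (s' * t')"
    unfolding eq using le i st by blast
  moreover have "(e * s) * (f * t) \<in> T" "s * t \<in> T" "s' * t' \<in> T"
    using i st T by (auto simp: inverse_subsemigroup_def)
  ultimately show ?thesis unfolding max_group_rel_def by blast
qed

lemma max_group_mult_class:
  fixes T :: "'s::inverse_semigroup set"
  assumes T: "inverse_subsemigroup T" and "s \<in> T" "t \<in> T"
  shows "mult (max_group_image T) (max_group_rel T `` {s}) (max_group_rel T `` {t}) =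
     max_group_rel T `` {s * t}"
proof -
  let ?R = "max_group_rel T"
  have E: "equiv T ?R" by (rule equiv_max_group_rel[OF T])
  have cl: "?R `` {x * y} = ?R `` {s * t}" if "x \<in> ?R `` {s}" "y \<in> ?R `` {t}" for x y
    using that max_group_rel_mult[OF T] equiv_class_eq[OF E] by (metis Image_singleton_iff)
  have mem: "s \<in> ?R `` {s}" "t \<in> ?R `` {t}" by (rule equiv_class_self[OF E]; fact)+
  have "mult (max_group_image T) (?R `` {s}) (?R `` {t}) =
      (\<Union>x\<in>?R `` {s}. \<Union>y\<in>?R `` {t}. ?R `` {x * y})"
    by (simp add: max_group_image_def)
  also have "\<dots> = (\<Union>x\<in>?R `` {s}. \<Union>y\<in>?R `` {t}. ?R `` {s * t})"
    using cl by (intro SUP_cong refl)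
  also have "\<dots> = ?R `` {s * t}" using mem by blast
  finally show ?thesis .
qed

lemma max_group_rel_idem:
  fixes T :: "'s::inverse_semigroup set"
  assumes T: "inverse_subsemigroup T" and e: "e \<in> idems \<inter> T" and s: "s \<in> T"
  shows "(e * s, s) \<in> max_group_rel T"
proof -
  have "e * (e * s) = e * s" using e by (simp add: idems_def flip: mult.assoc)
  moreover have "e * s \<in> T" using e s T by (auto simp: inverse_subsemigroup_def)
  ultimately show ?thesis using e s unfolding max_group_rel_def natural_le_def by force
qed

lemma max_group_one_class:
  fixes T :: "'s::inverse_semigroup set"
  assumes T: "inverse_subsemigroup T" and e: "e \<in> idems \<inter> T"
  shows "one (max_group_image T) = max_group_rel T `` {e}"
proof -
  let ?R = "max_group_rel T"
  have E: "equiv T ?R" by (rule equiv_max_group_rel[OF T])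
  have cl: "?R `` {f} = ?R `` {e}" if f: "f \<in> idems \<inter> T" for f
  proof (rule equiv_class_eq[OF E])
    have "(f * e, e) \<in> ?R" "(e * f, f) \<in> ?R" using max_group_rel_idem[OF T] e f by auto
    then show "(f, e) \<in> ?R"
      using idems_commute[of e f] e f E by (metis IntD1 equivE symD transD)
  qed
  have "one (max_group_image T) = (\<Union>f\<in>idems \<inter> T. ?R `` {f})"
    by (auto simp: max_group_image_def)
  also have "\<dots> = (\<Union>f\<in>idems \<inter> T. ?R `` {e})" using cl by (intro SUP_cong refl)
  also have "\<dots> = ?R `` {e}" using e by blast
  finally show ?thesis .
qed

lemma group_max_group_image:
  fixes T :: "'s::inverse_semigroup set"
  assumes T: "inverse_subsemigroup T"
  shows "group (max_group_image T)"
proof -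
  let ?R = "max_group_rel T"
  let ?G = "max_group_image T"
  have E: "equiv T ?R" by (rule equiv_max_group_rel[OF T])
  have clos: "s * t \<in> T" "star s \<in> T" if "s \<in> T" "t \<in> T" for s t
    using that T by (auto simp: inverse_subsemigroup_def)
  have car: "X \<in> carrier ?G \<longleftrightarrow> (\<exists>s\<in>T. X = ?R `` {s})" for X
    by (auto simp: max_group_image_def quotient_def)
  note mlt = max_group_mult_class[OF T]
  have idem: "star s * s \<in> idems \<inter> T" if "s \<in> T" for s
    using that clos by (simp add: star_mult_idem)
  obtain t where t: "t \<in> T" using T by (auto simp: inverse_subsemigroup_def)
  define e where "e = star t * t"
  have e: "e \<in> idems \<inter> T" unfolding e_def by (rule idem[OF t])
  have one: "one ?G = ?R `` {e}" by (rule max_group_one_class[OF T e])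
  show ?thesis
  proof (rule groupI)
    show "one ?G \<in> carrier ?G" using e one car by auto
    fix X assume "X \<in> carrier ?G"
    then obtain x where x: "x \<in> T" "X = ?R `` {x}" using car by auto
    have "?R `` {e * x} = ?R `` {x}"
      by (rule equiv_class_eq[OF E max_group_rel_idem[OF T e x(1)]])
    then show "mult ?G (one ?G) X = X" using x e by (simp add: one mlt)
    have "mult ?G (?R `` {star x}) X = one ?G"
      using x clos by (simp add: mlt max_group_one_class[OF T idem[OF x(1)]])
    then show "\<exists>Y\<in>carrier ?G. mult ?G Y X = one ?G" using x clos car by blast
    fix Y assume "Y \<in> carrier ?G"
    then obtain y where y: "y \<in> T" "Y = ?R `` {y}" using car by auto
    show "mult ?G X Y \<in> carrier ?G" using x y clos car by (auto simp: mlt)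
    fix Z assume "Z \<in> carrier ?G"
    then obtain z where z: "z \<in> T" "Z = ?R `` {z}" using car by auto
    show "mult ?G (mult ?G X Y) Z = mult ?G X (mult ?G Y Z)"
      using x y z clos by (simp add: mlt mult.assoc)
  qed
qed

lemma inverse_subsemigroup_stabilizer:
  fixes \<phi> :: "'s::inverse_semigroup \<Rightarrow> bool"
  assumes \<phi>: "\<phi> \<in> characters"
  shows "inverse_subsemigroup (stabilizer \<phi>)"
proof -
  have mlt: "\<phi> (e * f) \<longleftrightarrow> \<phi> e \<and> \<phi> f" if "e \<in> idems" "f \<in> idems" for e f
    using \<phi> that by (auto simp: characters_def)
  have ext: "\<phi> \<in> extensional idems" using \<phi> by (auto simp: characters_def)
  have stab: "s \<in> stabilizer \<phi> \<longleftrightarrow>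
      \<phi> (star s * s) \<and> (\<forall>e\<in>idems. \<phi> (star s * e * s) = \<phi> e)" for s
  proof -
    have "spectral_act s \<phi> = \<phi> \<longleftrightarrow> (\<forall>e\<in>idems. \<phi> (star s * e * s) = \<phi> e)"
    proof
      assume eq: "spectral_act s \<phi> = \<phi>"
      show "\<forall>e\<in>idems. \<phi> (star s * e * s) = \<phi> e"
      proof
        fix e :: 's assume "e \<in> idems"
        then show "\<phi> (star s * e * s) = \<phi> e"
          using fun_cong[OF eq, of e] by (simp add: spectral_act_def)
      qed
    next
      assume "\<forall>e\<in>idems. \<phi> (star s * e * s) = \<phi> e"
      then show "spectral_act s \<phi> = \<phi>"
        by (intro extensionalityI[OF _ ext]) (auto simp: spectral_act_def)
    qed
    then show ?thesis by (simp add: stabilizer_def)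
  qed
  obtain e where e: "e \<in> idems" "\<phi> e" using \<phi> by (auto simp: characters_def)
  have "e \<in> stabilizer \<phi>"
    using e by (auto simp: stab idems_star mlt idems_mult_closed)
  moreover have "s * t \<in> stabilizer \<phi>" if s: "s \<in> stabilizer \<phi>" and t: "t \<in> stabilizer \<phi>" for s t
  proof -
    have eq: "star (s * t) * e * (s * t) = star t * (star s * e * s) * t" for e
      by (simp add: star_mult mult.assoc)
    have eq1: "star (s * t) * (s * t) = star t * (star s * s) * t"
      by (simp add: star_mult mult.assoc)
    have S: "\<phi> (star s * s)" "\<And>e. e \<in> idems \<Longrightarrow> \<phi> (star s * e * s) = \<phi> e"
      and T: "\<phi> (star t * t)" "\<And>e. e \<in> idems \<Longrightarrow> \<phi> (star t * e * t) = \<phi> e"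
      using s t by (auto simp: stab)
    show ?thesis
      by (simp add: stab eq eq1 S T star_conj_idem star_mult_idem)
  qed
  moreover have "star s \<in> stabilizer \<phi>" if s: "s \<in> stabilizer \<phi>" for s
  proof -
    have "star s * (s * star s) * s = star s * s" by (simp add: star_props flip: mult.assoc)
    then have "\<phi> (s * star s)"
      using s star_mult_idem(2)[of s] unfolding stab by metis
    moreover have "\<phi> (s * e * star s) = \<phi> e" if "e \<in> idems" for e
    proof -
      have "s * e * star s \<in> idems" using star_conj_idem[OF that, of "star s"] by simp
      then have "\<phi> (s * e * star s) = \<phi> (star s * (s * e * star s) * s)"
        using s by (simp add: stab)
      also have "star s * (s * e * star s) * s = (star s * s) * (e * (star s * s))"
        by (simp add: mult.assoc)
      also have "\<phi> \<dots> \<longleftrightarrow> \<phi> (star s * s) \<and> \<phi> e"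
        using that star_mult_idem(1)[of s] by (auto simp: mlt idems_mult_closed)
      finally show ?thesis using s by (simp add: stab)
    qed
    ultimately show ?thesis by (simp add: stab)
  qed
  ultimately show ?thesis unfolding inverse_subsemigroup_def by blast
qed


section \<open>Models of finite dimensional simple modules\<close>

lemma lookup_pm_scale [simp]:
  "Poly_Mapping.lookup (pm_scale c f) x = c * Poly_Mapping.lookup f x"
  unfolding pm_scale_def by transfer (simp add: when_def)

lemma vector_space_pm_scale: "vector_space pm_scale"
  by unfold_locales
    (auto intro!: poly_mapping_eqI simp: lookup_add algebra_simps)

lemma finite_dim_simple_module_model:
  fixes scale :: "'k::field \<Rightarrow> 'v::ab_group_add \<Rightarrow> 'v"
  assumes vs: "vector_space scale"
    and simple: "simple_module scale M m V" and fin: "finite_dim_module scale V"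
  shows "\<exists>W \<in> fd_simple_modules TYPE('k) M m. module_iso scale pm_scale M V W"
proof -
  interpret A: vector_space scale by fact
  interpret P: vector_space "pm_scale :: 'k \<Rightarrow> (nat \<Rightarrow>\<^sub>0 'k) \<Rightarrow> _" by (rule vector_space_pm_scale)
  interpret vector_space_pair scale "pm_scale :: 'k \<Rightarrow> (nat \<Rightarrow>\<^sub>0 'k) \<Rightarrow> _" ..
  let ?C = "carrier V"
  note nd = simple[unfolded simple_module_def, THEN conjunct1, unfolded nondegenerate_module_def]
  have sub: "A.subspace ?C" using nd by blast
  obtain B0 where B0: "finite B0" "?C = A.span B0" using fin by (auto simp: finite_dim_module_def)
  obtain B where B: "B \<subseteq> ?C" "A.independent B" "?C \<subseteq> A.span B"
    by (rule A.maximal_independent_subset)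
  have finB: "finite B" using A.independent_span_bound[OF B0(1) B(2)] B B0 by auto
  have spB: "A.span B = ?C" using B sub by (simp add: A.span_minimal subset_antisym)
  obtain j :: "'v \<Rightarrow> nat" where j: "inj_on j B" using finB finite_imp_inj_to_nat_seg by blast
  obtain h where h: "Vector_Spaces.linear scale pm_scale h"
    and hB: "\<forall>b\<in>B. h b = Poly_Mapping.single (j b) 1"
    using linear_independent_extend[OF B(2), of "\<lambda>b. Poly_Mapping.single (j b) 1"] by blast
  interpret h: Vector_Spaces.linear scale pm_scale h by (rule h)
  have inj: "inj_on h ?C"
  proof -
    have "v = 0" if v: "v \<in> A.span B" "h v = 0" for v
    proof -
      obtain u where u: "v = (\<Sum>b\<in>B. scale (u b) b)" using v A.span_finite[OF finB] by auto
      have "u b = 0" if b: "b \<in> B" for b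
      proof -
        have "0 = Poly_Mapping.lookup (h v) (j b)" using v by simp
        also have "\<dots> = (\<Sum>b'\<in>B. u b' * Poly_Mapping.lookup (Poly_Mapping.single (j b') 1) (j b))"
          using hB by (simp add: u h.sum h.scale lookup_sum)
        also have "\<dots> = (\<Sum>b'\<in>B. if b' = b then u b else 0)"
          using b inj_onD[OF j] by (intro sum.cong) (auto simp: lookup_single when_def)
        finally show ?thesis using finB b by simp
      qed
      then show ?thesis by (simp add: u)
    qed
    then have "inj_on h (A.span B)"
      using linear_inj_on_iff_eq_0[OF h A.subspace_span] by blast
    then show ?thesis by (simp add: spB)
  qed
  define g where "g = inv_into ?C h"
  have g [simp]: "g (h v) = v" if "v \<in> ?C" for v
    using that inj by (simp add: g_def inv_into_f_f)
  define W where "W = \<lparr>carrier = h ` ?C, act = (\<lambda>a w. h (act V a (g w)))\<rparr>"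
  have cW [simp]: "carrier W = h ` ?C" by (simp add: W_def)
  have aW [simp]: "act W a (h v) = h (act V a v)" if "v \<in> ?C" for a v
    using that by (simp add: W_def)
  have cl [simp]: "v + w \<in> ?C" "scale c v \<in> ?C" if "v \<in> ?C" "w \<in> ?C" for v w c
    using that sub by (auto simp: A.subspace_def)
  have acl [simp]: "act V a v \<in> ?C" if "a \<in> semigroup_algebra M" "v \<in> ?C" for a v
    using nd that by blast
  have "{act W a w | a w. a \<in> semigroup_algebra M \<and> w \<in> carrier W} =
      h ` {act V a v | a v. a \<in> semigroup_algebra M \<and> v \<in> ?C}" (is "?X = h ` ?Y")
    by (auto simp: image_iff) (metis aW)+
  then have "P.span ?X = h ` A.span ?Y"
    using linear_span_image[OF h] by metis
  also have "A.span ?Y = ?C" using nd by blast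
  finally have sp: "P.span ?X = carrier W" by simp
  have subW: "P.subspace (carrier W)" using linear_subspace_image[OF h sub] by simp
  have ndW: "nondegenerate_module pm_scale M m W"
    unfolding nondegenerate_module_def
  proof (intro conjI)
    show "\<forall>a\<in>semigroup_algebra M. \<forall>v\<in>carrier W. \<forall>w\<in>carrier W.
        act W a (v + w) = act W a v + act W a w"
      using nd by (auto simp flip: h.add)
    show "\<forall>a\<in>semigroup_algebra M. \<forall>b\<in>semigroup_algebra M. \<forall>v\<in>carrier W.
        act W (a + b) v = act W a v + act W b v"
      using nd by (auto simp flip: h.add)
    show "\<forall>c. \<forall>a\<in>semigroup_algebra M. \<forall>v\<in>carrier W.
        act W a (pm_scale c v) = pm_scale c (act W a v) \<and>
        act W (pm_scale c a) v = pm_scale c (act W a v)"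
      using nd by (auto simp flip: h.scale)
    show "\<forall>a\<in>semigroup_algebra M. \<forall>b\<in>semigroup_algebra M. \<forall>v\<in>carrier W.
        act W (convolution m a b) v = act W a (act W b v)"
      using nd by auto
  qed (use sp subW in auto)
  have "U = {0} \<or> U = carrier W" if U: "submodule_of pm_scale M U W" for U
  proof -
    define U' where "U' = {v \<in> ?C. h v \<in> U}"
    have UU: "U = h ` U'" using U by (auto simp: U'_def submodule_of_def)
    have Usub: "P.subspace U" using U by (simp add: submodule_of_def)
    have "A.subspace U'"
      unfolding A.subspace_def
      using Usub sub by (auto simp: U'_def h.add h.scale h.zero P.subspace_def A.subspace_0)
    moreover have "act V a v \<in> U'" if "a \<in> semigroup_algebra M" "v \<in> U'" for a v
      using U that unfolding U'_def submodule_of_def by (metis (mono_tags, lifting) aW acl mem_Collect_eq)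
    ultimately have "submodule_of scale M U' V" by (auto simp: submodule_of_def U'_def)
    then have "U' = {0} \<or> U' = ?C" using simple by (simp add: simple_module_def)
    then show ?thesis by (auto simp: UU h.zero)
  qed
  moreover have "carrier W \<noteq> {0}"
  proof
    assume "carrier W = {0}"
    then have "h v = h 0" if "v \<in> ?C" for v using that h.zero by auto
    then have "?C \<subseteq> {0}" using inj_onD[OF inj _ _ A.subspace_0[OF sub]] by blast
    then show False using simple A.subspace_0[OF sub] by (auto simp: simple_module_def)
  qed
  ultimately have "simple_module pm_scale M m W" using ndW by (simp add: simple_module_def)
  moreover have "finite_dim_module pm_scale W"
    unfolding finite_dim_module_def
    using finB linear_span_image[OF h, of B] spB by (intro exI[of _ "h ` B"]) auto
  ultimately have "W \<in> fd_simple_modules TYPE('k) M m" by (simp add: fd_simple_modules_def)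
  moreover have "module_iso scale pm_scale M V W"
    unfolding module_iso_def
    using inj by (intro exI[of _ h]) (auto simp: bij_betw_def h.add h.scale)
  ultimately show ?thesis by blast
qed

end

theory Submission
  imports Defs "HOL-Library.Function_Algebras"
begin

text \<open>On a finite dimensional simple module \<open>V\<close> the commuting idempotent operators of \<open>E(S)\<close> have a
  common eigenvector, on which they act through a character \<open>\<phi>\<close>. An element \<open>s\<close> maps the weight space
  \<open>V\<^sub>\<phi>\<close> isomorphically onto \<open>V\<^sub>s\<^sub>\<phi>\<close> if \<open>\<phi>(s\<^sup>*s) = 1\<close> and annihilates it otherwise. Weight spaces of
  different characters are independent, so the orbit of \<open>\<phi>\<close> is finite. Products of operators \<open>e\<close> and
  \<open>1 - e\<close> project a sum of finitely many weight vectors to one summand; hence the weights of \<open>V\<close> form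
  a single orbit and \<open>V\<^sub>\<phi>\<close> is a simple \<open>KG\<^sub>\<phi>\<close>-module. Conversely, inducing a simple \<open>KG\<^sub>\<phi>\<close>-module
  \<open>U\<close> along the orbit of \<open>\<phi>\<close> gives a simple module with weight space \<open>U\<close>, and any isomorphism
  \<open>U \<rightarrow> V\<^sub>\<phi>\<close> extends to a nonzero homomorphism from the induced module to \<open>V\<close>, which is bijective
  by Schur's lemma.\<close>

section \<open>Modules and their basis operators\<close>

text \<open>Neither direction of the correspondence is canonical: the induced module depends on a
  choice \<open>\<tau>\<close> of elements moving \<open>\<phi>\<close> around its orbit, and it
  must be copied into the fixed ambient space. The correspondence is therefore carried by the
  relation \<open>linked\<close>, saying that the weight space of \<open>V\<close> at
  \<open>\<phi>\<close> is a copy of \<open>U\<close>; it becomes a bijection once both sides are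
  divided by isomorphism. The maximal group image enters through idempotents. Stabilizer elements
  with a common lower bound agree after multiplication by idempotents on which \<open>\<phi>\<close>
  is true, and these act as the identity on the weight space. The same fact makes induction work,
  since transports along \<open>\<tau>\<close> compose only up to such an idempotent. A common
  eigenvector exists over any field because commuting idempotents only have the eigenvalues 0 and 1.
  Since \<open>S\<close> may lack an identity, an idempotent on which a character is true repeatedly
  takes its place.\<close>

abbreviation basis_act :: "('g \<Rightarrow>\<^sub>0 'k::field, 'v) alg_module \<Rightarrow> 'g \<Rightarrow> 'v \<Rightarrow> 'v" where
  "basis_act V s \<equiv> act V (Poly_Mapping.single s 1)"

lemma single_in_semigroup_algebra: "s \<in> M \<Longrightarrow> Poly_Mapping.single s c \<in> semigroup_algebra M"
  by (auto simp: semigroup_algebra_def)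

lemma single_eq_pm_scale: "Poly_Mapping.single s c = pm_scale c (Poly_Mapping.single s 1)"
  by (rule poly_mapping_eqI) (simp add: lookup_single when_def)

lemma poly_mapping_sum_single:
  "a = (\<Sum>s\<in>Poly_Mapping.keys a. Poly_Mapping.single s (Poly_Mapping.lookup a s))"
proof (rule poly_mapping_eqI)
  fix t
  have "Poly_Mapping.lookup (\<Sum>s\<in>Poly_Mapping.keys a. Poly_Mapping.single s (Poly_Mapping.lookup a s)) t
    = (\<Sum>s\<in>Poly_Mapping.keys a. if s = t then Poly_Mapping.lookup a t else 0)"
    by (auto simp: lookup_sum lookup_single when_def intro!: sum.cong)
  then show "Poly_Mapping.lookup a t =
      Poly_Mapping.lookup (\<Sum>s\<in>Poly_Mapping.keys a. Poly_Mapping.single s (Poly_Mapping.lookup a s)) t"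
    by (simp add: in_keys_iff)
qed

lemma convolution_single:
  "convolution m (Poly_Mapping.single s a) (Poly_Mapping.single t b) = Poly_Mapping.single (m s t) (a * b)"
  by (cases "a = 0"; cases "b = 0") (simp_all add: convolution_def)

locale nd_module = vector_space scale
  for scale :: "'k::field \<Rightarrow> 'v::ab_group_add \<Rightarrow> 'v" +
  fixes M :: "'g set" and m :: "'g \<Rightarrow> 'g \<Rightarrow> 'g" and V :: "('g \<Rightarrow>\<^sub>0 'k, 'v) alg_module"
  assumes nd: "nondegenerate_module scale M m V"
begin

lemma subspace_carrier: "subspace (carrier V)"
  using nd by (simp add: nondegenerate_module_def)

lemma act_closed: "a \<in> semigroup_algebra M \<Longrightarrow> v \<in> carrier V \<Longrightarrow> act V a v \<in> carrier V"
  using nd by (simp add: nondegenerate_module_def)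

lemma act_add_left: "a \<in> semigroup_algebra M \<Longrightarrow> b \<in> semigroup_algebra M \<Longrightarrow> v \<in> carrier V \<Longrightarrow>
    act V (a + b) v = act V a v + act V b v"
  using nd by (simp add: nondegenerate_module_def)

lemma act_scale_left: "a \<in> semigroup_algebra M \<Longrightarrow> v \<in> carrier V \<Longrightarrow>
    act V (pm_scale c a) v = scale c (act V a v)"
  using nd by (simp add: nondegenerate_module_def)

lemma basis_act_closed: "s \<in> M \<Longrightarrow> v \<in> carrier V \<Longrightarrow> basis_act V s v \<in> carrier V"
  by (intro act_closed single_in_semigroup_algebra)

lemma basis_act_add: "s \<in> M \<Longrightarrow> v \<in> carrier V \<Longrightarrow> w \<in> carrier V \<Longrightarrow>
    basis_act V s (v + w) = basis_act V s v + basis_act V s w"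
  using nd by (simp add: nondegenerate_module_def single_in_semigroup_algebra)

lemma basis_act_scale: "s \<in> M \<Longrightarrow> v \<in> carrier V \<Longrightarrow>
    basis_act V s (scale c v) = scale c (basis_act V s v)"
  using nd by (simp add: nondegenerate_module_def single_in_semigroup_algebra)

lemma basis_act_mult: "s \<in> M \<Longrightarrow> t \<in> M \<Longrightarrow> v \<in> carrier V \<Longrightarrow>
    basis_act V (m s t) v = basis_act V s (basis_act V t v)"
proof -
  assume a: "s \<in> M" "t \<in> M" "v \<in> carrier V"
  have "act V (convolution m (Poly_Mapping.single s 1) (Poly_Mapping.single t 1)) v =
      basis_act V s (basis_act V t v)"
    using nd a by (simp add: nondegenerate_module_def single_in_semigroup_algebra)
  then show ?thesis by (simp add: convolution_single)
qed

text \<open>By linearity in the algebra argument, a module is determined by the operators of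
  semigroup elements. All later arguments are about these operators only; this is the way back to
  the algebra.\<close>

lemma act_eq_sum_basis_act:
  assumes a: "a \<in> semigroup_algebra M" and v: "v \<in> carrier V"
  shows "act V a v = (\<Sum>s\<in>Poly_Mapping.keys a. scale (Poly_Mapping.lookup a s) (basis_act V s v))"
proof -
  have z: "act V 0 v = 0"
  proof -
    have "(0 :: 'g \<Rightarrow>\<^sub>0 'k) \<in> semigroup_algebra M" by (simp add: semigroup_algebra_def)
    from act_add_left[OF this this v] show ?thesis by simp
  qed
  have sub: "(\<Sum>s\<in>F. Poly_Mapping.single s (c s)) \<in> semigroup_algebra M"
    if "F \<subseteq> M" for F and c :: "'g \<Rightarrow> 'k"
    using that keys_sum[of "\<lambda>s. Poly_Mapping.single s (c s)" F]
    by (fastforce simp: semigroup_algebra_def split: if_splits)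
  have "act V (\<Sum>s\<in>F. Poly_Mapping.single s (c s)) v = (\<Sum>s\<in>F. scale (c s) (basis_act V s v))"
    if "finite F" "F \<subseteq> M" for F and c :: "'g \<Rightarrow> 'k"
    using that
  proof (induction F rule: finite_induct)
    case (insert x F)
    have "act V (Poly_Mapping.single x (c x)) v = scale (c x) (basis_act V x v)"
      using insert.prems v
      by (subst single_eq_pm_scale) (simp add: act_scale_left single_in_semigroup_algebra)
    with insert sub[of F c] v show ?case
      by (simp add: act_add_left single_in_semigroup_algebra)
  qed (simp add: z)
  from this[of "Poly_Mapping.keys a" "Poly_Mapping.lookup a"] a show ?thesis
    using poly_mapping_sum_single[of a] by (simp add: semigroup_algebra_def)
qed

lemma span_basis_act: "span {basis_act V s v | s v. s \<in> M \<and> v \<in> carrier V} = carrier V"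
proof (rule antisym)
  show "span {basis_act V s v | s v. s \<in> M \<and> v \<in> carrier V} \<subseteq> carrier V"
    by (rule span_minimal) (auto simp: basis_act_closed subspace_carrier)
  have "act V a v \<in> span {basis_act V s v | s v. s \<in> M \<and> v \<in> carrier V}"
    if "a \<in> semigroup_algebra M" "v \<in> carrier V" for a v
    using that unfolding act_eq_sum_basis_act[OF that]
    by (intro span_sum span_scale span_base) (auto simp: semigroup_algebra_def)
  then have "span {act V a v | a v. a \<in> semigroup_algebra M \<and> v \<in> carrier V} \<subseteq>
      span {basis_act V s v | s v. s \<in> M \<and> v \<in> carrier V}"
    by (intro span_minimal) auto
  then show "carrier V \<subseteq> span {basis_act V s v | s v. s \<in> M \<and> v \<in> carrier V}"
    using nd by (simp add: nondegenerate_module_def)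
qed

lemma submodule_of_iff:
  "submodule_of scale M W V \<longleftrightarrow>
     W \<subseteq> carrier V \<and> subspace W \<and> (\<forall>s\<in>M. \<forall>w\<in>W. basis_act V s w \<in> W)"
proof -
  have "act V a w \<in> W" if "W \<subseteq> carrier V" "subspace W" "\<forall>s\<in>M. \<forall>w\<in>W. basis_act V s w \<in> W"
    "a \<in> semigroup_algebra M" "w \<in> W" for a w
  proof -
    have "w \<in> carrier V" using that by blast
    then show ?thesis using that unfolding act_eq_sum_basis_act[OF that(4) \<open>w \<in> carrier V\<close>]
      by (intro subspace_sum subspace_scale) (auto simp: semigroup_algebra_def)
  qed
  then show ?thesis by (auto simp: submodule_of_def single_in_semigroup_algebra)
qed

text \<open>Precomposing with a linear projection onto the carrier makes the operators linear and
  multiplicative on the whole ambient space.\<close>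

lemma global_basis_act:
  assumes closed: "\<And>s t. s \<in> M \<Longrightarrow> t \<in> M \<Longrightarrow> m s t \<in> M"
  obtains \<rho> where "\<And>s. s \<in> M \<Longrightarrow> Vector_Spaces.linear scale scale (\<rho> s)"
    "\<And>s t v. s \<in> M \<Longrightarrow> t \<in> M \<Longrightarrow> \<rho> (m s t) v = \<rho> s (\<rho> t v)"
    "\<And>s v. s \<in> M \<Longrightarrow> \<rho> s v \<in> carrier V"
    "\<And>s v. s \<in> M \<Longrightarrow> v \<in> carrier V \<Longrightarrow> \<rho> s v = basis_act V s v"
proof -
  interpret vector_space_pair scale scale ..
  obtain B where B: "B \<subseteq> carrier V" "independent B" "carrier V \<subseteq> span B"
    by (rule maximal_independent_subset)
  have sp: "span B = carrier V"
    using B span_minimal[OF B(1) subspace_carrier] by auto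
  obtain p where p: "Vector_Spaces.linear scale scale p" "\<forall>b\<in>B. p b = b" "range p = span B"
    using linear_independent_extend_subspace[OF B(2), of "\<lambda>x. x"] by auto
  interpret p: Vector_Spaces.linear scale scale p by (rule p(1))
  have pC: "p v \<in> carrier V" for v using p(3) sp by auto
  have pid: "p v = v" if "v \<in> carrier V" for v
  proof (rule linear_eq_on[OF p(1) _ that[folded sp]])
    show "Vector_Spaces.linear scale scale (\<lambda>x. x)" by (rule linear_ident)
  qed (use p(2) in auto)
  show ?thesis
  proof (rule that[of "\<lambda>s v. basis_act V s (p v)"])
    show "Vector_Spaces.linear scale scale (\<lambda>v. basis_act V s (p v))" if "s \<in> M" for s
      using that by (simp add: Vector_Spaces.linear_iff vector_space_axioms p.add p.scale pC
          basis_act_add basis_act_scale)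
  qed (use pC pid basis_act_closed basis_act_mult closed in auto)
qed

end

text \<open>Compatibility with the operators of semigroup elements extends to the algebra because
  both actions are the linear extensions of these operators.\<close>

lemma module_isoI:
  fixes M :: "'g set"
  assumes V: "nd_module scale1 M m V" and W: "nd_module scale2 M m W"
    and h: "bij_betw h (carrier V) (carrier W)"
      "\<And>v v'. v \<in> carrier V \<Longrightarrow> v' \<in> carrier V \<Longrightarrow> h (v + v') = h v + h v'"
      "\<And>c v. v \<in> carrier V \<Longrightarrow> h (scale1 c v) = scale2 c (h v)"
      "\<And>s v. s \<in> M \<Longrightarrow> v \<in> carrier V \<Longrightarrow> h (basis_act V s v) = basis_act W s (h v)"
  shows "module_iso scale1 scale2 M V W"
proof -
  interpret V: nd_module scale1 M m V by fact
  interpret W: nd_module scale2 M m W by fact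
  have hW: "h v \<in> carrier W" if "v \<in> carrier V" for v using h(1) that by (auto simp: bij_betw_def)
  have h0: "h 0 = 0" using h(2)[of 0 0] V.subspace_0[OF V.subspace_carrier] by simp
  have hsum: "h (sum f F) = (\<Sum>x\<in>F. h (f x))" if "finite F" "\<And>x. x \<in> F \<Longrightarrow> f x \<in> carrier V" for f and F :: "'g set"
    using that
  proof (induction F rule: finite_induct)
    case (insert x F)
    then show ?case by (simp add: h(2) V.subspace_sum[OF V.subspace_carrier])
  qed (simp add: h0)
  have "h (act V a v) = act W a (h v)" if a: "a \<in> semigroup_algebra M" and v: "v \<in> carrier V" for a v
  proof -
    have M: "s \<in> M" if "s \<in> Poly_Mapping.keys a" for s using a that by (auto simp: semigroup_algebra_def)
    have "h (act V a v) = (\<Sum>s\<in>Poly_Mapping.keys a. h (scale1 (Poly_Mapping.lookup a s) (basis_act V s v)))"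
      unfolding V.act_eq_sum_basis_act[OF a v]
      by (rule hsum) (simp_all add: M v V.basis_act_closed V.subspace_scale[OF V.subspace_carrier])
    also have "\<dots> = act W a (h v)"
      unfolding W.act_eq_sum_basis_act[OF a hW[OF v]]
      by (intro sum.cong refl) (simp add: M v h V.basis_act_closed)
    finally show ?thesis .
  qed
  then show ?thesis unfolding module_iso_def using h by blast
qed

section \<open>Modules built from operators of semigroup elements, and isomorphisms\<close>

definition linearized ::
    "('k::field \<Rightarrow> 'v::ab_group_add \<Rightarrow> 'v) \<Rightarrow> 'v set \<Rightarrow> ('g \<Rightarrow> 'v \<Rightarrow> 'v) \<Rightarrow> ('g \<Rightarrow>\<^sub>0 'k, 'v) alg_module" where
  "linearized scale C \<rho> = \<lparr>carrier = C, act = (\<lambda>a v.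
     \<Sum>s\<in>Poly_Mapping.keys a. scale (Poly_Mapping.lookup a s) (\<rho> s v))\<rparr>"

lemma carrier_linearized [simp]: "carrier (linearized scale C \<rho>) = C"
  by (simp add: linearized_def)

lemma (in vector_space) basis_act_linearized [simp]: "basis_act (linearized scale C \<rho>) s v = \<rho> s v"
  by (simp add: linearized_def)

text \<open>The module axioms over the algebra follow by bilinear extension from the laws for single
  elements. Both the group module on a weight space and the induced module are obtained in this
  way.\<close>

lemma (in vector_space) nd_module_linearized:
  fixes \<rho> :: "'g \<Rightarrow> 'b \<Rightarrow> 'b"
  assumes C: "subspace C" and closed: "\<And>s t. s \<in> M \<Longrightarrow> t \<in> M \<Longrightarrow> m s t \<in> M"
    and \<rho>: "\<And>s v. s \<in> M \<Longrightarrow> v \<in> C \<Longrightarrow> \<rho> s v \<in> C"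
      "\<And>s v w. s \<in> M \<Longrightarrow> v \<in> C \<Longrightarrow> w \<in> C \<Longrightarrow> \<rho> s (v + w) = \<rho> s v + \<rho> s w"
      "\<And>s c v. s \<in> M \<Longrightarrow> v \<in> C \<Longrightarrow> \<rho> s (scale c v) = scale c (\<rho> s v)"
      "\<And>s t v. s \<in> M \<Longrightarrow> t \<in> M \<Longrightarrow> v \<in> C \<Longrightarrow> \<rho> (m s t) v = \<rho> s (\<rho> t v)"
    and span: "C \<subseteq> span {\<rho> s v | s v. s \<in> M \<and> v \<in> C}"
  shows "nd_module scale M m (linearized scale C \<rho>)"
proof
  define A where "A a v = (\<Sum>s\<in>Poly_Mapping.keys a. scale (Poly_Mapping.lookup a s) (\<rho> s v))" for a v
  have act: "act (linearized scale C \<rho>) = A" by (simp add: linearized_def A_def fun_eq_iff)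
  \<comment> \<open>Supports change under addition and scaling because of cancellation, so sums are
    compared over a common finite superset of the supports.\<close>
  have Asup: "A a v = (\<Sum>s\<in>F. scale (Poly_Mapping.lookup a s) (\<rho> s v))"
    if "finite F" "Poly_Mapping.keys a \<subseteq> F" for a v F
    unfolding A_def by (rule sum.mono_neutral_left) (use that in \<open>auto simp: in_keys_iff\<close>)
  have M: "s \<in> M" if "a \<in> semigroup_algebra M" "s \<in> Poly_Mapping.keys a" for s and a :: "'g \<Rightarrow>\<^sub>0 'a"
    using that by (auto simp: semigroup_algebra_def)
  have Acl: "A a v \<in> C" if "a \<in> semigroup_algebra M" "v \<in> C" for a v
    unfolding A_def using that C M \<rho>(1) by (intro subspace_sum subspace_scale) auto
  have Aadd: "A (a + b) v = A a v + A b v" for a b v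
    using keys_add[of a b]
    by (subst (1 2 3) Asup[of "Poly_Mapping.keys a \<union> Poly_Mapping.keys b"])
      (auto simp: lookup_add scale_left_distrib sum.distrib)
  have A0: "A 0 v = 0" for v by (simp add: A_def)
  have Asum: "A (sum f F) v = (\<Sum>x\<in>F. A (f x) v)" for f v and F :: "'g set"
    by (induction F rule: infinite_finite_induct) (simp_all add: A0 Aadd)
  have Asingle: "A (Poly_Mapping.single s c) v = scale c (\<rho> s v)" for s c v
    by (simp add: A_def)
  have \<rho>sum: "\<rho> s (sum f F) = (\<Sum>x\<in>F. \<rho> s (f x))"
    if "s \<in> M" "finite F" "\<And>x. x \<in> F \<Longrightarrow> f x \<in> C" for s f and F :: "'g set"
    using that(2,3)
  proof (induction F rule: finite_induct)
    case empty
    show ?case using \<rho>(2)[of s 0 0] that(1) subspace_0[OF C] by simp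
  qed (simp add: \<rho>(2) that(1) subspace_sum[OF C])
  show "nondegenerate_module scale M m (linearized scale C \<rho>)"
    unfolding nondegenerate_module_def act carrier_linearized
  proof (intro conjI ballI allI)
    fix a b :: "'g \<Rightarrow>\<^sub>0 'a" and v w c
    assume a: "a \<in> semigroup_algebra M" and v: "v \<in> C"
    show "A a v \<in> C" using Acl a v by blast
    show "A a (scale c v) = scale c (A a v)"
      unfolding A_def scale_sum_right
      by (intro sum.cong refl) (simp add: \<rho>(3) M[OF a] v scale_left_commute)
    have "Poly_Mapping.keys (pm_scale c a) \<subseteq> Poly_Mapping.keys a" by (auto simp: in_keys_iff)
    from Asup[OF _ this] show "A (pm_scale c a) v = scale c (A a v)"
      by (simp add: A_def scale_sum_right)
    assume w: "w \<in> C"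
    show "A a (v + w) = A a v + A a w"
      unfolding A_def sum.distrib[symmetric]
      by (intro sum.cong refl) (simp add: \<rho>(2) M[OF a] v w scale_right_distrib)
  next
    fix a b :: "'g \<Rightarrow>\<^sub>0 'a" and v
    assume a: "a \<in> semigroup_algebra M" and b: "b \<in> semigroup_algebra M" and v: "v \<in> C"
    show "A (a + b) v = A a v + A b v" by (rule Aadd)
    have "A (convolution m a b) v = (\<Sum>s\<in>Poly_Mapping.keys a. \<Sum>t\<in>Poly_Mapping.keys b.
        scale (Poly_Mapping.lookup a s * Poly_Mapping.lookup b t) (\<rho> (m s t) v))"
      by (simp add: convolution_def Asum Asingle)
    also have "\<dots> = (\<Sum>s\<in>Poly_Mapping.keys a. scale (Poly_Mapping.lookup a s) (\<rho> s (A b v)))"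
    proof (intro sum.cong refl)
      fix s assume s: "s \<in> Poly_Mapping.keys a"
      have "\<rho> s (A b v) = (\<Sum>t\<in>Poly_Mapping.keys b. scale (Poly_Mapping.lookup b t) (\<rho> s (\<rho> t v)))"
        unfolding A_def using M[OF a s] M[OF b] v
        by (subst \<rho>sum) (auto simp: \<rho>(1,3) subspace_scale[OF C])
      then show "(\<Sum>t\<in>Poly_Mapping.keys b.
          scale (Poly_Mapping.lookup a s * Poly_Mapping.lookup b t) (\<rho> (m s t) v)) =
          scale (Poly_Mapping.lookup a s) (\<rho> s (A b v))"
        using M[OF a s] M[OF b] v by (simp add: \<rho>(4) scale_sum_right)
    qed
    finally show "A (convolution m a b) v = A a (A b v)" by (simp add: A_def)
  next
    show "span {A a v | a v. a \<in> semigroup_algebra M \<and> v \<in> C} = C"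
    proof (rule antisym)
      show "span {A a v | a v. a \<in> semigroup_algebra M \<and> v \<in> C} \<subseteq> C"
        by (rule span_minimal) (auto simp: Acl C)
      have "\<rho> s v \<in> {A a v | a v. a \<in> semigroup_algebra M \<and> v \<in> C}" if "s \<in> M" "v \<in> C" for s v
        using that Asingle[of s 1 v] single_in_semigroup_algebra[OF that(1), of 1]
        by (metis (mono_tags, lifting) mem_Collect_eq scale_one)
      then have "{\<rho> s v | s v. s \<in> M \<and> v \<in> C} \<subseteq> {A a v | a v. a \<in> semigroup_algebra M \<and> v \<in> C}"
        by blast
      from span_mono[OF this] span
      show "C \<subseteq> span {A a v | a v. a \<in> semigroup_algebra M \<and> v \<in> C}" by blast
    qed
  qed (rule C)
qed

lemma (in nd_module) simple_moduleI:
  assumes "carrier V \<noteq> {0}"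
    and "\<And>W. W \<subseteq> carrier V \<Longrightarrow> subspace W \<Longrightarrow> (\<And>s w. s \<in> M \<Longrightarrow> w \<in> W \<Longrightarrow> basis_act V s w \<in> W) \<Longrightarrow>
      W \<noteq> {0} \<Longrightarrow> carrier V \<subseteq> W"
  shows "simple_module scale M m V"
  unfolding simple_module_def
proof (intro conjI allI impI)
  fix W assume "submodule_of scale M W V"
  then have "W \<subseteq> carrier V" "subspace W" "\<And>s w. s \<in> M \<Longrightarrow> w \<in> W \<Longrightarrow> basis_act V s w \<in> W"
    by (simp_all add: submodule_of_iff)
  then show "W = {0} \<or> W = carrier V" using assms(2)[of W] by blast
qed (use assms(1) nd in simp_all)

lemma (in vector_space) simple_module_dichotomy:
  assumes V: "simple_module scale M m V"
    and "W \<subseteq> carrier V" "subspace W" "\<And>s w. s \<in> M \<Longrightarrow> w \<in> W \<Longrightarrow> basis_act V s w \<in> W"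
  shows "W = {0} \<or> W = carrier V"
proof -
  interpret nd_module scale M m V by standard (use V in \<open>simp add: simple_module_def\<close>)
  have "submodule_of scale M W V" unfolding submodule_of_iff using assms by blast
  then show ?thesis using V by (simp add: simple_module_def)
qed

lemma nd_module_fd_simple: "V \<in> fd_simple_modules TYPE('k::field) M m \<Longrightarrow> nd_module pm_scale M m V"
  using vector_space_pm_scale
  by (auto simp: nd_module_def nd_module_axioms_def simple_module_def fd_simple_modules_def)

lemma module_iso_refl: "module_iso scale scale M V V"
  unfolding module_iso_def by (intro exI[of _ "\<lambda>v. v"]) (simp add: bij_betw_def)

lemma module_iso_sym:
  fixes V :: "('g \<Rightarrow>\<^sub>0 'k::field, 'v::ab_group_add) alg_module"
  assumes V: "nd_module scale1 M m V" and iso: "module_iso scale1 scale2 M V W"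
  shows "module_iso scale2 scale1 M W V"
proof -
  interpret nd_module scale1 M m V by fact
  obtain h where h: "bij_betw h (carrier V) (carrier W)"
    and hom: "\<And>v v'. v \<in> carrier V \<Longrightarrow> v' \<in> carrier V \<Longrightarrow> h (v + v') = h v + h v'"
      "\<And>c v. v \<in> carrier V \<Longrightarrow> h (scale1 c v) = scale2 c (h v)"
      "\<And>a v. a \<in> semigroup_algebra M \<Longrightarrow> v \<in> carrier V \<Longrightarrow> h (act V a v) = act W a (h v)"
    using iso unfolding module_iso_def by blast
  define g where "g = inv_into (carrier V) h"
  have bij: "bij_betw g (carrier W) (carrier V)"
    unfolding g_def by (rule bij_betw_inv_into[OF h])
  have gV: "g w \<in> carrier V" and hg: "h (g w) = w" if "w \<in> carrier W" for w
    using that h unfolding g_def by (auto simp: bij_betw_def inv_into_into f_inv_into_f)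
  have gh: "g (h v) = v" if "v \<in> carrier V" for v
    using that h unfolding g_def by (simp add: bij_betw_def inv_into_f_f)
  show ?thesis unfolding module_iso_def
  proof (intro exI[of _ g] conjI ballI allI bij)
    fix w c assume w: "w \<in> carrier W"
    show "g (scale2 c w) = scale1 c (g w)"
      using gh[of "scale1 c (g w)"] hom(2)[of "g w" c] w gV hg
      by (simp add: subspace_scale[OF subspace_carrier])
    fix w' assume w': "w' \<in> carrier W"
    show "g (w + w') = g w + g w'"
      using gh[of "g w + g w'"] hom(1)[of "g w" "g w'"] w w' gV hg
      by (simp add: subspace_add[OF subspace_carrier])
  next
    fix w and a :: "'g \<Rightarrow>\<^sub>0 'k" assume "a \<in> semigroup_algebra M" "w \<in> carrier W"
    then show "g (act W a w) = act V a (g w)"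
      using gh[of "act V a (g w)"] hom(3)[of a "g w"] gV hg by (simp add: act_closed)
  qed
qed

lemma module_iso_trans:
  assumes "module_iso scale1 scale2 M U V" "module_iso scale2 scale3 M V W"
  shows "module_iso scale1 scale3 M U W"
proof -
  obtain h where h: "bij_betw h (carrier U) (carrier V)"
    and hom: "\<And>v v'. v \<in> carrier U \<Longrightarrow> v' \<in> carrier U \<Longrightarrow> h (v + v') = h v + h v'"
      "\<And>c v. v \<in> carrier U \<Longrightarrow> h (scale1 c v) = scale2 c (h v)"
      "\<And>a v. a \<in> semigroup_algebra M \<Longrightarrow> v \<in> carrier U \<Longrightarrow> h (act U a v) = act V a (h v)"
    using assms(1) unfolding module_iso_def by blast
  obtain g where g: "bij_betw g (carrier V) (carrier W)"
    and gom: "\<And>v v'. v \<in> carrier V \<Longrightarrow> v' \<in> carrier V \<Longrightarrow> g (v + v') = g v + g v'"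
      "\<And>c v. v \<in> carrier V \<Longrightarrow> g (scale2 c v) = scale3 c (g v)"
      "\<And>a v. a \<in> semigroup_algebra M \<Longrightarrow> v \<in> carrier V \<Longrightarrow> g (act V a v) = act W a (g v)"
    using assms(2) unfolding module_iso_def by blast
  have "h v \<in> carrier V" if "v \<in> carrier U" for v using h that by (auto simp: bij_betw_def)
  then show ?thesis unfolding module_iso_def
    by (intro exI[of _ "g \<circ> h"]) (simp add: bij_betw_trans[OF h g] hom gom)
qed

text \<open>A member of least \<open>dim\<close> is minimal: a basis of a strictly smaller member
  could be enlarged by a vector of \<open>W\<close> to an independent set with more elements than a
  basis of \<open>W\<close>, yet no more than the least dimension allows. Containment in
  \<open>span F\<close> keeps all these bases finite.\<close>

lemma (in vector_space) minimal_subspace: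
  assumes F: "finite F" and ne: "W0 \<in> \<W>"
    and \<W>: "\<And>W. W \<in> \<W> \<Longrightarrow> subspace W" "\<And>W. W \<in> \<W> \<Longrightarrow> W \<subseteq> span F"
  obtains W where "W \<in> \<W>" "\<And>W'. W' \<in> \<W> \<Longrightarrow> W' \<subseteq> W \<Longrightarrow> W' = W"
proof -
  obtain W where W: "W \<in> \<W>" and least: "\<And>W'. W' \<in> \<W> \<Longrightarrow> dim W \<le> dim W'"
    using ex_has_least_nat[of "\<lambda>W. W \<in> \<W>" W0 dim] ne by blast
  have "W' = W" if W': "W' \<in> \<W>" "W' \<subseteq> W" for W'
  proof (rule ccontr)
    assume "W' \<noteq> W"
    then obtain b where b: "b \<in> W" "b \<notin> W'" using W' by blast
    obtain B' where B': "B' \<subseteq> W'" "independent B'" "W' \<subseteq> span B'" "card B' = dim W'"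
      by (rule basis_exists)
    obtain B where B: "B \<subseteq> W" "independent B" "W \<subseteq> span B" "card B = dim W"
      by (rule basis_exists)
    have "B \<subseteq> span F" "B' \<subseteq> span F" using B(1) B'(1) \<W>(2)[OF W] \<W>(2)[OF W'(1)] by auto
    then have fin: "finite B" "finite B'"
      using independent_span_bound[OF F] B(2) B'(2) by auto
    have "span B' \<subseteq> W'" using B'(1) \<W>(1)[OF W'(1)] by (rule span_minimal)
    then have "b \<notin> span B'" using b(2) by blast
    then have "independent (insert b B')" using B'(2) by (rule independent_insertI)
    moreover have "b \<notin> B'" using b(2) B'(1) by blast
    moreover have "insert b B' \<subseteq> span B" using b B' B W' by blast
    ultimately have "Suc (card B') \<le> card B"
      using independent_span_bound[OF fin(1), of "insert b B'"] fin by simp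
    then show False using least[OF W'(1)] B B' by simp
  qed
  with W that show ?thesis by blast
qed

section \<open>Characters\<close>

lemma characters_mult:
  "\<phi> \<in> characters \<Longrightarrow> e \<in> idems \<Longrightarrow> f \<in> idems \<Longrightarrow> \<phi> (e * f) \<longleftrightarrow> \<phi> e \<and> \<phi> f"
  by (simp add: characters_def)

lemma characters_extensional: "\<phi> \<in> characters \<Longrightarrow> \<phi> \<in> extensional idems"
  by (simp add: characters_def)

lemma characters_nonzero: "\<phi> \<in> characters \<Longrightarrow> \<exists>e\<in>idems. \<phi> e"
  by (simp add: characters_def)

lemma spectral_act_apply: "e \<in> idems \<Longrightarrow> spectral_act s \<phi> e = \<phi> (star s * e * s)"
  by (simp add: spectral_act_def)

lemma conj_idem_mult:
  assumes "e \<in> idems" "f \<in> idems"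
  shows "(star s * e * s) * (star s * f * s) = star s * (e * f) * s"
proof -
  have "(star s * e * s) * (star s * f * s) = star s * (e * (s * star s)) * f * s"
    by (simp add: mult.assoc)
  also have "\<dots> = (star s * s * star s) * (e * f) * s"
    by (simp add: idems_commute[OF assms(1) star_mult_idem(2)] mult.assoc)
  finally show ?thesis by (simp add: star_props)
qed

text \<open>The idempotent \<open>star s * e * s\<close> lies below \<open>star s * s\<close>, and
  characters are monotone.\<close>

lemma characters_dom:
  assumes \<phi>: "\<phi> \<in> characters" and e: "e \<in> idems" "\<phi> (star s * e * s)"
  shows "\<phi> (star s * s)"
proof -
  have "(star s * e * s) * (star s * s) = star s * e * s"
    by (metis mult.assoc star_props(1))
  then show ?thesis
    using characters_mult[OF \<phi> star_conj_idem[OF e(1)] star_mult_idem(1)] e(2) by metis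
qed

lemma spectral_act_characters:
  assumes \<phi>: "\<phi> \<in> characters" and s: "\<phi> (star s * s)"
  shows "spectral_act s \<phi> \<in> characters"
  unfolding characters_def
proof (intro CollectI conjI ballI)
  show "spectral_act s \<phi> \<in> extensional idems" by (simp add: spectral_act_def)
  show "\<exists>e\<in>idems. spectral_act s \<phi> e"
  proof
    show "spectral_act s \<phi> (s * star s)"
      using s by (simp add: spectral_act_apply star_mult_idem star_props flip: mult.assoc)
  qed (rule star_mult_idem)
  fix e f :: 'a assume "e \<in> idems" "f \<in> idems"
  then show "spectral_act s \<phi> (e * f) = (spectral_act s \<phi> e \<and> spectral_act s \<phi> f)"
    using characters_mult[OF \<phi>, of "star s * e * s" "star s * f * s"]
    by (simp add: spectral_act_apply idems_mult_closed conj_idem_mult star_conj_idem)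
qed

text \<open>No domain condition appears, because \<open>spectral_act\<close> is a total formula and
  conjugates of idempotents are idempotents. Domains are tracked separately, by
  \<open>domain_mult\<close>.\<close>

lemma spectral_act_mult: "spectral_act (s * t) \<phi> = spectral_act s (spectral_act t \<phi>)"
proof (rule extensionalityI[of _ idems])
  fix e :: 'a assume e: "e \<in> idems"
  have "star (s * t) * e * (s * t) = star t * (star s * e * s) * t"
    by (simp add: star_mult mult.assoc)
  then show "spectral_act (s * t) \<phi> e = spectral_act s (spectral_act t \<phi>) e"
    using e by (simp add: spectral_act_apply star_conj_idem)
qed (simp_all add: spectral_act_def)

lemma domain_mult: "\<phi> (star (s * t) * (s * t)) = spectral_act t \<phi> (star s * s)"
  by (simp add: spectral_act_apply star_mult_idem star_mult mult.assoc)

lemma spectral_act_idem: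
  assumes \<phi>: "\<phi> \<in> characters" and e: "e \<in> idems" "\<phi> e"
  shows "spectral_act e \<phi> = \<phi>"
proof (rule extensionalityI[of _ idems])
  show "\<phi> \<in> extensional idems" using \<phi> by (rule characters_extensional)
  fix f :: 'a assume f: "f \<in> idems"
  then show "spectral_act e \<phi> f = \<phi> f"
    using e by (simp add: spectral_act_apply idems_star idems_mult_closed characters_mult[OF \<phi>])
qed (simp add: spectral_act_def)

lemma spectral_act_star:
  assumes "\<phi> \<in> characters" "\<phi> (star s * s)"
  shows "spectral_act (star s) (spectral_act s \<phi>) = \<phi>"
  using spectral_act_idem[OF assms(1) star_mult_idem(1) assms(2)] by (simp add: spectral_act_mult)

lemma spectral_act_domain_star:
  "\<phi> (star s * s) \<Longrightarrow> spectral_act s \<phi> (s * star s)"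
  by (simp add: spectral_act_apply star_mult_idem star_props flip: mult.assoc)

text \<open>In place of an identity of \<open>S\<close>, an idempotent on which
  \<open>\<phi>\<close> is true fixes \<open>\<phi>\<close>.\<close>

lemma spectral_orbit_refl: "\<phi> \<in> characters \<Longrightarrow> \<phi> \<in> spectral_orbit \<phi>"
proof -
  assume \<phi>: "\<phi> \<in> characters"
  then obtain e where e: "e \<in> idems" "\<phi> e" using characters_nonzero by blast
  then have "\<phi> = spectral_act e \<phi>" "\<phi> (star e * e)"
    using spectral_act_idem[OF \<phi> e] by (auto simp: idems_star idems_def)
  then show ?thesis by (auto simp: spectral_orbit_def)
qed

lemma spectral_orbit_characters: "\<phi> \<in> characters \<Longrightarrow> \<psi> \<in> spectral_orbit \<phi> \<Longrightarrow> \<psi> \<in> characters"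
  by (auto simp: spectral_orbit_def spectral_act_characters)

lemma spectral_orbit_closed:
  assumes "\<psi> \<in> spectral_orbit \<phi>" "\<psi> (star s * s)"
  shows "spectral_act s \<psi> \<in> spectral_orbit \<phi>"
proof -
  obtain t where t: "\<psi> = spectral_act t \<phi>" "\<phi> (star t * t)"
    using assms(1) by (auto simp: spectral_orbit_def)
  then show ?thesis using assms(2)
    by (auto simp: spectral_orbit_def domain_mult spectral_act_mult intro!: exI[of _ "s * t"])
qed

lemma idem_in_stabilizer_iff:
  "\<phi> \<in> characters \<Longrightarrow> e \<in> idems \<Longrightarrow> e \<in> stabilizer \<phi> \<longleftrightarrow> \<phi> e"
  using spectral_act_idem[of \<phi> e] by (auto simp: stabilizer_def idems_star) (auto simp: idems_def)

section \<open>Weight spaces\<close>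

text \<open>The operators are total and linear on the whole ambient space, so that facts about
  linear maps apply without carrier conditions. For a given module they come from
  \<open>global_basis_act\<close>.\<close>

locale inv_rep = vector_space scale
  for scale :: "'k::field \<Rightarrow> 'v::ab_group_add \<Rightarrow> 'v" +
  fixes \<rho> :: "'s::inverse_semigroup \<Rightarrow> 'v \<Rightarrow> 'v"
  assumes linear_\<rho>: "Vector_Spaces.linear scale scale (\<rho> s)"
    and \<rho>_mult: "\<rho> (s * t) v = \<rho> s (\<rho> t v)"
begin

sublocale \<rho>: Vector_Spaces.linear scale scale "\<rho> s" for s
  by (rule linear_\<rho>)

definition weight :: "('s \<Rightarrow> bool) \<Rightarrow> 'v set" where
  "weight \<phi> = {v. \<forall>e\<in>idems. \<rho> e v = (if \<phi> e then v else 0)}"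

lemma weightD: "v \<in> weight \<phi> \<Longrightarrow> e \<in> idems \<Longrightarrow> \<rho> e v = (if \<phi> e then v else 0)"
  by (simp add: weight_def)

lemma subspace_weight: "subspace (weight \<phi>)"
  by (rule subspaceI) (auto simp: weight_def \<rho>.add \<rho>.scale)

text \<open>Moving \<open>e\<close> past \<open>s\<close> conjugates it:
  \<open>e * s = s * (star s * e * s)\<close>. The claim also covers the case that
  \<open>\<phi>\<close> is outside the domain of \<open>s\<close>; there the vector is zero by
  \<open>\<rho>_eq_0\<close>.\<close>

lemma weight_act: "v \<in> weight \<phi> \<Longrightarrow> \<rho> s v \<in> weight (spectral_act s \<phi>)"
  unfolding weight_def[of "spectral_act s \<phi>"]
proof (intro CollectI ballI)
  fix e :: 's assume v: "v \<in> weight \<phi>" and e: "e \<in> idems"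
  have "s * (star s * e * s) = (s * star s) * e * s" by (simp add: mult.assoc)
  also have "\<dots> = e * s"
    by (metis idems_commute[OF star_mult_idem(2) e] mult.assoc star_props(1))
  finally have "\<rho> e (\<rho> s v) = \<rho> s (\<rho> (star s * e * s) v)" by (metis \<rho>_mult)
  then show "\<rho> e (\<rho> s v) = (if spectral_act s \<phi> e then \<rho> s v else 0)"
    using weightD[OF v star_conj_idem[OF e]] e by (simp add: spectral_act_apply)
qed

lemma \<rho>_star: "v \<in> weight \<phi> \<Longrightarrow> \<phi> (star s * s) \<Longrightarrow> \<rho> (star s) (\<rho> s v) = v"
  using weightD[of v \<phi> "star s * s"] by (simp add: star_mult_idem \<rho>_mult)

lemma \<rho>_eq_0: "v \<in> weight \<phi> \<Longrightarrow> \<not> \<phi> (star s * s) \<Longrightarrow> \<rho> s v = 0"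
proof -
  assume "v \<in> weight \<phi>" "\<not> \<phi> (star s * s)"
  then have "\<rho> (star s * s) v = 0" using weightD[of v \<phi> "star s * s"] by (simp add: star_mult_idem)
  then have "\<rho> (s * (star s * s)) v = 0" by (simp add: \<rho>_mult[of s])
  then show ?thesis by (simp add: star_props flip: mult.assoc)
qed

text \<open>\<open>P\<close> is a projection that need only be correct on the listed weights. The
  last clause keeps it inside every invariant subspace, so that a weight component of a vector of a
  submodule stays in that submodule.\<close>

definition separates :: "('v \<Rightarrow> 'v) \<Rightarrow> ('s \<Rightarrow> bool) \<Rightarrow> ('s \<Rightarrow> bool) set \<Rightarrow> bool" where
  "separates P \<phi> \<Psi> \<longleftrightarrow> Vector_Spaces.linear scale scale P \<and> (\<forall>v\<in>weight \<phi>. P v = v) \<and>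
     (\<forall>\<psi>\<in>\<Psi>. \<forall>v\<in>weight \<psi>. P v = 0) \<and>
     (\<forall>W. subspace W \<and> (\<forall>s. \<forall>w\<in>W. \<rho> s w \<in> W) \<longrightarrow> (\<forall>w\<in>W. P w \<in> W))"

text \<open>The operator is a product of factors \<open>\<rho> e\<close> and \<open>1 - \<rho> e\<close>, one for each member of \<open>\<Psi>\<close>.\<close>

lemma separating_operator:
  assumes "finite \<Psi>" "\<Psi> \<subseteq> extensional idems" "\<phi> \<in> extensional idems" "\<phi> \<notin> \<Psi>"
  shows "\<exists>P. separates P \<phi> \<Psi>"
proof -
  interpret vector_space_pair scale scale ..
  let ?inv = "\<lambda>W. subspace W \<and> (\<forall>s. \<forall>w\<in>W. \<rho> s w \<in> W)"
  show ?thesis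
    unfolding separates_def using assms
  proof (induction \<Psi> rule: finite_induct)
    case empty
    show ?case by (rule exI[of _ "\<lambda>v. v"]) (simp add: linear_ident)
  next
    case (insert \<psi> \<Psi>)
    then obtain P where P: "Vector_Spaces.linear scale scale P" "\<forall>v\<in>weight \<phi>. P v = v"
      "\<forall>\<psi>\<in>\<Psi>. \<forall>v\<in>weight \<psi>. P v = 0" "\<forall>W. ?inv W \<longrightarrow> (\<forall>w\<in>W. P w \<in> W)" by auto
    have "\<phi> \<noteq> \<psi>" "\<psi> \<in> extensional idems" using insert.prems by auto
    then obtain e where e: "e \<in> idems" "\<phi> e \<noteq> \<psi> e"
      using extensionalityI[OF insert.prems(2)] by blast
    \<comment> \<open>Of the two operators \<open>\<rho> e\<close> and \<open>1 - \<rho> e\<close>,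
      this is the one fixing the weight space of \<open>\<phi>\<close>. It annihilates that of
      \<open>\<psi>\<close>, since the characters differ at \<open>e\<close>, and is 0 or 1 on every
      other one, so what \<open>P\<close> annihilates stays annihilated.\<close>
    define Q where "Q v = (if \<phi> e then \<rho> e v else v - \<rho> e v)" for v
    have Q: "Vector_Spaces.linear scale scale Q"
      unfolding Q_def by (cases "\<phi> e") (simp_all add: linear_\<rho> linear_compose_sub linear_ident)
    have Q\<chi>: "Q v = (if \<phi> e = \<chi> e then v else 0)" if "v \<in> weight \<chi>" for v \<chi>
      using weightD[OF that e(1)] by (auto simp: Q_def)
    interpret P: Vector_Spaces.linear scale scale P by (rule P(1))
    show ?case
    proof (intro exI[of _ "P \<circ> Q"] conjI allI impI ballI)
      show "Vector_Spaces.linear scale scale (P \<circ> Q)" by (rule Vector_Spaces.linear_compose[OF Q P(1)])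
      show "(P \<circ> Q) v = v" if "v \<in> weight \<phi>" for v using P that Q\<chi>[OF that] by simp
      show "(P \<circ> Q) v = 0" if "\<chi> \<in> insert \<psi> \<Psi>" "v \<in> weight \<chi>" for \<chi> v
        using that P Q\<chi>[OF that(2)] e by (auto split: if_splits)
      show "(P \<circ> Q) w \<in> W" if W: "?inv W" and w: "w \<in> W" for W w
      proof -
        have "Q w \<in> W" using W w by (auto simp: Q_def subspace_diff)
        then show ?thesis using P(4) W by auto
      qed
    qed
  qed
qed

lemma separatesD:
  assumes "separates P \<phi> \<Psi>"
  shows "Vector_Spaces.linear scale scale P" "v \<in> weight \<phi> \<Longrightarrow> P v = v"
    "\<psi> \<in> \<Psi> \<Longrightarrow> v \<in> weight \<psi> \<Longrightarrow> P v = 0"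
    "subspace W \<Longrightarrow> (\<And>s w. w \<in> W \<Longrightarrow> \<rho> s w \<in> W) \<Longrightarrow> w \<in> W \<Longrightarrow> P w \<in> W"
  using assms by (auto simp: separates_def)

lemma weight_inter:
  assumes "\<phi> \<in> extensional idems" "\<psi> \<in> extensional idems" "\<phi> \<noteq> \<psi>" "v \<in> weight \<phi>" "v \<in> weight \<psi>"
  shows "v = 0"
proof -
  obtain P where "separates P \<phi> {\<psi>}" using separating_operator[of "{\<psi>}" \<phi>] assms by auto
  then show ?thesis using separatesD(2,3) assms(4,5) by (metis singletonI)
qed

text \<open>Nonzero weight vectors of different characters are independent, because a separating
  operator isolates any one term of a vanishing combination. An independent subset of
  \<open>span F\<close> is finite.\<close>

lemma finite_weights:
  assumes F: "finite F" and \<Psi>: "\<Psi> \<subseteq> extensional idems"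
    and ex: "\<And>\<psi>. \<psi> \<in> \<Psi> \<Longrightarrow> \<exists>v \<in> weight \<psi> \<inter> span F. v \<noteq> 0"
  shows "finite \<Psi>"
proof -
  obtain f where f: "\<And>\<psi>. \<psi> \<in> \<Psi> \<Longrightarrow> f \<psi> \<in> weight \<psi>" "\<And>\<psi>. \<psi> \<in> \<Psi> \<Longrightarrow> f \<psi> \<in> span F"
    "\<And>\<psi>. \<psi> \<in> \<Psi> \<Longrightarrow> f \<psi> \<noteq> 0"
    using ex by (metis Int_iff)
  have inj: "inj_on f \<Psi>"
  proof (rule inj_onI, rule ccontr)
    fix \<psi> \<chi> assume *: "\<psi> \<in> \<Psi>" "\<chi> \<in> \<Psi>" "f \<psi> = f \<chi>" "\<psi> \<noteq> \<chi>"
    then have "f \<psi> = 0" using weight_inter[of \<psi> \<chi> "f \<psi>"] f(1)[of \<psi>] f(1)[of \<chi>] \<Psi> by auto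
    then show False using f * by blast
  qed
  have "independent (f ` \<Psi>)"
    unfolding independent_explicit_module
  proof (intro allI impI)
    fix t u x assume t: "finite t" "t \<subseteq> f ` \<Psi>" and sum0: "(\<Sum>v\<in>t. scale (u v) v) = 0" and x: "x \<in> t"
    obtain \<Psi>' where \<Psi>': "\<Psi>' \<subseteq> \<Psi>" "t = f ` \<Psi>'" using t(2) by (auto simp: subset_image_iff)
    have inj': "inj_on f \<Psi>'" using inj \<Psi>'(1) by (rule inj_on_subset)
    obtain \<chi> where \<chi>: "\<chi> \<in> \<Psi>'" "x = f \<chi>" using x \<Psi>' by blast
    have fin: "finite \<Psi>'" using t(1) \<Psi>'(2) inj' by (simp add: finite_image_iff)
    have "\<exists>P. separates P \<chi> (\<Psi>' - {\<chi>})"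
      using fin \<Psi>' \<Psi> \<chi> by (intro separating_operator) auto
    then obtain P where "separates P \<chi> (\<Psi>' - {\<chi>})" ..
    note P = separatesD[OF this]
    interpret P: Vector_Spaces.linear scale scale P by (rule P(1))
    have "0 = P (\<Sum>v\<in>t. scale (u v) v)" by (simp add: sum0)
    also have "\<dots> = (\<Sum>\<psi>\<in>\<Psi>'. scale (u (f \<psi>)) (P (f \<psi>)))"
      by (simp add: \<Psi>'(2) sum.reindex[OF inj'] P.sum P.scale)
    also have "\<dots> = (\<Sum>\<psi>\<in>\<Psi>'. if \<psi> = \<chi> then scale (u x) x else 0)"
      using P(2,3) f(1) \<Psi>'(1) \<chi> by (intro sum.cong refl) auto
    finally show "u x = 0" using fin \<chi> f(3) \<Psi>'(1) by auto
  qed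
  then have "finite (f ` \<Psi>)" using independent_span_bound[OF F] f(2) by blast
  then show ?thesis using inj by (simp add: finite_image_iff)
qed

text \<open>An operator separating \<open>\<psi>\<close> from the finitely many other weights in an
  expression for \<open>v\<close> fixes \<open>v\<close> and removes all translates that do not land
  in the weight space of \<open>\<psi>\<close>. For \<open>\<psi> = \<phi>\<close> only translates
  by the stabilizer remain; for \<open>\<psi>\<close> outside the orbit of \<open>\<phi>\<close>
  nothing remains.\<close>

lemma weight_component:
  assumes \<psi>: "\<psi> \<in> extensional idems" and W: "W \<subseteq> weight \<phi>"
    and v: "v \<in> weight \<psi>" "v \<in> span {\<rho> s w | s w. w \<in> W}"
  shows "v \<in> span {\<rho> s w | s w. w \<in> W \<and> \<phi> (star s * s) \<and> spectral_act s \<phi> = \<psi>}"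
proof -
  obtain t r where t: "finite t" "t \<subseteq> {\<rho> s w | s w. w \<in> W}" and v_eq: "v = (\<Sum>x\<in>t. scale (r x) x)"
    using v(2) unfolding span_explicit by blast
  have "\<forall>x\<in>t. \<exists>s w. x = \<rho> s w \<and> w \<in> W" using t(2) by blast
  then obtain a b where ab: "\<And>x. x \<in> t \<Longrightarrow> x = \<rho> (a x) (b x)" "\<And>x. x \<in> t \<Longrightarrow> b x \<in> W"
    by metis
  have b: "b x \<in> weight \<phi>" if "x \<in> t" for x using ab(2)[OF that] W by blast
  let ?\<Psi> = "(\<lambda>x. spectral_act (a x) \<phi>) ` t - {\<psi>}"
  have "finite ?\<Psi>" "?\<Psi> \<subseteq> extensional idems" using t(1) by (auto simp: spectral_act_def)
  then have "\<exists>P. separates P \<psi> ?\<Psi>" using \<psi> by (intro separating_operator) auto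
  then obtain P where "separates P \<psi> ?\<Psi>" ..
  note P = separatesD[OF this]
  interpret P: Vector_Spaces.linear scale scale P by (rule P(1))
  let ?X = "{\<rho> s w | s w. w \<in> W \<and> \<phi> (star s * s) \<and> spectral_act s \<phi> = \<psi>}"
  have "P x \<in> span ?X" if x: "x \<in> t" for x
  proof (cases "\<phi> (star (a x) * a x)")
    case False
    then have "\<rho> (a x) (b x) = 0" by (rule \<rho>_eq_0[OF b[OF x]])
    then have "x = 0" using ab(1)[OF x] by simp
    then show ?thesis by (simp add: span_zero)
  next
    case True
    have wt: "x \<in> weight (spectral_act (a x) \<phi>)" using weight_act[OF b[OF x], of "a x"] ab(1)[OF x] by simp
    show ?thesis
    proof (cases "spectral_act (a x) \<phi> = \<psi>")
      case eq: True
      have "\<rho> (a x) (b x) \<in> ?X" using ab(2)[OF x] True eq by blast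
      then have "x \<in> span ?X" using ab(1)[OF x] by (simp add: span_base)
      moreover have "P x = x" using wt unfolding eq by (rule P(2))
      ultimately show ?thesis by simp
    next
      case False
      then have "P x = 0" using x by (intro P(3)[OF _ wt]) blast
      then show ?thesis by (simp add: span_zero)
    qed
  qed
  then have "P v \<in> span ?X" unfolding v_eq P.sum P.scale by (intro span_sum span_scale)
  then show ?thesis using P(2) v(1) by simp
qed

end

lemma (in vector_space) finite_spanning_subset:
  assumes "finite F" "subspace W" "W \<subseteq> span F"
  shows "\<exists>B. finite B \<and> W = span B"
proof -
  obtain B where B: "B \<subseteq> W" "independent B" "W \<subseteq> span B"
    by (rule maximal_independent_subset)
  have "finite B" using independent_span_bound[OF assms(1) B(2)] B(1) assms(3) by blast
  moreover have "W = span B" using B(3) span_minimal[OF B(1) assms(2)] by blast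
  ultimately show ?thesis by blast
qed

text \<open>This version refers to the module alone and not to a chosen extension
  \<open>\<rho>\<close> of its operators, so weight spaces of different modules can be
  compared.\<close>

definition weight_space :: "('s::inverse_semigroup \<Rightarrow>\<^sub>0 'k::field, 'v::ab_group_add) alg_module \<Rightarrow> ('s \<Rightarrow> bool) \<Rightarrow> 'v set" where
  "weight_space V \<phi> = {v \<in> carrier V. \<forall>e\<in>idems. basis_act V e v = (if \<phi> e then v else 0)}"

locale inv_module = inv_rep scale \<rho> + nd_module scale "UNIV :: 's set" "(*)" V
  for scale :: "'k::field \<Rightarrow> 'v::ab_group_add \<Rightarrow> 'v" and \<rho> :: "'s::inverse_semigroup \<Rightarrow> 'v \<Rightarrow> 'v"
    and V :: "('s \<Rightarrow>\<^sub>0 'k, 'v) alg_module" +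
  assumes \<rho>_carrier: "\<rho> s v \<in> carrier V"
    and \<rho>_eq_basis_act: "v \<in> carrier V \<Longrightarrow> \<rho> s v = basis_act V s v"

lemma inv_module_exists:
  fixes V :: "('s::inverse_semigroup \<Rightarrow>\<^sub>0 'k::field, 'v::ab_group_add) alg_module"
  assumes "nd_module scale UNIV (*) V"
  shows "\<exists>\<rho>. inv_module scale \<rho> V"
proof -
  interpret nd_module scale "UNIV :: 's set" "(*)" V by fact
  show ?thesis
  proof (rule global_basis_act[OF UNIV_I])
    fix \<rho>
    assume "\<And>s. s \<in> UNIV \<Longrightarrow> Vector_Spaces.linear scale scale (\<rho> s)"
      "\<And>s t v. s \<in> UNIV \<Longrightarrow> t \<in> UNIV \<Longrightarrow> \<rho> (s * t) v = \<rho> s (\<rho> t v)"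
      "\<And>s v. s \<in> UNIV \<Longrightarrow> \<rho> s v \<in> carrier V"
      "\<And>s v. s \<in> UNIV \<Longrightarrow> v \<in> carrier V \<Longrightarrow> \<rho> s v = basis_act V s v"
    then have "inv_module scale \<rho> V"
      by (intro inv_module.intro inv_rep.intro inv_rep_axioms.intro inv_module_axioms.intro
          vector_space_axioms nd_module_axioms) simp_all
    then show ?thesis by (rule exI[of _ \<rho>])
  qed
qed

section \<open>Weights of a simple module\<close>

context inv_module
begin

text \<open>Some idempotent is true under \<open>\<phi>\<close>, and its operator fixes a weight
  vector while mapping into the carrier.\<close>

lemma weight_subset_carrier: "\<phi> \<in> characters \<Longrightarrow> weight \<phi> \<subseteq> carrier V"
proof
  fix v assume \<phi>: "\<phi> \<in> characters" and v: "v \<in> weight \<phi>"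
  obtain e where "e \<in> idems" "\<phi> e" using characters_nonzero[OF \<phi>] by blast
  then have "\<rho> e v = v" using weightD[OF v] by simp
  then show "v \<in> carrier V" using \<rho>_carrier[of e v] by simp
qed

lemma weight_eq_weight_space:
  assumes "\<phi> \<in> characters"
  shows "weight \<phi> = weight_space V \<phi>"
proof (rule Set.set_eqI)
  fix v
  have "v \<in> weight \<phi> \<Longrightarrow> v \<in> carrier V" using weight_subset_carrier[OF assms] by blast
  then show "v \<in> weight \<phi> \<longleftrightarrow> v \<in> weight_space V \<phi>"
    unfolding weight_def weight_space_def mem_Collect_eq using \<rho>_eq_basis_act[of v] by metis
qed

lemma span_\<rho>: "carrier V = span {\<rho> s v | s v. v \<in> carrier V}"
proof -
  have "{\<rho> s v | s v. v \<in> carrier V} = {basis_act V s v | s v. s \<in> UNIV \<and> v \<in> carrier V}"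
    using \<rho>_eq_basis_act by (metis (no_types, opaque_lifting) UNIV_I)
  then show ?thesis using span_basis_act by simp
qed

lemma simple_dichotomy:
  assumes "simple_module scale UNIV (*) V" "W \<subseteq> carrier V" "subspace W"
    "\<And>s w. w \<in> W \<Longrightarrow> \<rho> s w \<in> W"
  shows "W = {0} \<or> W = carrier V"
proof (rule simple_module_dichotomy[OF assms(1-3)])
  fix s w assume "w \<in> W"
  then show "basis_act V s w \<in> W" using assms(2,4) \<rho>_eq_basis_act by (metis subsetD)
qed

text \<open>In a minimal nonzero subspace \<open>W\<close> invariant under all idempotents, the
  image of \<open>W\<close> under an idempotent is again invariant by commutativity, hence zero or
  all of \<open>W\<close>. An idempotent operator that is onto is the identity, so each idempotent
  acts on \<open>W\<close> as 0 or 1, and every nonzero vector of \<open>W\<close> is a weight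
  vector.\<close>

lemma weight_exists:
  assumes simple: "simple_module scale UNIV (*) V" and fin: "finite_dim_module scale V"
  shows "\<exists>\<phi>\<in>characters. weight \<phi> \<noteq> {0}"
proof -
  obtain F where F: "finite F" "carrier V = span F" using fin by (auto simp: finite_dim_module_def)
  have "\<exists>s v. \<rho> s v \<noteq> 0"
  proof (rule ccontr)
    assume "\<not> ?thesis"
    then have "{\<rho> s v | s v. v \<in> carrier V} \<subseteq> {0}" by auto
    then have "span {\<rho> s v | s v. v \<in> carrier V} \<subseteq> {0}" using subspace_single_0 by (rule span_minimal)
    then have "carrier V \<subseteq> {0}" using span_\<rho> by simp
    then show False using simple subspace_0[OF subspace_carrier] by (auto simp: simple_module_def)
  qed
  then obtain s v where sv: "\<rho> s v \<noteq> 0" by blast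
  \<comment> \<open>A character must be true somewhere. Working inside the nonzero image of
    \<open>e0\<close> guarantees that it is true at \<open>e0\<close>; otherwise a vector
    annihilated by all idempotents might be found.\<close>
  define e0 where "e0 = s * star s"
  have e0: "e0 \<in> idems" by (simp add: e0_def star_mult_idem)
  have e0s: "\<rho> e0 (\<rho> s v) = \<rho> s v" by (simp add: e0_def star_props flip: \<rho>_mult)
  define X where "X = {v \<in> carrier V. \<rho> e0 v = v}"
  have commute: "\<rho> e (\<rho> f v) = \<rho> f (\<rho> e v)" if "e \<in> idems" "f \<in> idems" for e f v
    using idems_commute[OF that] by (metis \<rho>_mult)
  define \<W> where "\<W> = {W. subspace W \<and> W \<noteq> {0} \<and> W \<subseteq> X \<and> (\<forall>e\<in>idems. \<rho> e ` W \<subseteq> W)}"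
  have "subspace X"
    using subspace_carrier by (auto simp: X_def subspace_def \<rho>.add \<rho>.scale)
  moreover have "\<rho> s v \<in> X" using e0s \<rho>_carrier by (simp add: X_def)
  ultimately have "X \<in> \<W>" using sv e0 commute \<rho>_carrier by (auto simp: \<W>_def X_def)
  moreover have "subspace W" "W \<subseteq> span F" if "W \<in> \<W>" for W
    using that F(2) by (auto simp: \<W>_def X_def)
  ultimately obtain W where W: "W \<in> \<W>" and min: "\<And>W'. W' \<in> \<W> \<Longrightarrow> W' \<subseteq> W \<Longrightarrow> W' = W"
    using minimal_subspace[OF F(1), of X \<W>] by blast
  have dich: "(\<forall>w\<in>W. \<rho> e w = 0) \<or> (\<forall>w\<in>W. \<rho> e w = w)" if e: "e \<in> idems" for e
  proof -
    have "\<rho> e ` W = {0} \<or> \<rho> e ` W = W"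
    proof (cases "\<rho> e ` W = {0}")
      case False
      have sub: "\<rho> e ` W \<subseteq> W" using W e by (simp add: \<W>_def)
      have "\<rho> f (\<rho> e w) \<in> \<rho> e ` W" if "f \<in> idems" "w \<in> W" for f w
      proof -
        have "\<rho> f w \<in> W" using W that by (auto simp: \<W>_def)
        then show ?thesis using commute[OF that(1) e] by simp
      qed
      moreover have "subspace (\<rho> e ` W)" "\<rho> e ` W \<subseteq> X"
        using W sub by (auto simp: \<W>_def intro: \<rho>.subspace_image)
      ultimately have "\<rho> e ` W \<in> \<W>" using False by (auto simp: \<W>_def)
      then show ?thesis using min sub by blast
    qed simp
    then show ?thesis
    proof
      assume eq: "\<rho> e ` W = W"
      have "\<rho> e w = w" if "w \<in> W" for w
      proof -
        have "w \<in> \<rho> e ` W" using that eq by simp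
        then obtain w' where "w = \<rho> e w'" by (rule imageE)
        then show ?thesis using e by (simp add: idems_def flip: \<rho>_mult)
      qed
      then show ?thesis by blast
    qed auto
  qed
  have "0 \<in> W" using W by (simp add: \<W>_def subspace_0)
  then obtain w where w: "w \<in> W" "w \<noteq> 0" using W by (auto simp: \<W>_def)
  define \<phi> where "\<phi> = (\<lambda>e\<in>idems. \<rho> e w = w)"
  have act: "\<rho> e w = (if \<phi> e then w else 0)" if "e \<in> idems" for e
    using dich[OF that] w(1) that by (auto simp: \<phi>_def)
  have "\<phi> \<in> characters"
    unfolding characters_def
  proof (intro CollectI conjI ballI)
    show "\<exists>e\<in>idems. \<phi> e" using e0 W w by (auto simp: \<phi>_def \<W>_def X_def)
    fix e f :: 's assume ef: "e \<in> idems" "f \<in> idems"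
    have "\<rho> (e * f) w = (if \<phi> e \<and> \<phi> f then w else 0)"
      using act[OF ef(1)] act[OF ef(2)] by (simp add: \<rho>_mult)
    then show "\<phi> (e * f) = (\<phi> e \<and> \<phi> f)"
      using act[OF idems_mult_closed[OF ef]] w(2) by (auto split: if_splits)
  qed (simp add: \<phi>_def)
  moreover have "w \<in> weight \<phi>" using act by (simp add: weight_def)
  ultimately show ?thesis using w by blast
qed

lemma weight_act_nonzero:
  assumes "weight \<phi> \<noteq> {0}" "\<phi> (star s * s)"
  shows "weight (spectral_act s \<phi>) \<noteq> {0}"
proof -
  obtain v where v: "v \<in> weight \<phi>" "v \<noteq> 0" using assms(1) subspace_0[OF subspace_weight] by blast
  then have "\<rho> s v \<noteq> 0" using \<rho>_star[OF v(1) assms(2)] by auto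
  then show ?thesis using weight_act[OF v(1), of s] by blast
qed

lemma finite_index_weight:
  assumes fin: "finite_dim_module scale V" and \<phi>: "\<phi> \<in> characters" "weight \<phi> \<noteq> {0}"
  shows "finite_index \<phi>"
proof -
  obtain F where F: "finite F" "carrier V = span F" using fin by (auto simp: finite_dim_module_def)
  show ?thesis unfolding finite_index_def
  proof (rule finite_weights[OF F(1)])
    show "spectral_orbit \<phi> \<subseteq> extensional idems"
      using spectral_orbit_characters[OF \<phi>(1)] characters_extensional by blast
    fix \<psi> assume \<psi>: "\<psi> \<in> spectral_orbit \<phi>"
    then have "weight \<psi> \<noteq> {0}" using weight_act_nonzero[OF \<phi>(2)] by (auto simp: spectral_orbit_def)
    moreover have "weight \<psi> \<subseteq> span F"
      using weight_subset_carrier[OF spectral_orbit_characters[OF \<phi>(1) \<psi>]] F by simp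
    ultimately show "\<exists>v\<in>weight \<psi> \<inter> span F. v \<noteq> 0"
      using subspace_0[OF subspace_weight] by blast
  qed
qed

lemma weight_generates:
  assumes simple: "simple_module scale UNIV (*) V" and \<phi>: "\<phi> \<in> characters"
    and W: "W \<subseteq> weight \<phi>" "w \<in> W" "w \<noteq> 0"
  shows "carrier V \<subseteq> span {\<rho> s w | s w. w \<in> W}" (is "_ \<subseteq> span ?X")
proof -
  have X: "span ?X \<subseteq> carrier V" by (rule span_minimal) (auto simp: \<rho>_carrier subspace_carrier)
  \<comment> \<open>This \<open>e\<close> fixes \<open>w\<close> and thereby puts \<open>w\<close>
    itself among the translates, so their span is nonzero.\<close>
  obtain e where e: "e \<in> idems" "\<phi> e" using characters_nonzero[OF \<phi>] by blast
  then have "\<rho> e w = w" using weightD[of w \<phi> e] W by auto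
  then have "w \<in> ?X" using W(2) by (auto intro!: exI[of _ e] exI[of _ w])
  then have ne: "span ?X \<noteq> {0}" using W(3) span_base[of w ?X] by auto
  have "\<rho> s x \<in> span ?X" if "x \<in> span ?X" for s x
  proof -
    have "\<rho> s ` ?X \<subseteq> ?X"
    proof (clarify)
      fix t w assume "w \<in> W"
      then show "\<exists>s' w'. \<rho> s (\<rho> t w) = \<rho> s' w' \<and> w' \<in> W"
        by (intro exI[of _ "s * t"] exI[of _ w]) (simp add: \<rho>_mult)
    qed
    then have "span (\<rho> s ` ?X) \<subseteq> span ?X" by (rule span_mono)
    then show ?thesis using \<rho>.span_image[of s ?X] that by blast
  qed
  then show ?thesis using simple_dichotomy[OF simple X subspace_span] ne by blast
qed

text \<open>The translates of \<open>W\<close> span \<open>V\<close> by simplicity. By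
  \<open>weight_component\<close>, a vector of weight \<open>\<phi>\<close> is already a combination
  of translates by stabilizer elements, and these lie in \<open>W\<close>.\<close>

lemma weight_simple:
  assumes simple: "simple_module scale UNIV (*) V" and \<phi>: "\<phi> \<in> characters"
    and W: "W \<subseteq> weight \<phi>" "subspace W" "W \<noteq> {0}"
      "\<And>s w. s \<in> stabilizer \<phi> \<Longrightarrow> w \<in> W \<Longrightarrow> \<rho> s w \<in> W"
  shows "weight \<phi> \<subseteq> W"
proof
  fix v assume v: "v \<in> weight \<phi>"
  obtain w where w: "w \<in> W" "w \<noteq> 0" using W(3) subspace_0[OF W(2)] by blast
  have "v \<in> span {\<rho> s w | s w. w \<in> W}"
    using weight_generates[OF simple \<phi> W(1) w] weight_subset_carrier[OF \<phi>] v by blast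
  then have "v \<in> span {\<rho> s w | s w. w \<in> W \<and> \<phi> (star s * s) \<and> spectral_act s \<phi> = \<phi>}"
    by (rule weight_component[OF characters_extensional[OF \<phi>] W(1) v])
  moreover have "{\<rho> s w | s w. w \<in> W \<and> \<phi> (star s * s) \<and> spectral_act s \<phi> = \<phi>} \<subseteq> W"
    using W(4) by (auto simp: stabilizer_def)
  ultimately show "v \<in> W" using span_minimal[OF _ W(2)] by blast
qed

text \<open>All of \<open>V\<close> is spanned by translates of the weight space of
  \<open>\<phi>\<close>. If no translate lands in weight \<open>\<psi>\<close>, then
  \<open>weight_component\<close> expresses every vector of that weight by an empty span.\<close>

lemma weight_orbit:
  assumes simple: "simple_module scale UNIV (*) V" and \<phi>: "\<phi> \<in> characters" "weight \<phi> \<noteq> {0}"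
    and \<psi>: "\<psi> \<in> characters" "weight \<psi> \<noteq> {0}"
  shows "\<psi> \<in> spectral_orbit \<phi>"
proof (rule ccontr)
  assume no: "\<psi> \<notin> spectral_orbit \<phi>"
  obtain v where v: "v \<in> weight \<psi>" "v \<noteq> 0" using \<psi>(2) subspace_0[OF subspace_weight] by blast
  obtain w where w: "w \<in> weight \<phi>" "w \<noteq> 0" using \<phi>(2) subspace_0[OF subspace_weight] by blast
  have "v \<in> span {\<rho> s w | s w. w \<in> weight \<phi>}"
    using weight_generates[OF simple \<phi>(1) subset_refl w] weight_subset_carrier[OF \<psi>(1)] v by blast
  then have "v \<in> span {\<rho> s w | s w. w \<in> weight \<phi> \<and> \<phi> (star s * s) \<and> spectral_act s \<phi> = \<psi>}"
    by (rule weight_component[OF characters_extensional[OF \<psi>(1)] subset_refl v(1)])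
  moreover have "{\<rho> s w | s w. w \<in> weight \<phi> \<and> \<phi> (star s * s) \<and> spectral_act s \<phi> = \<psi>} = {}"
    using no by (auto simp: spectral_orbit_def)
  ultimately have "v \<in> span {}" by metis
  then show False using v(2) by simp
qed

end

section \<open>Modules over the maximal group image of a stabilizer\<close>

abbreviation stab_group :: "('s::inverse_semigroup \<Rightarrow> bool) \<Rightarrow> 's set monoid" where
  "stab_group \<phi> \<equiv> max_group_image (stabilizer \<phi>)"

abbreviation stab_class :: "('s::inverse_semigroup \<Rightarrow> bool) \<Rightarrow> 's \<Rightarrow> 's set" where
  "stab_class \<phi> s \<equiv> max_group_rel (stabilizer \<phi>) `` {s}"

lemma stabilizer_mult: "\<phi> \<in> characters \<Longrightarrow> s \<in> stabilizer \<phi> \<Longrightarrow> t \<in> stabilizer \<phi> \<Longrightarrow> s * t \<in> stabilizer \<phi>"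
  using inverse_subsemigroup_stabilizer by (auto simp: inverse_subsemigroup_def)

lemma carrier_stab_group: "carrier (stab_group \<phi>) = stab_class \<phi> ` stabilizer \<phi>"
  by (auto simp: max_group_image_def quotient_def)

lemma stab_group_mult:
  "\<phi> \<in> characters \<Longrightarrow> s \<in> stabilizer \<phi> \<Longrightarrow> t \<in> stabilizer \<phi> \<Longrightarrow>
    mult (stab_group \<phi>) (stab_class \<phi> s) (stab_class \<phi> t) = stab_class \<phi> (s * t)"
  by (rule max_group_mult_class[OF inverse_subsemigroup_stabilizer])

lemma stab_group_closed:
  "\<phi> \<in> characters \<Longrightarrow> X \<in> carrier (stab_group \<phi>) \<Longrightarrow> Y \<in> carrier (stab_group \<phi>) \<Longrightarrow>
    mult (stab_group \<phi>) X Y \<in> carrier (stab_group \<phi>)"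
  using group.is_monoid[OF group_max_group_image[OF inverse_subsemigroup_stabilizer]]
  by (rule monoid.m_closed)

text \<open>The map \<open>h\<close> is an isomorphism of group modules onto the weight space, with
  each class acting through all of its representatives. Stating it this way avoids a module
  structure on the weight space itself, and the free \<open>scale\<close> admits modules on any
  ambient space, in particular induced ones.\<close>

definition linked :: "('k::field \<Rightarrow> 'v::ab_group_add \<Rightarrow> 'v) \<Rightarrow> ('s::inverse_semigroup \<Rightarrow>\<^sub>0 'k, 'v) alg_module \<Rightarrow>
    ('s \<Rightarrow> bool) \<Rightarrow> ('s set \<Rightarrow>\<^sub>0 'k, nat \<Rightarrow>\<^sub>0 'k) alg_module \<Rightarrow> bool" where
  "linked scale V \<phi> U \<longleftrightarrow> (\<exists>h. bij_betw h (carrier U) (weight_space V \<phi>) \<and>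
     (\<forall>u\<in>carrier U. \<forall>u'\<in>carrier U. h (u + u') = h u + h u') \<and>
     (\<forall>c. \<forall>u\<in>carrier U. h (pm_scale c u) = scale c (h u)) \<and>
     (\<forall>s\<in>stabilizer \<phi>. \<forall>u\<in>carrier U. h (basis_act U (stab_class \<phi> s) u) = basis_act V s (h u)))"

lemma linked_weight_space:
  fixes \<phi> :: "'s::inverse_semigroup \<Rightarrow> bool"
    and V :: "('s \<Rightarrow>\<^sub>0 'k::field, nat \<Rightarrow>\<^sub>0 'k) alg_module"
  assumes V: "V \<in> fd_simple_modules TYPE('k) UNIV (*)"
    and \<phi>: "\<phi> \<in> characters" "weight_space V \<phi> \<noteq> {0}"
  shows "\<exists>U \<in> fd_simple_modules TYPE('k) (carrier (stab_group \<phi>)) (mult (stab_group \<phi>)).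
    linked pm_scale V \<phi> U"
proof -
  have simple: "simple_module pm_scale UNIV (*) V" and fin: "finite_dim_module pm_scale V"
    using V by (auto simp: fd_simple_modules_def)
  from inv_module_exists[OF nd_module_fd_simple[OF V]] obtain \<rho> where "inv_module pm_scale \<rho> V" ..
  then interpret inv_module pm_scale \<rho> V .
  have W: "weight_space V \<phi> = weight \<phi>" using weight_eq_weight_space[OF \<phi>(1)] by simp
  note T = inverse_subsemigroup_stabilizer[OF \<phi>(1)]
  have stab: "\<rho> s v \<in> weight \<phi>" if "s \<in> stabilizer \<phi>" "v \<in> weight \<phi>" for s v
    using weight_act[OF that(2), of s] that(1) by (simp add: stabilizer_def)
  \<comment> \<open>Related elements satisfy \<open>e * s = f * t\<close> with idempotents of the
    stabilizer. On these \<open>\<phi>\<close> is true, so they fix every vector of weight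
    \<open>\<phi>\<close>, and the action descends to the group.\<close>
  have rel: "\<rho> s v = \<rho> t v" if st: "(s, t) \<in> max_group_rel (stabilizer \<phi>)" and v: "v \<in> weight \<phi>" for s t v
  proof -
    obtain e f where ef: "e \<in> idems" "e \<in> stabilizer \<phi>" "f \<in> idems" "f \<in> stabilizer \<phi>"
      "e * s = f * t" "s \<in> stabilizer \<phi>" "t \<in> stabilizer \<phi>"
      using st by (auto simp: max_group_rel_def natural_le_def)
    have "\<rho> e (\<rho> s v) = \<rho> s v" "\<rho> f (\<rho> t v) = \<rho> t v"
      using weightD[OF stab[OF _ v]] ef idem_in_stabilizer_iff[OF \<phi>(1)] by auto
    then show ?thesis using ef(5) by (metis \<rho>_mult)
  qed
  \<comment> \<open>A class acts through an arbitrary representative; on weight vectors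
    \<open>rel\<close> makes the choice immaterial.\<close>
  define \<sigma> where "\<sigma> X v = \<rho> (SOME s. s \<in> X) v" for X v
  have \<sigma>: "\<sigma> (stab_class \<phi> s) v = \<rho> s v" if "s \<in> stabilizer \<phi>" "v \<in> weight \<phi>" for s v
  proof -
    have "s \<in> stab_class \<phi> s" by (rule equiv_class_self[OF equiv_max_group_rel[OF T] that(1)])
    then have "(SOME t. t \<in> stab_class \<phi> s) \<in> stab_class \<phi> s" by (rule someI)
    then have "(s, SOME t. t \<in> stab_class \<phi> s) \<in> max_group_rel (stabilizer \<phi>)" by blast
    then show ?thesis using rel that(2) by (simp add: \<sigma>_def)
  qed
  define U where "U = linearized pm_scale (weight \<phi>) \<sigma>"
  have cU: "carrier U = weight \<phi>" by (simp add: U_def)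
  have aU: "basis_act U (stab_class \<phi> s) v = \<rho> s v" if "s \<in> stabilizer \<phi>" "v \<in> weight \<phi>" for s v
    using \<sigma>[OF that] by (simp add: U_def)
  have "nd_module pm_scale (carrier (stab_group \<phi>)) (mult (stab_group \<phi>)) U"
    unfolding U_def
  proof (rule nd_module_linearized[OF subspace_weight])
    show "weight \<phi> \<subseteq> span {\<sigma> X v | X v. X \<in> carrier (stab_group \<phi>) \<and> v \<in> weight \<phi>}"
    proof
      fix v assume v: "v \<in> weight \<phi>"
      obtain e where e: "e \<in> idems" "\<phi> e" using characters_nonzero[OF \<phi>(1)] by blast
      then have e': "e \<in> stabilizer \<phi>" using idem_in_stabilizer_iff[OF \<phi>(1)] by blast
      have "\<sigma> (stab_class \<phi> e) v = v" using \<sigma>[OF e' v] weightD[OF v e(1)] e by simp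
      then have "v \<in> {\<sigma> X v | X v. X \<in> carrier (stab_group \<phi>) \<and> v \<in> weight \<phi>}"
        using v e' unfolding carrier_stab_group
        by (auto intro!: exI[of _ "stab_class \<phi> e"] exI[of _ v])
      then show "v \<in> span {\<sigma> X v | X v. X \<in> carrier (stab_group \<phi>) \<and> v \<in> weight \<phi>}"
        by (rule span_base)
    qed
    show "mult (stab_group \<phi>) X Y \<in> carrier (stab_group \<phi>)"
      if "X \<in> carrier (stab_group \<phi>)" "Y \<in> carrier (stab_group \<phi>)" for X Y
      using stab_group_closed[OF \<phi>(1) that] .
    show "\<sigma> (mult (stab_group \<phi>) X Y) v = \<sigma> X (\<sigma> Y v)"
      if "X \<in> carrier (stab_group \<phi>)" "Y \<in> carrier (stab_group \<phi>)" "v \<in> weight \<phi>" for X Y v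
      using that unfolding carrier_stab_group
      by (auto simp: stab_group_mult[OF \<phi>(1)] \<sigma> stab stabilizer_mult[OF \<phi>(1)] \<rho>_mult)
  qed (auto simp: carrier_stab_group \<sigma> stab \<rho>.add \<rho>.scale subspace_add subspace_scale subspace_weight)
  then interpret U: nd_module pm_scale "carrier (stab_group \<phi>)" "mult (stab_group \<phi>)" U .
  have "simple_module pm_scale (carrier (stab_group \<phi>)) (mult (stab_group \<phi>)) U"
  proof (rule U.simple_moduleI)
    show "carrier U \<noteq> {0}" using \<phi>(2) by (simp add: cU W)
    fix X assume X: "X \<subseteq> carrier U" "subspace X" "X \<noteq> {0}"
      "\<And>s w. s \<in> carrier (stab_group \<phi>) \<Longrightarrow> w \<in> X \<Longrightarrow> basis_act U s w \<in> X"
    have "\<rho> s w \<in> X" if s: "s \<in> stabilizer \<phi>" and w: "w \<in> X" for s w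
    proof -
      have "basis_act U (stab_class \<phi> s) w \<in> X"
        using X(4)[OF _ w] s by (simp add: carrier_stab_group)
      then show ?thesis using aU[OF s] w X(1) cU by auto
    qed
    then show "carrier U \<subseteq> X" unfolding cU
      using X(1) by (intro weight_simple[OF simple \<phi>(1) _ X(2,3)]) (auto simp: cU)
  qed
  moreover have "finite_dim_module pm_scale U"
    using fin weight_subset_carrier[OF \<phi>(1)] finite_spanning_subset[OF _ subspace_weight, of _ \<phi>]
    unfolding finite_dim_module_def cU by metis
  ultimately have "U \<in> fd_simple_modules TYPE('k) (carrier (stab_group \<phi>)) (mult (stab_group \<phi>))"
    by (simp add: fd_simple_modules_def)
  moreover have "linked pm_scale V \<phi> U"
    unfolding linked_def W cU
    using weight_subset_carrier[OF \<phi>(1)]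
    by (intro exI[of _ "\<lambda>v. v"]) (auto simp: bij_betw_def aU \<rho>_eq_basis_act)
  ultimately show ?thesis by blast
qed

section \<open>Induced modules\<close>

definition fun_scale :: "('k \<Rightarrow> 'v \<Rightarrow> 'v) \<Rightarrow> 'k \<Rightarrow> ('a \<Rightarrow> 'v) \<Rightarrow> 'a \<Rightarrow> 'v" where
  "fun_scale scale c f = (\<lambda>x. scale c (f x))"

lemma fun_scale_apply [simp]: "fun_scale scale c f x = scale c (f x)"
  by (simp add: fun_scale_def)

lemma vector_space_fun_scale: "vector_space scale \<Longrightarrow> vector_space (fun_scale scale)"
  by (auto simp: vector_space_def fun_eq_iff)

lemma sum_fun_apply: "(sum f A) x = (\<Sum>a\<in>A. f a x)"
  by (induction A rule: infinite_finite_induct) simp_all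

definition delta :: "'a \<Rightarrow> 'v::zero \<Rightarrow> 'a \<Rightarrow> 'v" where
  "delta a v = (\<lambda>x. if x = a then v else 0)"

lemma eq_sum_delta:
  assumes "finite A" "\<And>a. a \<notin> A \<Longrightarrow> f a = 0"
  shows "f = (\<Sum>a\<in>A. delta a (f a))"
proof
  fix x
  have "(\<Sum>a\<in>A. delta a (f a)) x = (\<Sum>a\<in>A. if a = x then f x else 0)"
    by (auto simp: sum_fun_apply delta_def intro!: sum.cong)
  then show "f x = (\<Sum>a\<in>A. delta a (f a)) x" using assms by auto
qed

text \<open>Here \<open>\<sigma>\<close> is the action of the group pulled back to the stabilizer
  and extended to the ambient space, and \<open>\<tau>\<close> selects for each orbit point an
  element moving \<open>\<phi>\<close> there. An idempotent is demanded at \<open>\<phi>\<close> so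
  that the stabilizer acts on the fibre over \<open>\<phi>\<close> by \<open>\<sigma>\<close> itself
  and not by a conjugate.\<close>

locale induced =
  fixes \<phi> :: "'s::inverse_semigroup \<Rightarrow> bool"
    and U :: "('s set \<Rightarrow>\<^sub>0 'k::field, nat \<Rightarrow>\<^sub>0 'k) alg_module"
    and \<sigma> :: "'s \<Rightarrow> (nat \<Rightarrow>\<^sub>0 'k) \<Rightarrow> (nat \<Rightarrow>\<^sub>0 'k)"
    and \<tau> :: "('s \<Rightarrow> bool) \<Rightarrow> 's"
  assumes \<phi>: "\<phi> \<in> characters" "finite_index \<phi>"
    and U: "U \<in> fd_simple_modules TYPE('k) (carrier (stab_group \<phi>)) (mult (stab_group \<phi>))"
    and linear_\<sigma>: "s \<in> stabilizer \<phi> \<Longrightarrow> Vector_Spaces.linear pm_scale pm_scale (\<sigma> s)"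
    and \<sigma>_mult: "s \<in> stabilizer \<phi> \<Longrightarrow> t \<in> stabilizer \<phi> \<Longrightarrow> \<sigma> (s * t) u = \<sigma> s (\<sigma> t u)"
    and \<sigma>_carrier: "s \<in> stabilizer \<phi> \<Longrightarrow> \<sigma> s u \<in> carrier U"
    and \<sigma>_eq: "s \<in> stabilizer \<phi> \<Longrightarrow> u \<in> carrier U \<Longrightarrow> \<sigma> s u = basis_act U (stab_class \<phi> s) u"
    and \<tau>: "\<psi> \<in> spectral_orbit \<phi> \<Longrightarrow> \<phi> (star (\<tau> \<psi>) * \<tau> \<psi>)"
      "\<psi> \<in> spectral_orbit \<phi> \<Longrightarrow> spectral_act (\<tau> \<psi>) \<phi> = \<psi>"
    and \<tau>_\<phi>: "\<tau> \<phi> \<in> idems"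
begin

sublocale P: vector_space "pm_scale :: 'k \<Rightarrow> (nat \<Rightarrow>\<^sub>0 'k) \<Rightarrow> _"
  by (rule vector_space_pm_scale)

sublocale U: nd_module pm_scale "carrier (stab_group \<phi>)" "mult (stab_group \<phi>)" U
  by (rule nd_module_fd_simple[OF U])

lemma simple_U: "simple_module pm_scale (carrier (stab_group \<phi>)) (mult (stab_group \<phi>)) U"
  using U by (simp add: fd_simple_modules_def)

lemma orbit_\<phi>: "\<phi> \<in> spectral_orbit \<phi>"
  by (rule spectral_orbit_refl[OF \<phi>(1)])

lemma orbit_characters: "\<psi> \<in> spectral_orbit \<phi> \<Longrightarrow> \<psi> \<in> characters"
  by (rule spectral_orbit_characters[OF \<phi>(1)])

lemma finite_orbit: "finite (spectral_orbit \<phi>)"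
  using \<phi>(2) by (simp add: finite_index_def)

text \<open>Since \<open>e * s\<close> and \<open>s\<close> have the same class,
  \<open>\<sigma> e\<close> fixes every vector in the image of a group element. By nondegeneracy
  these vectors span \<open>U\<close>.\<close>

lemma \<sigma>_idem:
  assumes e: "e \<in> idems" "e \<in> stabilizer \<phi>" and u: "u \<in> carrier U"
  shows "\<sigma> e u = u"
proof -
  have fix_image: "\<sigma> e (basis_act U X v) = basis_act U X v"
    if X: "X \<in> carrier (stab_group \<phi>)" and v: "v \<in> carrier U" for X v
  proof -
    obtain s where s: "s \<in> stabilizer \<phi>" "X = stab_class \<phi> s"
      using X by (auto simp: carrier_stab_group)
    have "stab_class \<phi> (e * s) = stab_class \<phi> s"
      using max_group_rel_idem[OF inverse_subsemigroup_stabilizer[OF \<phi>(1)], of e s] e s(1)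
      by (intro equiv_class_eq[OF equiv_max_group_rel[OF inverse_subsemigroup_stabilizer[OF \<phi>(1)]]]) auto
    then have "\<sigma> (e * s) v = \<sigma> s v"
      using s e v by (simp add: \<sigma>_eq stabilizer_mult[OF \<phi>(1)])
    then show ?thesis using s e v by (simp add: \<sigma>_mult \<sigma>_eq)
  qed
  interpret \<sigma>e: Vector_Spaces.linear pm_scale pm_scale "\<sigma> e" by (rule linear_\<sigma>[OF e(2)])
  have "P.subspace {v. \<sigma> e v = v}"
    by (rule P.subspaceI) (auto simp: \<sigma>e.add \<sigma>e.scale)
  then have "P.span {basis_act U X v | X v. X \<in> carrier (stab_group \<phi>) \<and> v \<in> carrier U} \<subseteq> {v. \<sigma> e v = v}"
    using fix_image by (intro P.span_minimal) auto
  then show ?thesis using u U.span_basis_act by auto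
qed

text \<open>The product describes a loop: from \<open>\<phi>\<close> to \<open>\<psi>\<close> by
  \<open>\<tau> \<psi>\<close>, on by \<open>s\<close>, and back to \<open>\<phi>\<close> by the
  star of the element chosen for the new point. Each step is defined where the previous one
  ends.\<close>

lemma transport_in_stabilizer:
  assumes \<psi>: "\<psi> \<in> spectral_orbit \<phi>" "\<psi> (star s * s)"
  shows "star (\<tau> (spectral_act s \<psi>)) * s * \<tau> \<psi> \<in> stabilizer \<phi>"
proof -
  let ?\<chi> = "spectral_act s \<psi>"
  have \<chi>: "?\<chi> \<in> spectral_orbit \<phi>" by (rule spectral_orbit_closed[OF \<psi>])
  have "spectral_act (star (\<tau> ?\<chi>) * s * \<tau> \<psi>) \<phi> = spectral_act (star (\<tau> ?\<chi>)) ?\<chi>"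
    by (simp add: spectral_act_mult \<tau>(2)[OF \<psi>(1)])
  also have "\<dots> = \<phi>" using spectral_act_star[OF \<phi>(1) \<tau>(1)[OF \<chi>]] \<tau>(2)[OF \<chi>] by simp
  finally have act: "spectral_act (star (\<tau> ?\<chi>) * s * \<tau> \<psi>) \<phi> = \<phi>" .
  have "?\<chi> (\<tau> ?\<chi> * star (\<tau> ?\<chi>))"
    using spectral_act_domain_star[of \<phi> "\<tau> ?\<chi>"] \<tau>[OF \<chi>] by simp
  then have "\<phi> (star (star (\<tau> ?\<chi>) * s * \<tau> \<psi>) * (star (\<tau> ?\<chi>) * s * \<tau> \<psi>))"
    by (simp add: domain_mult \<tau>(2)[OF \<psi>(1)] mult.assoc spectral_act_mult)
  then show ?thesis using act by (simp add: stabilizer_def)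
qed

text \<open>The same loop, now indexed by the point where \<open>s\<close> ends, which is the point
  at which \<open>ind_act\<close> evaluates its result.\<close>

lemma transport_back_in_stabilizer:
  assumes \<psi>: "\<psi> \<in> spectral_orbit \<phi>" "\<psi> (s * star s)"
  shows "star (\<tau> \<psi>) * s * \<tau> (spectral_act (star s) \<psi>) \<in> stabilizer \<phi>"
    "spectral_act (star s) \<psi> \<in> spectral_orbit \<phi>"
proof -
  show orb: "spectral_act (star s) \<psi> \<in> spectral_orbit \<phi>"
    using spectral_orbit_closed[OF \<psi>(1), of "star s"] \<psi>(2) by simp
  have "spectral_act (star s) \<psi> (star s * s)"
    using spectral_act_domain_star[of \<psi> "star s"] \<psi>(2) by simp
  moreover have "spectral_act s (spectral_act (star s) \<psi>) = \<psi>"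
    using spectral_act_star[OF orbit_characters[OF \<psi>(1)], of "star s"] \<psi>(2) by simp
  ultimately show "star (\<tau> \<psi>) * s * \<tau> (spectral_act (star s) \<psi>) \<in> stabilizer \<phi>"
    using transport_in_stabilizer[OF orb, of s] by simp
qed

text \<open>The element \<open>\<tau> \<psi>\<close> moves \<open>\<phi>\<close> to \<open>\<psi>\<close> and identifies \<open>U\<close> with the fibre over \<open>\<psi>\<close>; in these
  coordinates \<open>s\<close>, as a map from the fibre over \<open>s\<^sup>*\<psi>\<close> to the one over \<open>\<psi>\<close>, is an element of the
  stabilizer of \<open>\<phi>\<close>.\<close>

definition ind_act :: "'s \<Rightarrow> (('s \<Rightarrow> bool) \<Rightarrow> (nat \<Rightarrow>\<^sub>0 'k)) \<Rightarrow> ('s \<Rightarrow> bool) \<Rightarrow> (nat \<Rightarrow>\<^sub>0 'k)" where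
  "ind_act s f = (\<lambda>\<psi>. if \<psi> \<in> spectral_orbit \<phi> \<and> \<psi> (s * star s)
     then \<sigma> (star (\<tau> \<psi>) * s * \<tau> (spectral_act (star s) \<psi>)) (f (spectral_act (star s) \<psi>)) else 0)"

text \<open>The direct sum of copies of \<open>U\<close> over the orbit. Values off the orbit are
  fixed to be 0 because the functions are defined on all predicates.\<close>

definition ind_carrier :: "(('s \<Rightarrow> bool) \<Rightarrow> (nat \<Rightarrow>\<^sub>0 'k)) set" where
  "ind_carrier = {f. (\<forall>\<psi>\<in>spectral_orbit \<phi>. f \<psi> \<in> carrier U) \<and> (\<forall>\<psi>. \<psi> \<notin> spectral_orbit \<phi> \<longrightarrow> f \<psi> = 0)}"

abbreviation ind_scale :: "'k \<Rightarrow> (('s \<Rightarrow> bool) \<Rightarrow> (nat \<Rightarrow>\<^sub>0 'k)) \<Rightarrow> ('s \<Rightarrow> bool) \<Rightarrow> (nat \<Rightarrow>\<^sub>0 'k)" where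
  "ind_scale \<equiv> fun_scale pm_scale"

definition ind_module :: "('s \<Rightarrow>\<^sub>0 'k, ('s \<Rightarrow> bool) \<Rightarrow> (nat \<Rightarrow>\<^sub>0 'k)) alg_module" where
  "ind_module = linearized ind_scale ind_carrier ind_act"

sublocale X: vector_space ind_scale
  by (rule vector_space_fun_scale[OF vector_space_pm_scale])

lemma carrier_ind_module [simp]: "carrier ind_module = ind_carrier"
  by (simp add: ind_module_def)

lemma basis_act_ind_module [simp]: "basis_act ind_module s f = ind_act s f"
  by (simp add: ind_module_def)

text \<open>Composing two loops leaves the idempotent \<open>e\<close> formed from
  \<open>\<tau>\<close> and its star at the intermediate point, where a group would have an
  identity. Moved to the left past \<open>x\<close> by \<open>mult_idem_swap\<close>, it becomes an
  idempotent of the stabilizer and acts trivially on \<open>U\<close>.\<close>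

lemma ind_act_mult: "ind_act (s * t) f = ind_act s (ind_act t f)"
proof
  fix \<psi>
  let ?s\<psi> = "spectral_act (star s) \<psi>"
  let ?ts\<psi> = "spectral_act (star t) ?s\<psi>"
  have act: "spectral_act (star (s * t)) \<psi> = ?ts\<psi>" by (simp add: star_mult spectral_act_mult)
  have dom: "\<psi> ((s * t) * star (s * t)) \<longleftrightarrow> ?s\<psi> (t * star t)"
    using domain_mult[of \<psi> "star t" "star s"] by (simp add: star_mult)
  show "ind_act (s * t) f \<psi> = ind_act s (ind_act t f) \<psi>"
  proof (cases "\<psi> \<in> spectral_orbit \<phi> \<and> ?s\<psi> (t * star t)")
    \<comment> \<open>Either both sides take the default 0 directly, or on the right a linear
      \<open>\<sigma>\<close> is applied to the default 0 of the inner action.\<close>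
    case False
    then show ?thesis
      using transport_back_in_stabilizer(1)[of \<psi> s] linear_\<sigma>[THEN Vector_Spaces.linear.axioms(3), THEN module_hom.zero]
      by (auto simp: ind_act_def dom)
  next
    case True
    then have \<psi>: "\<psi> \<in> spectral_orbit \<phi>" and t: "?s\<psi> (t * star t)" by auto
    \<comment> \<open>Where \<open>s * t\<close> can be undone, so can \<open>s\<close>: this is
      monotonicity of the character, in the form of \<open>characters_dom\<close>.\<close>
    have s: "\<psi> (s * star s)"
      using characters_dom[OF orbit_characters[OF \<psi>], of "t * star t" "star s"] t
      by (simp add: spectral_act_apply star_mult_idem)
    note s\<psi> = transport_back_in_stabilizer[OF \<psi> s]
    note ts\<psi> = transport_back_in_stabilizer[OF s\<psi>(2) t]
    have st: "star (\<tau> \<psi>) * (s * t) * \<tau> ?ts\<psi> \<in> stabilizer \<phi>"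
      using transport_back_in_stabilizer(1)[OF \<psi>, of "s * t"] True unfolding dom act by simp
    define x where "x = star (\<tau> \<psi>) * s"
    define e where "e = \<tau> ?s\<psi> * star (\<tau> ?s\<psi>)"
    have e: "e \<in> idems" by (simp add: e_def star_mult_idem)
    have "spectral_act (star x) \<phi> = ?s\<psi>"
      using \<tau>(2)[OF \<psi>] by (simp add: x_def star_mult spectral_act_mult)
    moreover have "?s\<psi> e"
      using spectral_act_domain_star[of \<phi> "\<tau> ?s\<psi>"] \<tau>[OF s\<psi>(2)] by (simp add: e_def)
    ultimately have "\<phi> (x * e * star x)"
      using spectral_act_apply[OF e, of "star x" \<phi>] by simp
    moreover have xex: "x * e * star x \<in> idems" using star_conj_idem[OF e, of "star x"] by simp
    ultimately have xexT: "x * e * star x \<in> stabilizer \<phi>"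
      using idem_in_stabilizer_iff[OF \<phi>(1)] by simp
    have "(star (\<tau> \<psi>) * s * \<tau> ?s\<psi>) * (star (\<tau> ?s\<psi>) * t * \<tau> ?ts\<psi>) = (x * e) * (t * \<tau> ?ts\<psi>)"
      by (simp add: x_def e_def mult.assoc)
    also have "\<dots> = (x * e * star x) * (x * (t * \<tau> ?ts\<psi>))"
      by (subst mult_idem_swap[OF e]) (simp only: mult.assoc)
    also have "x * (t * \<tau> ?ts\<psi>) = star (\<tau> \<psi>) * (s * t) * \<tau> ?ts\<psi>" by (simp add: x_def mult.assoc)
    \<comment> \<open>The rule \<open>\<sigma>_idem\<close> needs a vector of
      \<open>carrier U\<close>; the operator applied before the idempotent provides one for every
      \<open>u\<close>.\<close>
    finally have "\<sigma> (star (\<tau> \<psi>) * s * \<tau> ?s\<psi>) (\<sigma> (star (\<tau> ?s\<psi>) * t * \<tau> ?ts\<psi>) u) =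
        \<sigma> (star (\<tau> \<psi>) * (s * t) * \<tau> ?ts\<psi>) u" for u
      using \<sigma>_idem[OF xex xexT \<sigma>_carrier[OF st]] \<sigma>_mult[OF xexT st] \<sigma>_mult[OF s\<psi>(1) ts\<psi>(1)] by simp
    then show ?thesis
      using \<psi> s t s\<psi>(2) True by (simp add: ind_act_def dom act)
  qed
qed

lemma linear_ind_act: "Vector_Spaces.linear ind_scale ind_scale (ind_act s)"
proof -
  note add = linear_\<sigma>[THEN Vector_Spaces.linear.axioms(3), THEN module_hom.add]
  note scale = linear_\<sigma>[THEN Vector_Spaces.linear.axioms(3), THEN module_hom.scale]
  show ?thesis
    unfolding Vector_Spaces.linear_iff
    using transport_back_in_stabilizer(1) X.vector_space_axioms
    by (auto simp: ind_act_def fun_eq_iff add scale)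
qed

lemma ind_act_carrier: "ind_act s f \<in> ind_carrier"
  using transport_back_in_stabilizer(1) \<sigma>_carrier P.subspace_0[OF U.subspace_carrier]
  by (auto simp: ind_carrier_def ind_act_def)

lemma subspace_ind_carrier: "X.subspace ind_carrier"
  using U.subspace_carrier by (intro X.subspaceI) (auto simp: ind_carrier_def P.subspace_def)

section \<open>Vectors concentrated at one orbit point\<close>

lemma ind_act_delta:
  assumes \<psi>: "\<psi> \<in> spectral_orbit \<phi>" "\<psi> (star s * s)"
  shows "ind_act s (delta \<psi> u) =
    delta (spectral_act s \<psi>) (\<sigma> (star (\<tau> (spectral_act s \<psi>)) * s * \<tau> \<psi>) u)"
proof
  fix \<chi>
  have inv: "spectral_act (star s) (spectral_act s \<psi>) = \<psi>"
    by (rule spectral_act_star[OF orbit_characters[OF \<psi>(1)] \<psi>(2)])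
  \<comment> \<open>The partial action of \<open>s\<close> is injective, so no point other than the
    image of \<open>\<psi>\<close> is led back to \<open>\<psi>\<close>.\<close>
  have iff: "\<chi> = spectral_act s \<psi>" if "\<chi> \<in> spectral_orbit \<phi>" "\<chi> (s * star s)" "spectral_act (star s) \<chi> = \<psi>"
    using spectral_act_star[OF orbit_characters[OF that(1)], of "star s"] that by simp
  show "ind_act s (delta \<psi> u) \<chi> =
      delta (spectral_act s \<psi>) (\<sigma> (star (\<tau> (spectral_act s \<psi>)) * s * \<tau> \<psi>) u) \<chi>"
  proof (cases "\<chi> = spectral_act s \<psi>")
    case True
    then show ?thesis
      using spectral_orbit_closed[OF \<psi>] spectral_act_domain_star[of \<psi> s] \<psi>(2) inv
      by (simp add: ind_act_def delta_def)
  next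
    case False
    then have "spectral_act (star s) \<chi> \<noteq> \<psi>" if "\<chi> \<in> spectral_orbit \<phi>" "\<chi> (s * star s)"
      using iff that by blast
    then show ?thesis
      using False transport_back_in_stabilizer(1)[of \<chi> s] linear_\<sigma>[THEN Vector_Spaces.linear.axioms(3), THEN module_hom.zero]
      by (auto simp: ind_act_def delta_def)
  qed
qed

text \<open>Where \<open>\<psi>\<close> is true at \<open>e\<close>, the point is fixed and the loop
  at \<open>\<psi>\<close> is an idempotent of the stabilizer, which acts as the identity on
  \<open>U\<close>.\<close>

lemma ind_act_idem:
  assumes e: "e \<in> idems" and f: "f \<in> ind_carrier"
  shows "ind_act e f = (\<lambda>\<psi>. if \<psi> e then f \<psi> else 0)"
proof
  fix \<psi>
  have ee: "e * e = e" "star e = e" using e by (auto simp: idems_star) (simp add: idems_def)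
  show "ind_act e f \<psi> = (if \<psi> e then f \<psi> else 0)"
  proof (cases "\<psi> \<in> spectral_orbit \<phi> \<and> \<psi> e")
    case True
    then have \<psi>: "\<psi> \<in> spectral_orbit \<phi>" "\<psi> e" by auto
    have fixed: "spectral_act e \<psi> = \<psi>" by (rule spectral_act_idem[OF orbit_characters[OF \<psi>(1)] e \<psi>(2)])
    have "star (\<tau> \<psi>) * e * \<tau> \<psi> \<in> stabilizer \<phi>"
      using transport_back_in_stabilizer(1)[OF \<psi>(1), of e] \<psi>(2) by (simp add: ee fixed)
    moreover have "f \<psi> \<in> carrier U" using f \<psi> by (simp add: ind_carrier_def)
    ultimately show ?thesis
      using \<psi> \<sigma>_idem[OF star_conj_idem[OF e]] by (simp add: ind_act_def ee fixed)
  next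
    case False
    then show ?thesis using f by (auto simp: ind_act_def ee ind_carrier_def)
  qed
qed

lemma delta_carrier: "\<psi> \<in> spectral_orbit \<phi> \<Longrightarrow> u \<in> carrier U \<Longrightarrow> delta \<psi> u \<in> ind_carrier"
  using P.subspace_0[OF U.subspace_carrier] by (auto simp: ind_carrier_def delta_def)

lemma ind_act_delta_stabilizer:
  assumes s: "s \<in> stabilizer \<phi>" and u: "u \<in> carrier U"
  shows "ind_act s (delta \<phi> u) = delta \<phi> (\<sigma> s u)"
proof -
  have sd: "\<phi> (star s * s)" "spectral_act s \<phi> = \<phi>" using s by (auto simp: stabilizer_def)
  have e: "\<tau> \<phi> \<in> stabilizer \<phi>"
    using \<tau>[OF orbit_\<phi>] by (simp add: stabilizer_def)
  have "\<sigma> (star (\<tau> \<phi>) * s * \<tau> \<phi>) u = \<sigma> (\<tau> \<phi>) (\<sigma> s (\<sigma> (\<tau> \<phi>) u))"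
    using e s by (simp add: idems_star[OF \<tau>_\<phi>] \<sigma>_mult stabilizer_mult[OF \<phi>(1)])
  also have "\<dots> = \<sigma> s u" using \<sigma>_idem[OF \<tau>_\<phi> e] \<sigma>_carrier[OF s] u by simp
  finally show ?thesis using ind_act_delta[OF orbit_\<phi> sd(1), of u] sd(2) by simp
qed

text \<open>Every fibre is reached from the one over \<open>\<phi>\<close> by a single semigroup
  element. Nondegeneracy and simplicity of the induced module both rest on this.\<close>

lemma delta_eq_ind_act_\<tau>:
  assumes \<psi>: "\<psi> \<in> spectral_orbit \<phi>" and u: "u \<in> carrier U"
  shows "ind_act (\<tau> \<psi>) (delta \<phi> u) = delta \<psi> u"
proof -
  have e: "\<tau> \<phi> \<in> stabilizer \<phi>" using \<tau>[OF orbit_\<phi>] by (simp add: stabilizer_def)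
  have f: "star (\<tau> \<psi>) * \<tau> \<psi> \<in> idems" by (rule star_mult_idem)
  then have f': "star (\<tau> \<psi>) * \<tau> \<psi> \<in> stabilizer \<phi>"
    using \<tau>(1)[OF \<psi>] idem_in_stabilizer_iff[OF \<phi>(1)] by simp
  have "\<sigma> (star (\<tau> \<psi>) * \<tau> \<psi> * \<tau> \<phi>) u = u"
    using \<sigma>_idem[OF f f' u] \<sigma>_idem[OF \<tau>_\<phi> e u] \<sigma>_mult[OF f' e] by simp
  then show ?thesis
    using ind_act_delta[OF orbit_\<phi> \<tau>(1)[OF \<psi>], of u] \<tau>(2)[OF \<psi>] by simp
qed

lemma ind_carrier_expansion:
  "f \<in> ind_carrier \<Longrightarrow> f = (\<Sum>\<psi>\<in>spectral_orbit \<phi>. delta \<psi> (f \<psi>))"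
  using eq_sum_delta[OF finite_orbit, of f] by (simp add: ind_carrier_def)

lemma nd_ind_module: "nd_module ind_scale UNIV (*) ind_module"
  unfolding ind_module_def
proof (rule X.nd_module_linearized[OF subspace_ind_carrier])
  show "ind_carrier \<subseteq> X.span {ind_act s v | s v. s \<in> UNIV \<and> v \<in> ind_carrier}"
  proof
    fix f assume f: "f \<in> ind_carrier"
    have "delta \<psi> (f \<psi>) \<in> X.span {ind_act s v | s v. s \<in> UNIV \<and> v \<in> ind_carrier}"
      if \<psi>: "\<psi> \<in> spectral_orbit \<phi>" for \<psi>
    proof -
      have "f \<psi> \<in> carrier U" using f \<psi> by (simp add: ind_carrier_def)
      then show ?thesis
        using delta_eq_ind_act_\<tau>[OF \<psi>, symmetric] delta_carrier[OF orbit_\<phi>]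
        by (intro X.span_base) auto
    qed
    then show "f \<in> X.span {ind_act s v | s v. s \<in> UNIV \<and> v \<in> ind_carrier}"
      by (subst ind_carrier_expansion[OF f]) (rule X.span_sum)
  qed
qed (simp_all add: ind_act_carrier ind_act_mult linear_ind_act[unfolded Vector_Spaces.linear_iff])

sublocale I: inv_module ind_scale ind_act ind_module
proof -
  interpret nd_module ind_scale UNIV "(*)" ind_module by (rule nd_ind_module)
  show "inv_module ind_scale ind_act ind_module"
    by unfold_locales
      (simp_all add: ind_act_carrier ind_act_mult linear_ind_act linear_ind_act[unfolded Vector_Spaces.linear_iff])
qed

lemma delta_weight: "\<psi> \<in> spectral_orbit \<phi> \<Longrightarrow> u \<in> carrier U \<Longrightarrow> delta \<psi> u \<in> I.weight \<psi>"
  unfolding I.weight_def using ind_act_idem[OF _ delta_carrier] by (auto simp: delta_def fun_eq_iff)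

text \<open>At an orbit point \<open>\<psi>\<close> other than \<open>\<phi>\<close>, choose an
  idempotent on which the two characters differ. It acts on the value there by
  \<open>\<psi> e\<close>, whereas weight \<open>\<phi>\<close> requires \<open>\<phi> e\<close>, so
  the value is 0.\<close>

lemma ind_weight_space: "weight_space ind_module \<phi> = delta \<phi> ` carrier U"
proof (intro equalityI subsetI)
  fix f assume "f \<in> delta \<phi> ` carrier U"
  then show "f \<in> weight_space ind_module \<phi>"
    using delta_weight[OF orbit_\<phi>] I.weight_eq_weight_space[OF \<phi>(1)] by auto
next
  fix f assume "f \<in> weight_space ind_module \<phi>"
  then have f: "f \<in> ind_carrier" "f \<in> I.weight \<phi>"
    using I.weight_eq_weight_space[OF \<phi>(1)] by (auto simp: weight_space_def)
  have "f \<psi> = 0" if ne: "\<psi> \<noteq> \<phi>" for \<psi>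
  proof (cases "\<psi> \<in> spectral_orbit \<phi>")
    case True
    then have "\<psi> \<in> extensional idems" using orbit_characters characters_extensional by blast
    then obtain e where e: "e \<in> idems" "\<psi> e \<noteq> \<phi> e"
      using ne extensionalityI[of \<psi> idems \<phi>] characters_extensional[OF \<phi>(1)] by metis
    have "(\<lambda>\<psi>. if \<psi> e then f \<psi> else 0) = (if \<phi> e then f else 0)"
      using I.weightD[OF f(2) e(1)] unfolding ind_act_idem[OF e(1) f(1)] .
    from fun_cong[OF this, of \<psi>] show ?thesis using e(2) by (cases "\<phi> e") simp_all
  next
    case False
    then show ?thesis using f(1) by (simp add: ind_carrier_def)
  qed
  then have "f = delta \<phi> (f \<phi>)" by (auto simp: delta_def)
  then show "f \<in> delta \<phi> ` carrier U" using f(1) orbit_\<phi> by (auto simp: ind_carrier_def)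
qed

lemma linked_ind_module: "linked ind_scale ind_module \<phi> U"
  unfolding linked_def
proof (intro exI[of _ "delta \<phi>"] conjI ballI allI)
  show "bij_betw (delta \<phi>) (carrier U) (weight_space ind_module \<phi>)"
    unfolding ind_weight_space
    by (rule inj_on_imp_bij_betw) (auto simp: inj_on_def delta_def fun_eq_iff split: if_splits)
  fix s u assume "s \<in> stabilizer \<phi>" "u \<in> carrier U"
  then show "delta \<phi> (basis_act U (stab_class \<phi> s) u) = basis_act ind_module s (delta \<phi> u)"
    by (simp add: ind_act_delta_stabilizer \<sigma>_eq)
qed (auto simp: delta_def)

text \<open>A nonzero invariant subspace contains a nonzero vector concentrated at one orbit point.
  Moved to \<open>\<phi>\<close>, it generates the whole fibre there because \<open>U\<close> is
  simple, and \<open>\<tau>\<close> spreads this fibre over the orbit.\<close>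

lemma simple_ind_module: "simple_module ind_scale UNIV (*) ind_module"
proof (rule I.simple_moduleI)
  obtain u where u: "u \<in> carrier U" "u \<noteq> 0"
    using simple_U P.subspace_0[OF U.subspace_carrier] by (auto simp: simple_module_def)
  then have "delta \<phi> u \<in> ind_carrier" "delta \<phi> u \<noteq> 0"
    using delta_carrier[OF orbit_\<phi>] by (auto simp: delta_def fun_eq_iff)
  then show "carrier ind_module \<noteq> {0}" by auto
next
  fix W assume W: "W \<subseteq> carrier ind_module" "X.subspace W" "W \<noteq> {0}"
    and inv': "\<And>s w. s \<in> UNIV \<Longrightarrow> w \<in> W \<Longrightarrow> basis_act ind_module s w \<in> W"
  have inv: "ind_act s w \<in> W" if "w \<in> W" for s w using inv'[OF _ that] by simp
  obtain f where f: "f \<in> W" "f \<noteq> 0" using W(3) X.subspace_0[OF W(2)] by blast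
  have fI: "f \<in> ind_carrier" using f(1) W(1) by auto
  obtain \<psi> where \<psi>: "f \<psi> \<noteq> 0" using f(2) by (auto simp: fun_eq_iff)
  then have \<psi>O: "\<psi> \<in> spectral_orbit \<phi>" using fI by (auto simp: ind_carrier_def)
  have fU: "f \<chi> \<in> carrier U" if "\<chi> \<in> spectral_orbit \<phi>" for \<chi>
    using that fI by (simp add: ind_carrier_def)
  have ext: "spectral_orbit \<phi> \<subseteq> extensional idems"
    using orbit_characters characters_extensional by blast
  \<comment> \<open>The operator cuts \<open>f\<close> down to its value at \<open>\<psi>\<close>
    without leaving \<open>W\<close>.\<close>
  have "\<exists>P. I.separates P \<psi> (spectral_orbit \<phi> - {\<psi>})"
    using finite_orbit ext \<psi>O by (intro I.separating_operator) auto
  then obtain P where "I.separates P \<psi> (spectral_orbit \<phi> - {\<psi>})" ..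
  note P = I.separatesD[OF this]
  interpret P': Vector_Spaces.linear ind_scale ind_scale P by (rule P(1))
  have "P f = (\<Sum>\<chi>\<in>spectral_orbit \<phi>. P (delta \<chi> (f \<chi>)))"
    by (subst ind_carrier_expansion[OF fI]) (rule P'.sum)
  also have "\<dots> = (\<Sum>\<chi>\<in>spectral_orbit \<phi>. if \<chi> = \<psi> then delta \<psi> (f \<psi>) else 0)"
    using P(2,3) delta_weight fU by (intro sum.cong refl) auto
  also have "\<dots> = delta \<psi> (f \<psi>)" using finite_orbit \<psi>O by simp
  finally have "delta \<psi> (f \<psi>) \<in> W" using P(4)[OF W(2) inv f(1)] by simp
  then have "ind_act (star (\<tau> \<psi>)) (ind_act (\<tau> \<psi>) (delta \<phi> (f \<psi>))) \<in> W"
    using inv delta_eq_ind_act_\<tau>[OF \<psi>O fU[OF \<psi>O]] by simp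
  then have start: "delta \<phi> (f \<psi>) \<in> W"
    using I.\<rho>_star[OF delta_weight[OF orbit_\<phi> fU[OF \<psi>O]] \<tau>(1)[OF \<psi>O]] by simp
  \<comment> \<open>The part of the fibre over \<open>\<phi>\<close> lying in \<open>W\<close>,
    regarded as a submodule of \<open>U\<close>.\<close>
  define Y where "Y = {u \<in> carrier U. delta \<phi> u \<in> W}"
  have "Y = {0} \<or> Y = carrier U"
  proof (rule P.simple_module_dichotomy[OF simple_U])
    have add: "delta \<phi> (u + v) = delta \<phi> u + delta \<phi> v" for u v :: "nat \<Rightarrow>\<^sub>0 'k"
      by (auto simp: delta_def)
    have scale: "delta \<phi> (pm_scale c u) = ind_scale c (delta \<phi> u)" for c and u :: "nat \<Rightarrow>\<^sub>0 'k"
      by (auto simp: delta_def)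
    have zero: "delta \<phi> (0 :: nat \<Rightarrow>\<^sub>0 'k) = 0" by (auto simp: delta_def)
    show "P.subspace Y"
      using U.subspace_carrier W(2)
      by (intro P.subspaceI) (auto simp: Y_def add scale zero P.subspace_def X.subspace_def)
    fix s u assume "s \<in> carrier (stab_group \<phi>)" "u \<in> Y"
    then obtain t where t: "t \<in> stabilizer \<phi>" "s = stab_class \<phi> t" and u: "u \<in> carrier U" "delta \<phi> u \<in> W"
      by (auto simp: carrier_stab_group Y_def)
    have "delta \<phi> (\<sigma> t u) \<in> W" using inv[OF u(2), of t] ind_act_delta_stabilizer[OF t(1) u(1)] by simp
    then show "basis_act U s u \<in> Y" using \<sigma>_eq[OF t(1) u(1)] \<sigma>_carrier[OF t(1), of u] t(2) by (simp add: Y_def)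
  qed (auto simp: Y_def)
  moreover have "f \<psi> \<in> Y" using start fU[OF \<psi>O] by (simp add: Y_def)
  ultimately have Y: "Y = carrier U" using \<psi> by auto
  show "carrier ind_module \<subseteq> W"
  proof
    fix g assume "g \<in> carrier ind_module"
    then have g: "g \<in> ind_carrier" by simp
    have "delta \<chi> (g \<chi>) \<in> W" if \<chi>: "\<chi> \<in> spectral_orbit \<phi>" for \<chi>
    proof -
      have gU: "g \<chi> \<in> carrier U" using g \<chi> by (simp add: ind_carrier_def)
      then have "delta \<phi> (g \<chi>) \<in> W" using Y by (auto simp: Y_def)
      then show ?thesis using inv delta_eq_ind_act_\<tau>[OF \<chi> gU] by metis
    qed
    then show "g \<in> W" by (subst ind_carrier_expansion[OF g]) (rule X.subspace_sum[OF W(2)])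
  qed
qed

text \<open>Copies of a finite spanning set of \<open>U\<close> at each of the finitely many orbit
  points span the module; finite index is used here.\<close>

lemma finite_dim_ind_module: "finite_dim_module ind_scale ind_module"
proof -
  obtain B where B: "finite B" "carrier U = P.span B"
    using U by (auto simp: fd_simple_modules_def finite_dim_module_def)
  let ?F = "\<Union>\<psi>\<in>spectral_orbit \<phi>. delta \<psi> ` B"
  have lin: "Vector_Spaces.linear pm_scale ind_scale (delta \<psi>)" for \<psi> :: "'s \<Rightarrow> bool"
    unfolding Vector_Spaces.linear_iff using P.vector_space_axioms X.vector_space_axioms
    by (auto simp: delta_def fun_eq_iff)
  have "f \<in> X.span ?F" if f: "f \<in> ind_carrier" for f
  proof -
    have "delta \<psi> (f \<psi>) \<in> X.span ?F" if \<psi>: "\<psi> \<in> spectral_orbit \<phi>" for \<psi>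
    proof -
      interpret d: Vector_Spaces.linear pm_scale ind_scale "delta \<psi>" by (rule lin)
      have "delta \<psi> (f \<psi>) \<in> X.span (delta \<psi> ` B)"
        using f \<psi> B(2) by (simp add: d.span_image ind_carrier_def)
      then show ?thesis using X.span_mono[of "delta \<psi> ` B" ?F] \<psi> by blast
    qed
    then show ?thesis by (subst ind_carrier_expansion[OF f]) (rule X.span_sum)
  qed
  then have "\<exists>B'. finite B' \<and> ind_carrier = X.span B'"
    using B(1) finite_orbit by (intro X.finite_spanning_subset[OF _ subspace_ind_carrier, of ?F]) auto
  then show ?thesis by (simp add: finite_dim_module_def)
qed

end

section \<open>Comparison of a simple module with an induced one\<close>

lemma extend_linear_on:
  fixes h :: "'v::ab_group_add \<Rightarrow> 'w::ab_group_add"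
  assumes "vector_space scale1" "vector_space scale2" and C: "module.subspace scale1 C"
    and h: "\<And>v w. v \<in> C \<Longrightarrow> w \<in> C \<Longrightarrow> h (v + w) = h v + h w"
      "\<And>c v. v \<in> C \<Longrightarrow> h (scale1 c v) = scale2 c (h v)"
  shows "\<exists>g. Vector_Spaces.linear scale1 scale2 g \<and> (\<forall>v\<in>C. g v = h v)"
proof -
  interpret A: vector_space scale1 by fact
  interpret B: vector_space scale2 by fact
  interpret vector_space_pair scale1 scale2 ..
  obtain B where B: "B \<subseteq> C" "A.independent B" "C \<subseteq> A.span B"
    by (rule A.maximal_independent_subset)
  obtain g where g: "Vector_Spaces.linear scale1 scale2 g" "\<forall>b\<in>B. g b = h b"
    using linear_independent_extend[OF B(2), of h] by blast
  interpret g: Vector_Spaces.linear scale1 scale2 g by (rule g(1))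
  have h0: "h 0 = 0" using h(2)[of 0 0] A.subspace_0[OF C] by simp
  \<comment> \<open>Membership in \<open>C\<close> is carried through the induction because
    \<open>h\<close> is additive and homogeneous only there.\<close>
  have "v \<in> C \<and> g v = h v" if "v \<in> A.span B" for v
    using that
  proof (induction rule: A.span_induct_alt)
    case base
    show ?case using h0 A.subspace_0[OF C] by simp
  next
    case (step c x y)
    then show ?case
      using g(2) B(1) C by (auto simp: g.add g.scale h A.subspace_add A.subspace_scale)
  qed
  then show ?thesis using g(1) B(3) by blast
qed

text \<open>A concrete form of Frobenius reciprocity: the identification of \<open>U\<close> with
  the weight space extends along \<open>\<tau>\<close> to a homomorphism \<open>\<theta>\<close>.
  Its kernel and image are invariant and it is nonzero on the fibre over \<open>\<phi>\<close>, so
  simplicity of both modules makes it bijective.\<close>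

lemma (in induced) ind_module_iso:
  fixes scale :: "'k \<Rightarrow> 'v::ab_group_add \<Rightarrow> 'v"
  assumes vs: "vector_space scale" and simple: "simple_module scale UNIV (*) V"
    and linked: "linked scale V \<phi> U"
  shows "module_iso ind_scale scale UNIV ind_module V"
proof -
  have V: "nd_module scale UNIV (*) V"
    using vs simple by (simp add: nd_module_def nd_module_axioms_def simple_module_def)
  from inv_module_exists[OF V] obtain \<rho> where "inv_module scale \<rho> V" ..
  then interpret V: inv_module scale \<rho> V .
  obtain h0 where h0: "bij_betw h0 (carrier U) (V.weight \<phi>)"
    "\<And>u u'. u \<in> carrier U \<Longrightarrow> u' \<in> carrier U \<Longrightarrow> h0 (u + u') = h0 u + h0 u'"
    "\<And>c u. u \<in> carrier U \<Longrightarrow> h0 (pm_scale c u) = scale c (h0 u)"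
    "\<And>s u. s \<in> stabilizer \<phi> \<Longrightarrow> u \<in> carrier U \<Longrightarrow> h0 (basis_act U (stab_class \<phi> s) u) = basis_act V s (h0 u)"
    using linked unfolding linked_def V.weight_eq_weight_space[OF \<phi>(1)] by blast
  have "\<exists>h. Vector_Spaces.linear pm_scale scale h \<and> (\<forall>u\<in>carrier U. h u = h0 u)"
    by (rule extend_linear_on[OF P.vector_space_axioms vs U.subspace_carrier]) (fact h0)+
  then obtain h where h: "Vector_Spaces.linear pm_scale scale h" and hh0: "\<forall>u\<in>carrier U. h u = h0 u"
    by blast
  interpret h: Vector_Spaces.linear pm_scale scale h by (rule h)
  have hw: "h u \<in> V.weight \<phi>" if "u \<in> carrier U" for u
    using that h0(1) hh0 by (auto simp: bij_betw_def)
  have hV: "h u \<in> carrier V" if "u \<in> carrier U" for u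
    using hw[OF that] V.weight_subset_carrier[OF \<phi>(1)] by blast
  have h_act: "h (\<sigma> s u) = \<rho> s (h u)" if s: "s \<in> stabilizer \<phi>" and u: "u \<in> carrier U" for s u
  proof -
    have "basis_act U (stab_class \<phi> s) u \<in> carrier U"
      using \<sigma>_carrier[OF s, of u] \<sigma>_eq[OF s u] by simp
    then have "h (\<sigma> s u) = basis_act V s (h u)"
      using h0(4)[OF s u] hh0 u \<sigma>_eq[OF s u] by simp
    then show ?thesis using V.\<rho>_eq_basis_act[OF hV[OF u]] by simp
  qed
  \<comment> \<open>The value at \<open>\<psi>\<close> is read in \<open>V\<close> at
    \<open>\<phi>\<close> through \<open>h\<close> and then moved by \<open>\<tau> \<psi>\<close>
    into the weight space of \<open>\<psi>\<close>. Compatibility with \<open>S\<close> leaves no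
    other choice.\<close>
  define \<theta> where "\<theta> f = (\<Sum>\<psi>\<in>spectral_orbit \<phi>. \<rho> (\<tau> \<psi>) (h (f \<psi>)))" for f
  have lin: "Vector_Spaces.linear ind_scale scale \<theta>"
    unfolding Vector_Spaces.linear_iff using X.vector_space_axioms vs
    by (simp add: \<theta>_def h.add h.scale V.\<rho>.add V.\<rho>.scale sum.distrib V.scale_sum_right)
  interpret \<theta>: Vector_Spaces.linear ind_scale scale \<theta> by (rule lin)
  have \<theta>_delta: "\<theta> (delta \<psi> u) = \<rho> (\<tau> \<psi>) (h u)" if \<psi>: "\<psi> \<in> spectral_orbit \<phi>" for \<psi> u
  proof -
    have "\<theta> (delta \<psi> u) = (\<Sum>\<chi>\<in>spectral_orbit \<phi>. if \<chi> = \<psi> then \<rho> (\<tau> \<psi>) (h u) else 0)"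
      unfolding \<theta>_def by (intro sum.cong refl) (simp add: delta_def)
    then show ?thesis using finite_orbit \<psi> by simp
  qed
  have \<theta>_act_delta: "\<theta> (ind_act s (delta \<psi> u)) = \<rho> s (\<theta> (delta \<psi> u))"
    if \<psi>: "\<psi> \<in> spectral_orbit \<phi>" and u: "u \<in> carrier U" for s \<psi> u
  proof -
    have w\<psi>: "\<rho> (\<tau> \<psi>) (h u) \<in> V.weight \<psi>"
      using V.weight_act[OF hw[OF u], of "\<tau> \<psi>"] \<tau>(2)[OF \<psi>] by simp
    show ?thesis
    proof (cases "\<psi> (star s * s)")
      case False
      then show ?thesis
        using V.\<rho>_eq_0[OF w\<psi>] I.\<rho>_eq_0[OF delta_weight[OF \<psi> u]] \<theta>_delta[OF \<psi>] \<theta>.zero by simp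
    next
      case True
      let ?\<chi> = "spectral_act s \<psi>"
      have \<chi>: "?\<chi> \<in> spectral_orbit \<phi>" by (rule spectral_orbit_closed[OF \<psi> True])
      have dom: "?\<chi> (\<tau> ?\<chi> * star (\<tau> ?\<chi>))"
        using spectral_act_domain_star[of \<phi> "\<tau> ?\<chi>"] \<tau>[OF \<chi>] by simp
      have "\<theta> (ind_act s (delta \<psi> u)) = \<rho> (\<tau> ?\<chi>) (\<rho> (star (\<tau> ?\<chi>) * s * \<tau> \<psi>) (h u))"
        using ind_act_delta[OF \<psi> True, of u] \<theta>_delta[OF \<chi>]
          h_act[OF transport_in_stabilizer[OF \<psi> True] u] by simp
      also have "\<dots> = \<rho> (\<tau> ?\<chi> * star (\<tau> ?\<chi>)) (\<rho> s (\<rho> (\<tau> \<psi>) (h u)))"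
        by (simp add: V.\<rho>_mult)
      \<comment> \<open>The leftover idempotent fixes vectors whose weight is the image of
        \<open>\<psi>\<close> under \<open>s\<close>, since that character is true on it.\<close>
      also have "\<dots> = \<rho> s (\<rho> (\<tau> \<psi>) (h u))"
        using V.weightD[OF V.weight_act[OF w\<psi>, of s] star_mult_idem(2)] dom by simp
      finally show ?thesis using \<theta>_delta[OF \<psi>] by simp
    qed
  qed
  have \<theta>_act: "\<theta> (ind_act s f) = \<rho> s (\<theta> f)" if f: "f \<in> ind_carrier" for s f
  proof -
    have "\<theta> (ind_act s f) = (\<Sum>\<psi>\<in>spectral_orbit \<phi>. \<theta> (ind_act s (delta \<psi> (f \<psi>))))"
      by (subst ind_carrier_expansion[OF f]) (simp only: I.\<rho>.sum \<theta>.sum)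
    also have "\<dots> = (\<Sum>\<psi>\<in>spectral_orbit \<phi>. \<rho> s (\<theta> (delta \<psi> (f \<psi>))))"
      using f by (intro sum.cong refl \<theta>_act_delta) (auto simp: ind_carrier_def)
    also have "\<dots> = \<rho> s (\<theta> f)"
      by (subst (2) ind_carrier_expansion[OF f]) (simp only: V.\<rho>.sum \<theta>.sum)
    finally show ?thesis .
  qed
  have \<theta>V: "\<theta> f \<in> carrier V" for f
    unfolding \<theta>_def by (intro V.subspace_sum[OF V.subspace_carrier] V.\<rho>_carrier)
  obtain u where u: "u \<in> carrier U" "u \<noteq> 0"
    using simple_U P.subspace_0[OF U.subspace_carrier] by (auto simp: simple_module_def)
  have "inj_on h0 (carrier U)" using h0(1) by (simp add: bij_betw_def)
  then have "h u \<noteq> 0"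
    using u hh0 h.zero P.subspace_0[OF U.subspace_carrier] by (metis inj_on_contraD)
  moreover have "\<rho> (\<tau> \<phi>) (h u) = h u"
    using V.weightD[OF hw[OF u(1)] \<tau>_\<phi>] \<tau>(1)[OF orbit_\<phi>] \<tau>_\<phi>
    by (simp add: idems_star) (simp add: idems_def)
  ultimately have nz: "\<theta> (delta \<phi> u) \<noteq> 0" using \<theta>_delta[OF orbit_\<phi>] by simp
  have du: "delta \<phi> u \<in> ind_carrier" by (rule delta_carrier[OF orbit_\<phi> u(1)])
  have "{f \<in> ind_carrier. \<theta> f = 0} = {0} \<or> {f \<in> ind_carrier. \<theta> f = 0} = carrier ind_module"
  proof (rule I.simple_dichotomy[OF simple_ind_module])
    show "X.subspace {f \<in> ind_carrier. \<theta> f = 0}"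
      using subspace_ind_carrier by (auto simp: X.subspace_def \<theta>.add \<theta>.scale)
  qed (use ind_act_carrier \<theta>_act in auto)
  then have ker: "f = 0" if "f \<in> ind_carrier" "\<theta> f = 0" for f using that nz du by auto
  have "\<theta> ` ind_carrier = {0} \<or> \<theta> ` ind_carrier = carrier V"
  proof (rule V.simple_dichotomy[OF simple])
    show "\<rho> s w \<in> \<theta> ` ind_carrier" if "w \<in> \<theta> ` ind_carrier" for s w
      using that by (auto simp: ind_act_carrier simp flip: \<theta>_act)
  qed (use \<theta>V \<theta>.subspace_image[OF subspace_ind_carrier] in auto)
  then have im: "\<theta> ` ind_carrier = carrier V" using nz du by blast
  have "inj_on \<theta> ind_carrier"
  proof (rule inj_onI)
    fix f g assume "f \<in> ind_carrier" "g \<in> ind_carrier" "\<theta> f = \<theta> g"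
    then have "f - g = 0" by (intro ker) (auto simp: X.subspace_diff[OF subspace_ind_carrier] \<theta>.diff)
    then show "f = g" by simp
  qed
  then have "bij_betw \<theta> (carrier ind_module) (carrier V)" using im by (simp add: bij_betw_def)
  then show ?thesis
    by (rule module_isoI[OF nd_ind_module V])
      (simp_all add: \<theta>.add \<theta>.scale \<theta>_act V.\<rho>_eq_basis_act[OF \<theta>V])
qed

lemma induced_exists:
  fixes U :: "('s::inverse_semigroup set \<Rightarrow>\<^sub>0 'k::field, nat \<Rightarrow>\<^sub>0 'k) alg_module"
  assumes \<phi>: "\<phi> \<in> characters" "finite_index \<phi>"
    and U: "U \<in> fd_simple_modules TYPE('k) (carrier (stab_group \<phi>)) (mult (stab_group \<phi>))"
  shows "\<exists>\<sigma> \<tau>. induced \<phi> U \<sigma> \<tau>"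
proof -
  interpret nd_module pm_scale "carrier (stab_group \<phi>)" "mult (stab_group \<phi>)" U
    by (rule nd_module_fd_simple[OF U])
  obtain e where e: "e \<in> idems" "\<phi> e" using characters_nonzero[OF \<phi>(1)] by blast
  \<comment> \<open>At \<open>\<phi>\<close> itself the idempotent \<open>e\<close> is chosen,
    elsewhere any element realizing the orbit point.\<close>
  have "\<forall>\<psi>\<in>spectral_orbit \<phi>. \<exists>s. \<phi> (star s * s) \<and> spectral_act s \<phi> = \<psi> \<and> (\<psi> = \<phi> \<longrightarrow> s \<in> idems)"
  proof
    fix \<psi> assume "\<psi> \<in> spectral_orbit \<phi>"
    then obtain s where "\<phi> (star s * s)" "\<psi> = spectral_act s \<phi>" by (auto simp: spectral_orbit_def)
    moreover have "\<phi> (star e * e)" using e by (simp add: idems_star) (simp add: idems_def)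
    ultimately show "\<exists>s. \<phi> (star s * s) \<and> spectral_act s \<phi> = \<psi> \<and> (\<psi> = \<phi> \<longrightarrow> s \<in> idems)"
      using spectral_act_idem[OF \<phi>(1) e] e by (cases "\<psi> = \<phi>") auto
  qed
  then obtain \<tau> where \<tau>: "\<forall>\<psi>\<in>spectral_orbit \<phi>.
      \<phi> (star (\<tau> \<psi>) * \<tau> \<psi>) \<and> spectral_act (\<tau> \<psi>) \<phi> = \<psi> \<and> (\<psi> = \<phi> \<longrightarrow> \<tau> \<psi> \<in> idems)"
    by metis
  have mem: "stab_class \<phi> s \<in> carrier (stab_group \<phi>)" if "s \<in> stabilizer \<phi>" for s
    using that by (simp add: carrier_stab_group)
  show ?thesis
  proof (rule global_basis_act[OF stab_group_closed[OF \<phi>(1)]])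
    fix \<sigma>0
    assume \<sigma>0: "\<And>X. X \<in> carrier (stab_group \<phi>) \<Longrightarrow> Vector_Spaces.linear pm_scale pm_scale (\<sigma>0 X)"
      "\<And>X Y v. X \<in> carrier (stab_group \<phi>) \<Longrightarrow> Y \<in> carrier (stab_group \<phi>) \<Longrightarrow>
         \<sigma>0 (mult (stab_group \<phi>) X Y) v = \<sigma>0 X (\<sigma>0 Y v)"
      "\<And>X v. X \<in> carrier (stab_group \<phi>) \<Longrightarrow> \<sigma>0 X v \<in> carrier U"
      "\<And>X v. X \<in> carrier (stab_group \<phi>) \<Longrightarrow> v \<in> carrier U \<Longrightarrow> \<sigma>0 X v = basis_act U X v"
    have "induced \<phi> U (\<lambda>s. \<sigma>0 (stab_class \<phi> s)) \<tau>"
    proof (rule induced.intro)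
      show "\<sigma>0 (stab_class \<phi> (s * t)) u = \<sigma>0 (stab_class \<phi> s) (\<sigma>0 (stab_class \<phi> t) u)"
        if "s \<in> stabilizer \<phi>" "t \<in> stabilizer \<phi>" for s t u
        using \<sigma>0(2)[OF mem[OF that(1)] mem[OF that(2)]] stab_group_mult[OF \<phi>(1) that] by simp
      show "\<sigma>0 (stab_class \<phi> s) u = basis_act U (stab_class \<phi> s) u"
        if "s \<in> stabilizer \<phi>" "u \<in> carrier U" for s u
        using \<sigma>0(4)[OF mem[OF that(1)] that(2)] .
    qed (simp_all add: \<phi> U \<sigma>0(1,3) mem \<tau> spectral_orbit_refl)
    then show ?thesis by blast
  qed
qed

section \<open>Compatibility of the correspondence with isomorphism\<close>

lemma linked_module_iso:
  fixes V :: "('s::inverse_semigroup \<Rightarrow>\<^sub>0 'k::field, 'v::ab_group_add) alg_module"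
    and W :: "('s \<Rightarrow>\<^sub>0 'k, 'w::ab_group_add) alg_module"
  assumes V: "nd_module scale1 UNIV (*) V"
    and iso: "module_iso scale1 scale2 UNIV V W" and linked: "linked scale1 V \<phi> U"
  shows "linked scale2 W \<phi> U"
proof -
  interpret nd_module scale1 UNIV "(*)" V by fact
  obtain k where k: "bij_betw k (carrier V) (carrier W)"
    "\<And>v v'. v \<in> carrier V \<Longrightarrow> v' \<in> carrier V \<Longrightarrow> k (v + v') = k v + k v'"
    "\<And>c v. v \<in> carrier V \<Longrightarrow> k (scale1 c v) = scale2 c (k v)"
    "\<And>a v. a \<in> semigroup_algebra UNIV \<Longrightarrow> v \<in> carrier V \<Longrightarrow> k (act V a v) = act W a (k v)"
    using iso unfolding module_iso_def by blast
  obtain h where h: "bij_betw h (carrier U) (weight_space V \<phi>)"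
    "\<And>u u'. u \<in> carrier U \<Longrightarrow> u' \<in> carrier U \<Longrightarrow> h (u + u') = h u + h u'"
    "\<And>c u. u \<in> carrier U \<Longrightarrow> h (pm_scale c u) = scale1 c (h u)"
    "\<And>s u. s \<in> stabilizer \<phi> \<Longrightarrow> u \<in> carrier U \<Longrightarrow> h (basis_act U (stab_class \<phi> s) u) = basis_act V s (h u)"
    using linked unfolding linked_def by blast
  have kact: "k (basis_act V s v) = basis_act W s (k v)" if "v \<in> carrier V" for s v
    using k(4)[OF _ that] by (simp add: single_in_semigroup_algebra)
  have inj: "inj_on k (carrier V)" and im: "k ` carrier V = carrier W" using k(1) by (auto simp: bij_betw_def)
  have k0: "k 0 = 0" using k(2)[of 0 0] subspace_0[OF subspace_carrier] by simp
  have iff: "k v \<in> weight_space W \<phi> \<longleftrightarrow> v \<in> weight_space V \<phi>" if v: "v \<in> carrier V" for v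
  proof -
    have "basis_act W e (k v) = (if \<phi> e then k v else 0) \<longleftrightarrow> basis_act V e v = (if \<phi> e then v else 0)" for e
    proof -
      have "(if \<phi> e then k v else 0) = k (if \<phi> e then v else 0)" by (simp add: k0)
      moreover have "basis_act V e v \<in> carrier V" "(if \<phi> e then v else 0) \<in> carrier V"
        using v subspace_0[OF subspace_carrier] by (auto simp: basis_act_closed)
      ultimately show ?thesis
        using inj_on_eq_iff[OF inj, of "basis_act V e v" "if \<phi> e then v else 0"] kact[OF v, of e] by simp
    qed
    then show ?thesis using v im by (auto simp: weight_space_def)
  qed
  have sub: "weight_space V \<phi> \<subseteq> carrier V" "weight_space W \<phi> \<subseteq> carrier W"
    by (auto simp: weight_space_def)
  have "k ` weight_space V \<phi> = weight_space W \<phi>"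
  proof (intro equalityI subsetI)
    fix w assume "w \<in> weight_space W \<phi>"
    moreover then obtain v where "v \<in> carrier V" "w = k v" using sub(2) im by blast
    ultimately show "w \<in> k ` weight_space V \<phi>" using iff by blast
  qed (use iff sub in blast)
  then have "bij_betw k (weight_space V \<phi>) (weight_space W \<phi>)"
    using inj_on_subset[OF inj sub(1)] by (simp add: bij_betw_def)
  from bij_betw_trans[OF h(1) this] have bij: "bij_betw (k \<circ> h) (carrier U) (weight_space W \<phi>)" .
  have hV: "h u \<in> carrier V" if "u \<in> carrier U" for u
    using that h(1) sub(1) by (auto simp: bij_betw_def)
  show ?thesis
    unfolding linked_def
    by (intro exI[of _ "k \<circ> h"] conjI bij) (simp_all add: h(2-4) k(2,3) hV kact)
qed

text \<open>Two group modules linked to \<open>V\<close> at \<open>\<phi>\<close> are copies of the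
  same weight space, so one identification followed by the inverse of the other is an isomorphism.
  Conversely, an identification may be composed with an isomorphism.\<close>

lemma linked_iso_iff:
  fixes U U' :: "('s::inverse_semigroup set \<Rightarrow>\<^sub>0 'k::field, nat \<Rightarrow>\<^sub>0 'k) alg_module"
  assumes \<phi>: "\<phi> \<in> characters"
    and U: "U \<in> fd_simple_modules TYPE('k) (carrier (stab_group \<phi>)) (mult (stab_group \<phi>))"
    and U': "U' \<in> fd_simple_modules TYPE('k) (carrier (stab_group \<phi>)) (mult (stab_group \<phi>))"
    and linked: "linked scale V \<phi> U"
  shows "linked scale V \<phi> U' \<longleftrightarrow> module_iso pm_scale pm_scale (carrier (stab_group \<phi>)) U U'"
proof -
  have nd: "nd_module pm_scale (carrier (stab_group \<phi>)) (mult (stab_group \<phi>)) U"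
    "nd_module pm_scale (carrier (stab_group \<phi>)) (mult (stab_group \<phi>)) U'"
    by (rule nd_module_fd_simple[OF U], rule nd_module_fd_simple[OF U'])
  interpret U: nd_module pm_scale "carrier (stab_group \<phi>)" "mult (stab_group \<phi>)" U by (rule nd)
  interpret U': nd_module pm_scale "carrier (stab_group \<phi>)" "mult (stab_group \<phi>)" U' by (rule nd)
  have mem: "stab_class \<phi> s \<in> carrier (stab_group \<phi>)" if "s \<in> stabilizer \<phi>" for s
    using that by (simp add: carrier_stab_group)
  obtain h where h: "bij_betw h (carrier U) (weight_space V \<phi>)"
    "\<And>u u'. u \<in> carrier U \<Longrightarrow> u' \<in> carrier U \<Longrightarrow> h (u + u') = h u + h u'"
    "\<And>c u. u \<in> carrier U \<Longrightarrow> h (pm_scale c u) = scale c (h u)"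
    "\<And>s u. s \<in> stabilizer \<phi> \<Longrightarrow> u \<in> carrier U \<Longrightarrow> h (basis_act U (stab_class \<phi> s) u) = basis_act V s (h u)"
    using linked unfolding linked_def by blast
  show ?thesis
  proof
    assume "linked scale V \<phi> U'"
    then obtain h' where h': "bij_betw h' (carrier U') (weight_space V \<phi>)"
      "\<And>u u'. u \<in> carrier U' \<Longrightarrow> u' \<in> carrier U' \<Longrightarrow> h' (u + u') = h' u + h' u'"
      "\<And>c u. u \<in> carrier U' \<Longrightarrow> h' (pm_scale c u) = scale c (h' u)"
      "\<And>s u. s \<in> stabilizer \<phi> \<Longrightarrow> u \<in> carrier U' \<Longrightarrow> h' (basis_act U' (stab_class \<phi> s) u) = basis_act V s (h' u)"
      unfolding linked_def by blast
    define g where "g u = inv_into (carrier U') h' (h u)" for u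
    have "bij_betw (inv_into (carrier U') h' \<circ> h) (carrier U) (carrier U')"
      by (rule bij_betw_trans[OF h(1) bij_betw_inv_into[OF h'(1)]])
    then have bij: "bij_betw g (carrier U) (carrier U')" by (simp add: g_def[abs_def] comp_def)
    have gU: "g u \<in> carrier U'" if "u \<in> carrier U" for u using bij that by (auto simp: bij_betw_def)
    have hg: "h' (g u) = h u" if "u \<in> carrier U" for u
    proof -
      have "h u \<in> h' ` carrier U'" using that h(1) h'(1) by (auto simp: bij_betw_def)
      then show ?thesis unfolding g_def by (rule f_inv_into_f)
    qed
    have eqI: "x = y" if "x \<in> carrier U'" "y \<in> carrier U'" "h' x = h' y" for x y
      using that h'(1) by (auto simp: bij_betw_def inj_on_def)
    show "module_iso pm_scale pm_scale (carrier (stab_group \<phi>)) U U'"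
    proof (rule module_isoI[OF nd bij])
      fix u u' assume u: "u \<in> carrier U" "u' \<in> carrier U"
      then show "g (u + u') = g u + g u'"
        by (intro eqI) (simp_all add: gU hg h h' U.subspace_add[OF U.subspace_carrier]
            U.subspace_add[OF U'.subspace_carrier])
    next
      fix c u assume u: "u \<in> carrier U"
      then show "g (pm_scale c u) = pm_scale c (g u)"
        by (intro eqI) (simp_all add: gU hg h h' U.subspace_scale[OF U.subspace_carrier]
            U.subspace_scale[OF U'.subspace_carrier])
    next
      fix X u assume X: "X \<in> carrier (stab_group \<phi>)" and u: "u \<in> carrier U"
      then obtain s where s: "s \<in> stabilizer \<phi>" "X = stab_class \<phi> s" by (auto simp: carrier_stab_group)
      show "g (basis_act U X u) = basis_act U' X (g u)"
        using u X s(1) unfolding s(2)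
        by (intro eqI) (simp_all add: gU hg h h' U.basis_act_closed U'.basis_act_closed)
    qed
  next
    assume "module_iso pm_scale pm_scale (carrier (stab_group \<phi>)) U U'"
    then have "module_iso pm_scale pm_scale (carrier (stab_group \<phi>)) U' U" by (rule module_iso_sym[OF nd(1)])
    then obtain k where k: "bij_betw k (carrier U') (carrier U)"
      "\<And>v v'. v \<in> carrier U' \<Longrightarrow> v' \<in> carrier U' \<Longrightarrow> k (v + v') = k v + k v'"
      "\<And>c v. v \<in> carrier U' \<Longrightarrow> k (pm_scale c v) = pm_scale c (k v)"
      "\<And>a v. a \<in> semigroup_algebra (carrier (stab_group \<phi>)) \<Longrightarrow> v \<in> carrier U' \<Longrightarrow> k (act U' a v) = act U a (k v)"
      unfolding module_iso_def by blast
    have kU: "k u \<in> carrier U" if "u \<in> carrier U'" for u using k(1) that by (auto simp: bij_betw_def)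
    show "linked scale V \<phi> U'"
      unfolding linked_def
      by (intro exI[of _ "h \<circ> k"] conjI bij_betw_trans[OF k(1) h(1)])
        (simp_all add: k h kU single_in_semigroup_algebra mem)
  qed
qed

text \<open>Turns a correspondence without canonical choices into a bijection of classes. The
  assumption \<open>total\<close> gives a map, \<open>surj\<close> its surjectivity, and the two
  directions of \<open>compat\<close> its independence of representatives and its
  injectivity.\<close>

lemma quotient_bij_betw_Sigma:
  assumes A: "equiv A r" and B: "\<And>i. i \<in> D \<Longrightarrow> equiv (B i) (q i)"
    and total: "\<And>a. a \<in> A \<Longrightarrow> \<exists>i\<in>D. \<exists>b\<in>B i. L a i b"
    and surj: "\<And>i b. i \<in> D \<Longrightarrow> b \<in> B i \<Longrightarrow> \<exists>a\<in>A. L a i b"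
    and compat: "\<And>a i b a' i' b'. a \<in> A \<Longrightarrow> a' \<in> A \<Longrightarrow> i \<in> D \<Longrightarrow> i' \<in> D \<Longrightarrow> b \<in> B i \<Longrightarrow> b' \<in> B i' \<Longrightarrow>
      L a i b \<Longrightarrow> L a' i' b' \<Longrightarrow> (a, a') \<in> r \<longleftrightarrow> i = i' \<and> (b, b') \<in> q i"
  shows "\<exists>F. bij_betw F (A // r) (SIGMA i:D. B i // q i)"
proof -
  obtain \<iota> \<beta> where \<iota>: "\<And>a. a \<in> A \<Longrightarrow> \<iota> a \<in> D" "\<And>a. a \<in> A \<Longrightarrow> \<beta> a \<in> B (\<iota> a)" "\<And>a. a \<in> A \<Longrightarrow> L a (\<iota> a) (\<beta> a)"
    using total by metis
  define G where "G a = (\<iota> a, q (\<iota> a) `` {\<beta> a})" for a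
  have G_iff: "G a = G a' \<longleftrightarrow> (a, a') \<in> r" if "a \<in> A" "a' \<in> A" for a a'
  proof -
    have "(a, a') \<in> r \<longleftrightarrow> \<iota> a = \<iota> a' \<and> (\<beta> a, \<beta> a') \<in> q (\<iota> a)"
      using that by (intro compat \<iota>)
    moreover have "(\<beta> a, \<beta> a') \<in> q (\<iota> a) \<longleftrightarrow> q (\<iota> a) `` {\<beta> a} = q (\<iota> a) `` {\<beta> a'}" if "\<iota> a = \<iota> a'"
      using eq_equiv_class_iff[OF B[OF \<iota>(1)[OF \<open>a \<in> A\<close>]], of "\<beta> a" "\<beta> a'"]
        \<iota>(2)[OF \<open>a \<in> A\<close>] \<iota>(2)[OF \<open>a' \<in> A\<close>] that by simp
    ultimately show ?thesis by (cases "\<iota> a = \<iota> a'") (simp_all add: G_def)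
  qed
  define F where "F X = G (SOME a. a \<in> X)" for X
  have F: "F (r `` {a}) = G a" if a: "a \<in> A" for a
  proof -
    have "(SOME x. x \<in> r `` {a}) \<in> r `` {a}"
      using equiv_class_self[OF A a] by (rule someI)
    then have "(a, SOME x. x \<in> r `` {a}) \<in> r" by blast
    moreover then have "(SOME x. x \<in> r `` {a}) \<in> A" using A a by (meson equiv_class_eq_iff)
    ultimately show ?thesis using G_iff a unfolding F_def by metis
  qed
  have "bij_betw F (A // r) (SIGMA i:D. B i // q i)"
    unfolding bij_betw_def
  proof
    show "inj_on F (A // r)"
    proof (rule inj_onI)
      fix X Y assume "X \<in> A // r" "Y \<in> A // r" and eq: "F X = F Y"
      then obtain a b where ab: "a \<in> A" "X = r `` {a}" "b \<in> A" "Y = r `` {b}" by (auto elim!: quotientE)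
      then have "(a, b) \<in> r" using eq F G_iff by metis
      then show "X = Y" unfolding ab by (rule equiv_class_eq[OF A])
    qed
    show "F ` (A // r) = (SIGMA i:D. B i // q i)"
    proof (intro equalityI subsetI)
      fix y assume "y \<in> F ` (A // r)"
      then obtain a where "a \<in> A" "y = G a" using F by (auto elim!: quotientE)
      then show "y \<in> (SIGMA i:D. B i // q i)" using \<iota> by (auto simp: G_def intro: quotientI)
    next
      fix y assume "y \<in> (SIGMA i:D. B i // q i)"
      then obtain i b where ib: "i \<in> D" "b \<in> B i" "y = (i, q i `` {b})" by (auto elim!: quotientE)
      obtain a where a: "a \<in> A" "L a i b" using surj[OF ib(1,2)] by blast
      have "(a, a) \<in> r" using equiv_class_self[OF A a(1)] by simp
      \<comment> \<open>Here \<open>compat\<close> is applied with \<open>a\<close> in both places: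
        the given partner of \<open>a\<close> and the chosen one must be equivalent.\<close>
      then have "i = \<iota> a" "(b, \<beta> a) \<in> q i"
        using compat[OF a(1) a(1) ib(1) \<iota>(1)[OF a(1)] ib(2) \<iota>(2)[OF a(1)] a(2) \<iota>(3)[OF a(1)]] by blast+
      then have "y = G a" using equiv_class_eq[OF B[OF ib(1)]] ib(3) by (auto simp: G_def)
      then have "y = F (r `` {a})" using F[OF a(1)] by simp
      then show "y \<in> F ` (A // r)" using quotientI[OF a(1)] by blast
    qed
  qed
  then show ?thesis by (rule exI[of _ F])
qed

lemma equiv_fd_simple_modules:
  fixes M :: "'g set"
  shows "equiv (fd_simple_modules TYPE('k::field) M m)
    {(V, W). V \<in> fd_simple_modules TYPE('k) M m \<and> W \<in> fd_simple_modules TYPE('k) M m \<and>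
      module_iso pm_scale pm_scale M V W}"
proof (rule equivI)
  show "sym {(V, W). V \<in> fd_simple_modules TYPE('k) M m \<and> W \<in> fd_simple_modules TYPE('k) M m \<and>
      module_iso pm_scale pm_scale M V W}"
    by (auto intro!: symI intro: module_iso_sym[OF nd_module_fd_simple])
qed (auto intro!: refl_onI transI intro: module_iso_refl module_iso_trans)

theorem theorem6p27:
  fixes D :: "('s::inverse_semigroup \<Rightarrow> bool) set"
  assumes "D \<subseteq> {\<phi> \<in> characters. finite_index \<phi>}"
    and "\<And>\<phi>. \<phi> \<in> characters \<Longrightarrow> finite_index \<phi> \<Longrightarrow> \<exists>!\<psi>. \<psi> \<in> D \<and> \<psi> \<in> spectral_orbit \<phi>"
  shows "\<exists>F. bij_betw F
    (fd_simple_classes TYPE('k::field) (UNIV :: 's set) (*))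
    (SIGMA \<phi>:D. fd_simple_classes TYPE('k)
       (carrier (max_group_image (stabilizer \<phi>))) (mult (max_group_image (stabilizer \<phi>))))"
  unfolding fd_simple_classes_def
proof (rule quotient_bij_betw_Sigma[where L = "linked pm_scale", OF equiv_fd_simple_modules equiv_fd_simple_modules])
  have D: "\<phi> \<in> characters" "finite_index \<phi>" if "\<phi> \<in> D" for \<phi> using assms(1) that by auto
  note nd = nd_module_fd_simple
  have simple: "simple_module pm_scale UNIV (*) V" and fin: "finite_dim_module pm_scale V"
    if "V \<in> fd_simple_modules TYPE('k) (UNIV :: 's set) (*)" for V
    using that by (auto simp: fd_simple_modules_def)
  have nonzero: "weight_space V \<phi> \<noteq> {0}"
    if \<phi>: "\<phi> \<in> D" and U: "U \<in> fd_simple_modules TYPE('k) (carrier (stab_group \<phi>)) (mult (stab_group \<phi>))"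
      and linked: "linked pm_scale V \<phi> U"
    for V :: "('s \<Rightarrow>\<^sub>0 'k, nat \<Rightarrow>\<^sub>0 'k) alg_module" and \<phi> U
  proof
    obtain h where h: "bij_betw h (carrier U) (weight_space V \<phi>)" using linked by (auto simp: linked_def)
    assume "weight_space V \<phi> = {0}"
    \<comment> \<open>A carrier with one element is the zero space, which simplicity of
      \<open>U\<close> excludes.\<close>
    then have "\<exists>u. carrier U = {u}" using h bij_betw_same_card[OF h] by (simp add: card_1_singleton_iff)
    moreover obtain \<sigma> \<tau> where "induced \<phi> U \<sigma> \<tau>" using induced_exists[OF D[OF \<phi>] U] by blast
    then interpret induced \<phi> U \<sigma> \<tau> .
    have "0 \<in> carrier U" by (rule P.subspace_0[OF U.subspace_carrier])
    ultimately show False using simple_U by (auto simp: simple_module_def)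
  qed
  show "\<exists>\<phi>\<in>D. \<exists>U\<in>fd_simple_modules TYPE('k) (carrier (stab_group \<phi>)) (mult (stab_group \<phi>)). linked pm_scale V \<phi> U"
    if V: "V \<in> fd_simple_modules TYPE('k) (UNIV :: 's set) (*)" for V
  proof -
    from inv_module_exists[OF nd[OF V]] obtain \<rho> where "inv_module pm_scale \<rho> V" ..
    then interpret inv_module pm_scale \<rho> V .
    obtain \<phi> where \<phi>: "\<phi> \<in> characters" "weight \<phi> \<noteq> {0}" using weight_exists[OF simple[OF V] fin[OF V]] by blast
    have "finite_index \<phi>" by (rule finite_index_weight[OF fin[OF V] \<phi>])
    \<comment> \<open>The weight found need not belong to \<open>D\<close>; its orbit representative
      in \<open>D\<close> is a weight as well.\<close>
    then obtain \<psi> where \<psi>: "\<psi> \<in> D" "\<psi> \<in> spectral_orbit \<phi>" using assms(2)[OF \<phi>(1)] by blast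
    then obtain s where "\<phi> (star s * s)" "\<psi> = spectral_act s \<phi>" by (auto simp: spectral_orbit_def)
    then have "weight \<psi> \<noteq> {0}" using weight_act_nonzero[OF \<phi>(2)] by simp
    then show ?thesis
      using linked_weight_space[OF V D(1)[OF \<psi>(1)]] weight_eq_weight_space[OF D(1)[OF \<psi>(1)]] \<psi>(1) by auto
  qed
  show "\<exists>V\<in>fd_simple_modules TYPE('k) (UNIV :: 's set) (*). linked pm_scale V \<phi> U"
    if \<phi>: "\<phi> \<in> D" and U: "U \<in> fd_simple_modules TYPE('k) (carrier (stab_group \<phi>)) (mult (stab_group \<phi>))" for \<phi> U
  proof -
    obtain \<sigma> \<tau> where "induced \<phi> U \<sigma> \<tau>" using induced_exists[OF D[OF \<phi>] U] by blast
    then interpret induced \<phi> U \<sigma> \<tau> .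
    \<comment> \<open>The induced module consists of functions on predicates. A copy in the fixed
      ambient space replaces it, and \<open>linked\<close> passes along the isomorphism.\<close>
    obtain V where V: "V \<in> fd_simple_modules TYPE('k) (UNIV :: 's set) (*)"
        "module_iso ind_scale pm_scale UNIV ind_module V"
      using finite_dim_simple_module_model[OF X.vector_space_axioms simple_ind_module finite_dim_ind_module] by blast
    then show ?thesis using linked_module_iso[OF nd_ind_module V(2) linked_ind_module] by blast
  qed
  fix V \<phi> U V' \<phi>' U'
  assume V: "V \<in> fd_simple_modules TYPE('k) (UNIV :: 's set) (*)" "V' \<in> fd_simple_modules TYPE('k) (UNIV :: 's set) (*)"
    and \<phi>: "\<phi> \<in> D" "\<phi>' \<in> D"
    and U: "U \<in> fd_simple_modules TYPE('k) (carrier (stab_group \<phi>)) (mult (stab_group \<phi>))"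
    and U': "U' \<in> fd_simple_modules TYPE('k) (carrier (stab_group \<phi>')) (mult (stab_group \<phi>'))"
    and L: "linked pm_scale V \<phi> U" "linked pm_scale V' \<phi>' U'"
  have "module_iso pm_scale pm_scale UNIV V V' \<longleftrightarrow>
      \<phi> = \<phi>' \<and> module_iso pm_scale pm_scale (carrier (stab_group \<phi>)) U U'"
  proof
    assume "module_iso pm_scale pm_scale UNIV V V'"
    then have L': "linked pm_scale V' \<phi> U" using linked_module_iso[OF nd[OF V(1)] _ L(1)] by blast
    from inv_module_exists[OF nd[OF V(2)]] obtain \<rho> where "inv_module pm_scale \<rho> V'" ..
    then interpret inv_module pm_scale \<rho> V' .
    have "weight \<phi> \<noteq> {0}" "weight \<phi>' \<noteq> {0}"
      using nonzero[OF \<phi>(1) U L'] nonzero[OF \<phi>(2) U' L(2)] weight_eq_weight_space D(1) \<phi> by auto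
    \<comment> \<open>Both characters are weights of the simple module \<open>V'\<close>, hence
      share an orbit, and \<open>D\<close> contains only one point of it.\<close>
    then have "\<phi>' \<in> spectral_orbit \<phi>"
      using weight_orbit[OF simple[OF V(2)]] D(1) \<phi> by blast
    then have eq: "\<phi> = \<phi>'"
      using assms(2)[OF D[OF \<phi>(1)]] \<phi> spectral_orbit_refl[OF D(1)[OF \<phi>(1)]] by blast
    then show "\<phi> = \<phi>' \<and> module_iso pm_scale pm_scale (carrier (stab_group \<phi>)) U U'"
      using linked_iso_iff[OF D(1)[OF \<phi>(1)] U _ L'] U' L(2) by simp
  next
    assume iso: "\<phi> = \<phi>' \<and> module_iso pm_scale pm_scale (carrier (stab_group \<phi>)) U U'"
    then have U'\<phi>: "U' \<in> fd_simple_modules TYPE('k) (carrier (stab_group \<phi>)) (mult (stab_group \<phi>))"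
      using U' by simp
    have L': "linked pm_scale V \<phi> U'" using linked_iso_iff[OF D(1)[OF \<phi>(1)] U U'\<phi> L(1)] iso by blast
    obtain \<sigma> \<tau> where "induced \<phi> U' \<sigma> \<tau>" using induced_exists[OF D[OF \<phi>(1)] U'\<phi>] by blast
    then interpret induced \<phi> U' \<sigma> \<tau> .
    \<comment> \<open>Both modules are compared with the one induced from \<open>U'\<close>, to
      which each is linked.\<close>
    have "module_iso ind_scale pm_scale UNIV ind_module V" "module_iso ind_scale pm_scale UNIV ind_module V'"
      using ind_module_iso[OF vector_space_pm_scale simple] V L' L(2) iso by auto
    then show "module_iso pm_scale pm_scale UNIV V V'"
      using module_iso_sym[OF nd_ind_module] module_iso_trans by blast
  qed
  then show "(V, V') \<in> {(V, W). V \<in> fd_simple_modules TYPE('k) (UNIV :: 's set) (*) \<and>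
        W \<in> fd_simple_modules TYPE('k) UNIV (*) \<and> module_iso pm_scale pm_scale UNIV V W} \<longleftrightarrow>
      \<phi> = \<phi>' \<and> (U, U') \<in> {(V, W).
        V \<in> fd_simple_modules TYPE('k) (carrier (stab_group \<phi>)) (mult (stab_group \<phi>)) \<and>
        W \<in> fd_simple_modules TYPE('k) (carrier (stab_group \<phi>)) (mult (stab_group \<phi>)) \<and>
        module_iso pm_scale pm_scale (carrier (stab_group \<phi>)) V W}"
    using V U U' by auto
qed

end
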